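(* Let $n\ge 3$, let $1\le p<n$, let $F$ be a Minkowski norm on $\mathbb{R}^n$, let $\vec b=(\beta_1,\dots,\beta_p)$ be a sequence of linearly independent 1-forms on $\mathbb{R}^n$, let $\phi$ be a smooth positive function of $p$ variables with $\phi\neq 1$ (that is, $\phi$ does not take the value $1$), and suppose that $\bar F=T_{\vec b,\phi}(F)$ is a Minkowski norm. If the function $\tilde F=|\bar F^2-F^2|^{1/2}$ is a C-reducible Minkowski norm, then $\tilde F$ is a Randers norm on $\mathbb{R}^n$, and $F=T_{\vec b,\phi_1}(\tilde F)$ and $\bar F=T_{\vec b,\phi_2}(\tilde F)$ for some function $\phi_1$ of $p$ variables and $\phi_2(s)=\phi_1(s)\,\phi\big(s/\phi_1(s)\big)$.
   Context: A Minkowski norm on $\mathbb{R}^n$ ($n>1$) is a function $F:\mathbb{R}^n\to[0,\infty)$ that is $C^\infty$ on $\mathbb{R}^n\setminus\{0\}$, satisfies $F(\lambda y)=\lambda F(y)$ for $\lambda>0$, and such that for every $y\ne 0$ the symmetric bilinear form $g_y(u,v)=\frac12\frac{\partial^2}{\partial s\,\partial t}[F^2(y+su+tv)]_{|s=t=0}$ is positive definite. 1-forms on $\mathbb{R}^n$ are linear functionals. For a Minkowski norm $F$, a 1-form $\beta$ has norm $F(\beta)=\sup_{y\neq 0}|\beta(y)|/F(y)$. Given linearly independent 1-forms $\vec b=(\beta_1,\dots,\beta_p)$, $p\le n$, and a smooth function $\phi:\prod_{i=1}^p[-\delta_i,\delta_i]\to(0,\infty)$ with $F(\beta_i)<\delta_i$,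 the $T_{\vec b,\phi}$-deformation of $F$ is $T_{\vec b,\phi}(F)=F\cdot\phi(s)$, $s=(s_1,\dots,s_p)$, $s_i=\beta_i/F$. Standing assumption on deformations: $\phi-\sum_i s_i\,\partial\phi/\partial s_i>0$. Cartan torsion in linear coordinates: $g_{ij}=\frac12[F^2]_{y^iy^j}$, $C_{ijk}=\frac14[F^2]_{y^iy^jy^k}$ (at $y\neq0$); mean Cartan torsion $C_k=g^{ij}C_{ijk}$; angular metric $K_{ij}=F\,F_{y^iy^j}$. A Minkowski norm on $\mathbb{R}^n$, $n\ge3$, is C-reducible if $C_{ijk}=\frac1{n+1}(K_{ij}C_k+K_{jk}C_i+K_{ki}C_j)$. A Randers norm is a norm of the form $\alpha+\beta$, where $\alpha$ is a Euclidean norm (the norm of an inner product) and $\beta$ is a 1-form with $\alpha(\beta)<1$. *)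

theory Defs
  imports "HOL-Analysis.Analysis"
begin

definition partial_deriv :: "'n::finite \<Rightarrow> (real^'n \<Rightarrow> real) \<Rightarrow> real^'n \<Rightarrow> real" where
  "partial_deriv i f x = deriv (\<lambda>t. f (x + t *\<^sub>R axis i 1)) 0"

text \<open>The two notions below are meant for open sets \<open>S\<close>.\<close>

primrec Ck_on :: "nat \<Rightarrow> (real^'n::finite) set \<Rightarrow> (real^'n \<Rightarrow> real) \<Rightarrow> bool" where
  "Ck_on 0 S f \<longleftrightarrow> continuous_on S f"
| "Ck_on (Suc k) S f \<longleftrightarrow>
     (\<forall>x\<in>S. f differentiable (at x)) \<and> (\<forall>i. Ck_on k S (partial_deriv i f))"

definition smooth_on :: "(real^'n::finite) set \<Rightarrow> (real^'n \<Rightarrow> real) \<Rightarrow> bool" where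
  "smooth_on S f \<longleftrightarrow> (\<forall>k. Ck_on k S f)"

definition fundamental_form ::
    "(real^'n::finite \<Rightarrow> real) \<Rightarrow> real^'n \<Rightarrow> real^'n \<Rightarrow> real^'n \<Rightarrow> real" where
  "fundamental_form F y u v =
     1/2 * deriv (\<lambda>s. deriv (\<lambda>t. (F (y + s *\<^sub>R u + t *\<^sub>R v))\<^sup>2) 0) 0"

text \<open>Symmetry and bilinearity of \<open>fundamental_form F y\<close> are consequences of smoothness, so
  positive definiteness is the only condition on it.\<close>

definition minkowski_norm :: "(real^'n::finite \<Rightarrow> real) \<Rightarrow> bool" where
  "minkowski_norm F \<longleftrightarrow>
     1 < CARD('n) \<and>
     (\<forall>y. 0 \<le> F y) \<and>
     smooth_on (- {0}) F \<and>
     (\<forall>c y. 0 < c \<longrightarrow> F (c *\<^sub>R y) = c * F y) \<and>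
     (\<forall>y u. y \<noteq> 0 \<longrightarrow> u \<noteq> 0 \<longrightarrow> 0 < fundamental_form F y u u)"

text \<open>1-forms are elements of \<^typ>\<open>(real^'n) \<Rightarrow>\<^sub>L real\<close>: every linear functional on a
  finite-dimensional space is bounded.\<close>

definition dual_norm :: "(real^'n::finite \<Rightarrow> real) \<Rightarrow> ((real^'n) \<Rightarrow>\<^sub>L real) \<Rightarrow> real" where
  "dual_norm F \<beta> = (SUP y\<in>- {0}. \<bar>blinfun_apply \<beta> y\<bar> / F y)"

text \<open>At \<open>y = 0\<close> the value is \<open>0\<close> whenever \<open>F 0 = 0\<close>, whatever \<open>\<phi>\<close> is.\<close>

definition deform ::
    "('p::finite \<Rightarrow> ((real^'n::finite) \<Rightarrow>\<^sub>L real)) \<Rightarrow> (real^'p \<Rightarrow> real) \<Rightarrow>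
     (real^'n \<Rightarrow> real) \<Rightarrow> real^'n \<Rightarrow> real" where
  "deform b \<phi> F y = F y * \<phi> (\<chi> i. blinfun_apply (b i) y / F y)"

text \<open>The domain of \<open>\<phi>\<close> is the box \<open>\<Prod>\<^sub>i [-\<delta>\<^sub>i, \<delta>\<^sub>i]\<close>; smoothness on the closed box means
  smoothness on an open neighbourhood of it.\<close>

definition deformation_function ::
    "(real^'n::finite \<Rightarrow> real) \<Rightarrow> ('p::finite \<Rightarrow> ((real^'n) \<Rightarrow>\<^sub>L real)) \<Rightarrow>
     real^'p \<Rightarrow> (real^'p \<Rightarrow> real) \<Rightarrow> bool" where
  "deformation_function F b \<delta> \<phi> \<longleftrightarrow>
     (\<forall>i. dual_norm F (b i) < \<delta> $ i) \<and>
     (\<exists>U. open U \<and> cbox (- \<delta>) \<delta> \<subseteq> U \<and> smooth_on U \<phi>) \<and>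
     (\<forall>s\<in>cbox (- \<delta>) \<delta>. 0 < \<phi> s) \<and>
     (\<forall>s\<in>cbox (- \<delta>) \<delta>. 0 < \<phi> s - (\<Sum>i\<in>UNIV. s $ i * partial_deriv i \<phi> s))"

definition metric_tensor ::
    "(real^'n::finite \<Rightarrow> real) \<Rightarrow> real^'n \<Rightarrow> real^'n^'n" where
  "metric_tensor F y =
     (\<chi> i j. 1/2 * partial_deriv j (partial_deriv i (\<lambda>z. (F z)\<^sup>2)) y)"

definition cartan_torsion ::
    "(real^'n::finite \<Rightarrow> real) \<Rightarrow> real^'n \<Rightarrow> 'n \<Rightarrow> 'n \<Rightarrow> 'n \<Rightarrow> real" where
  "cartan_torsion F y i j k =
     1/4 * partial_deriv k (partial_deriv j (partial_deriv i (\<lambda>z. (F z)\<^sup>2))) y"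

definition mean_cartan_torsion ::
    "(real^'n::finite \<Rightarrow> real) \<Rightarrow> real^'n \<Rightarrow> 'n \<Rightarrow> real" where
  "mean_cartan_torsion F y k =
     (\<Sum>i\<in>UNIV. \<Sum>j\<in>UNIV. matrix_inv (metric_tensor F y) $ i $ j * cartan_torsion F y i j k)"

definition angular_metric ::
    "(real^'n::finite \<Rightarrow> real) \<Rightarrow> real^'n \<Rightarrow> 'n \<Rightarrow> 'n \<Rightarrow> real" where
  "angular_metric F y i j = F y * partial_deriv j (partial_deriv i F) y"

definition C_reducible :: "(real^'n::finite \<Rightarrow> real) \<Rightarrow> bool" where
  "C_reducible F \<longleftrightarrow>
     minkowski_norm F \<and> 3 \<le> CARD('n) \<and>
     (\<forall>y i j k. y \<noteq> 0 \<longrightarrow>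
        cartan_torsion F y i j k =
          1 / (real CARD('n) + 1) *
            (angular_metric F y i j * mean_cartan_torsion F y k +
             angular_metric F y j k * mean_cartan_torsion F y i +
             angular_metric F y k i * mean_cartan_torsion F y j))"

definition euclidean_norm :: "(real^'n::finite \<Rightarrow> real) \<Rightarrow> bool" where
  "euclidean_norm \<alpha> \<longleftrightarrow>
     (\<exists>B. bilinear B \<and> (\<forall>x y. B x y = B y x) \<and> (\<forall>x. x \<noteq> 0 \<longrightarrow> (0::real) < B x x) \<and>
          (\<forall>y. \<alpha> y = sqrt (B y y)))"

definition randers_norm :: "(real^'n::finite \<Rightarrow> real) \<Rightarrow> bool" where
  "randers_norm F \<longleftrightarrow>
     (\<exists>\<alpha> \<beta>. euclidean_norm \<alpha> \<and> dual_norm \<alpha> \<beta> < 1 \<and>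
            (\<forall>y. F y = \<alpha> y + blinfun_apply \<beta> y))"

end

theory Submission
  imports Defs
begin

text \<open>
  Two facts carry the proof. The first is the theorem of Matsumoto and Hojo in the form that
  applies to norms on the whole space: a C-reducible Minkowski norm is a Randers norm
  (\<open>C_reducible_imp_randers\<close>). The second is that a deformation that leads from one Minkowski
  norm to another can be inverted (\<open>deformation_inverse\<close>). Since \<open>\<phi>\<close> avoids the value \<open>1\<close>, the norm
  \<open>Ftilde\<close> is itself the deformation of \<open>F\<close> by the positive smooth function \<open>sqrt \<bar>\<phi>\<^sup>2 - 1\<bar>\<close>.
  Inverting it presents \<open>F\<close>, and then \<open>Fbar\<close>, as a deformation of \<open>Ftilde\<close>.

  For the first fact, write \<open>F_ij\<close> and \<open>F_ijk\<close> for the partial derivatives of \<open>F\<close>. The mean Cartan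
  torsion is half the gradient of \<open>ln \<bar>det g\<bar>\<close>, by Jacobi's formula. With the density
  \<open>\<rho> = F / \<bar>det g\<bar> powr (1/(n+1))\<close> the condition of C-reducibility therefore reads
  \<open>\<rho> F_ijk = - (F_ij \<rho>_k + F_jk \<rho>_i + F_ki \<rho>_j)\<close>. Differentiating once more and using the symmetry of
  the fourth derivatives of \<open>F\<close> yields \<open>\<rho>_ij = \<mu> F_ij\<close>, and the symmetry of the third derivatives of
  \<open>\<rho>\<close> then makes \<open>\<mu>\<close> a constant \<open>c\<close>; here \<open>n \<ge> 3\<close> enters. Substituted back, the condition says that all
  third derivatives of \<open>\<rho>\<^sup>2\<close> vanish. Hence \<open>\<rho>\<close> is a Euclidean norm, \<open>\<rho> - c F\<close> is linear, and
  \<open>F\<close> is a Euclidean norm plus a linear form. The case \<open>c = 0\<close> cannot occur, because \<open>\<rho>\<close> would be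
  both linear and positive.

  For the second fact, let \<open>Ft = F f(b/F)\<close>. Normalised vectors \<open>s = b/F\<close> and \<open>s' = b/Ft\<close> are related
  by the radial map \<open>s' = s / f s\<close>, whose radial derivative is a positive multiple of
  \<open>f s - s \<cdot> grad f s\<close>. This quantity is positive at all values \<open>s\<close> of \<open>b/F\<close>
  (\<open>deform_radial_pos\<close>): on a fibre of \<open>b\<close>, which has positive dimension since \<open>p < n\<close>, both \<open>F\<close> and
  \<open>Ft\<close> are smallest at the same point and increase away from it, and
  \<open>f s - s \<cdot> grad f s\<close> is the ratio of their derivatives. So the radial map is invertible near the
  compact set of values of \<open>b/F\<close>. The inverse has to be extended to a box, hence to points that are
  not values of \<open>b/Ft\<close>, and the extension must keep the inequality \<open>\<phi>1 - s \<cdot> grad \<phi>1 > 0\<close>. It is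
  enough to precompose the inverse with a smooth radial map of the whole space into a small
  neighbourhood of the values of \<open>b/Ft\<close> that is the identity on these values and increasing along
  rays (\<open>squeeze\<close>, \<open>radial_extension\<close>): the inequality just says that the resulting radial map is
  increasing along rays.
\<close>

section \<open>Calculus of iterated partial derivatives\<close>

text \<open>Directional derivative, written as a combination of partial derivatives so that it is linear
  in the direction without any assumption on the function.\<close>

definition dderiv :: "real^'n::finite \<Rightarrow> (real^'n \<Rightarrow> real) \<Rightarrow> real^'n \<Rightarrow> real" where
  "dderiv u f x = (\<Sum>i\<in>UNIV. u $ i * partial_deriv i f x)"

lemma partial_deriv_eqI:
  assumes "(f has_derivative f') (at x)"
  shows "partial_deriv i f x = f' (axis i 1)"
proof -
  interpret f': bounded_linear f' using assms by (rule has_derivative_bounded_linear)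
  have "((\<lambda>t. f (x + t *\<^sub>R axis i 1)) has_derivative (\<lambda>h. f' (h *\<^sub>R axis i 1))) (at 0)"
    by (rule has_derivative_compose[where g=f and g'=f'])
       (auto intro!: derivative_eq_intros simp: assms)
  hence "((\<lambda>t. f (x + t *\<^sub>R axis i 1)) has_real_derivative f' (axis i 1)) (at 0)"
    by (simp add: has_field_derivative_def f'.scaleR mult_commute_abs)
  thus ?thesis unfolding partial_deriv_def by (rule DERIV_imp_deriv)
qed

lemma has_derivative_dderiv:
  fixes f :: "real^'n::finite \<Rightarrow> real"
  assumes "f differentiable (at x)"
  shows "(f has_derivative (\<lambda>h. dderiv h f x)) (at x)"
proof -
  from assms obtain f' where f': "(f has_derivative f') (at x)"
    unfolding differentiable_def by blast
  interpret f': bounded_linear f' using f' by (rule has_derivative_bounded_linear)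
  have "f' h = dderiv h f x" for h
  proof -
    have "f' h = f' (\<Sum>i\<in>UNIV. h $ i *\<^sub>R axis i 1)"
      using basis_expansion[of h] by (simp add: scalar_mult_eq_scaleR)
    also have "\<dots> = (\<Sum>i\<in>UNIV. h $ i * f' (axis i 1))"
      by (simp add: f'.sum f'.scaleR)
    finally show ?thesis by (simp add: dderiv_def partial_deriv_eqI[OF f'])
  qed
  hence "f' = (\<lambda>h. dderiv h f x)" by blast
  with f' show ?thesis by simp
qed

lemma dderiv_eqI:
  assumes "(f has_derivative f') (at x)"
  shows "dderiv u f x = f' u"
  using has_derivative_dderiv[OF differentiableI[OF assms]] has_derivative_unique[OF assms]
  by metis

lemma dderiv_axis: "dderiv (axis i 1) f = partial_deriv i f"
proof
  fix x show "dderiv (axis i 1) f x = partial_deriv i f x"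
    by (simp add: dderiv_def axis_def if_distrib[where f="\<lambda>c. c * _"] cong: if_cong)
qed

lemma dderiv_add_left: "dderiv (u + v) f x = dderiv u f x + dderiv v f x"
  by (simp add: dderiv_def algebra_simps sum.distrib)
lemma dderiv_diff_left: "dderiv (u - v) f x = dderiv u f x - dderiv v f x"
  by (simp add: dderiv_def algebra_simps sum_subtractf)
lemma dderiv_scale_left: "dderiv (c *\<^sub>R u) f x = c * dderiv u f x"
  by (simp add: dderiv_def sum_distrib_left algebra_simps)

lemma dderiv_along_line:
  fixes f :: "real^'n::finite \<Rightarrow> real"
  assumes "f differentiable (at (x + t *\<^sub>R u))"
  shows "((\<lambda>t. f (x + t *\<^sub>R u)) has_real_derivative dderiv u f (x + t *\<^sub>R u)) (at t)"
proof -
  have "((\<lambda>t. f (x + t *\<^sub>R u)) has_derivative (\<lambda>h. dderiv (h *\<^sub>R u) f (x + t *\<^sub>R u))) (at t)"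
    by (rule has_derivative_compose[where f="\<lambda>t. x + t *\<^sub>R u" and f'="\<lambda>h. h *\<^sub>R u" and g=f
          and g'="\<lambda>h. dderiv h f (x + t *\<^sub>R u)"])
       (auto intro!: derivative_eq_intros has_derivative_dderiv[OF assms])
  thus ?thesis by (simp add: has_field_derivative_def dderiv_scale_left mult_commute_abs)
qed

lemma Ck_on_subset: "Ck_on k S f \<Longrightarrow> T \<subseteq> S \<Longrightarrow> Ck_on k T f"
  by (induction k arbitrary: f) (auto intro: continuous_on_subset)

lemma Ck_on_SucD: "Ck_on (Suc k) S f \<Longrightarrow> Ck_on k S f"
proof (induction k arbitrary: f)
  case 0
  thus ?case
    by (auto simp: continuous_at_imp_continuous_on differentiable_imp_continuous_within)
qed auto

lemma Ck_on_continuous: "Ck_on k S f \<Longrightarrow> continuous_on S f"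
  by (induction k) (auto dest: Ck_on_SucD simp del: Ck_on.simps(2))

lemma smooth_onD_diff: "smooth_on S f \<Longrightarrow> x \<in> S \<Longrightarrow> f differentiable (at x)"
  unfolding smooth_on_def by (metis Ck_on.simps(2))
lemma smooth_onD_cont: "smooth_on S f \<Longrightarrow> continuous_on S f"
  unfolding smooth_on_def using Ck_on_continuous by blast
lemma smooth_on_partial: "smooth_on S f \<Longrightarrow> smooth_on S (partial_deriv i f)"
  unfolding smooth_on_def by (metis Ck_on.simps(2))
lemma smooth_on_subset: "smooth_on S f \<Longrightarrow> T \<subseteq> S \<Longrightarrow> smooth_on T f"
  unfolding smooth_on_def using Ck_on_subset by blast

lemma partial_deriv_cong:
  assumes "open S" "x \<in> S" "\<And>y. y \<in> S \<Longrightarrow> f y = g y"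
  shows "partial_deriv i f x = partial_deriv i g x"
  unfolding partial_deriv_def
proof (rule deriv_cong_ev)
  have "((\<lambda>t. x + t *\<^sub>R axis i 1) \<longlongrightarrow> x + 0 *\<^sub>R axis i 1) (nhds (0::real))"
    by (intro tendsto_intros filterlim_ident)
  hence "eventually (\<lambda>t::real. x + t *\<^sub>R axis i 1 \<in> S) (nhds 0)"
    using assms(1,2) by (simp add: tendsto_def)
  thus "eventually (\<lambda>t::real. f (x + t *\<^sub>R axis i 1) = g (x + t *\<^sub>R axis i 1)) (nhds 0)"
    by eventually_elim (simp add: assms(3))
qed auto

lemma dderiv_cong:
  assumes "open S" "x \<in> S" "\<And>y. y \<in> S \<Longrightarrow> f y = g y"
  shows "dderiv u f x = dderiv u g x"
  unfolding dderiv_def by (intro sum.cong refl arg_cong2[where f="(*)"] partial_deriv_cong[OF assms])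

lemma differentiable_cong_open:
  fixes f g :: "'a::real_normed_vector \<Rightarrow> real"
  assumes "open S" "x \<in> S" "\<And>y. y \<in> S \<Longrightarrow> f y = g y" "f differentiable (at x)"
  shows "g differentiable (at x)"
proof -
  from assms(4) obtain f' where "(f has_derivative f') (at x)" by (auto simp: differentiable_def)
  hence "(g has_derivative f') (at x)"
    by (rule has_derivative_transform_within_open[OF _ assms(1,2)]) (simp add: assms(3))
  thus ?thesis by (auto simp: differentiable_def)
qed

text \<open>The partial derivatives of a function at a point of an open set \<open>S\<close> depend only on its
  values on \<open>S\<close>. This makes it possible to replace a partial derivative by its formula on \<open>S\<close> in
  inductions over the order of differentiability.\<close>

lemma Ck_on_cong:
  assumes "open S" "\<And>y. y \<in> S \<Longrightarrow> f y = g y" "Ck_on k S f"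
  shows "Ck_on k S g"
  using assms(2,3)
proof (induction k arbitrary: f g)
  case 0
  thus ?case by (simp add: continuous_on_cong[of S S f g])
next
  case (Suc k)
  have "Ck_on k S (partial_deriv i g)" for i
    by (rule Suc.IH[of "partial_deriv i f"])
       (use Suc.prems partial_deriv_cong[OF assms(1) _ Suc.prems(1)] in auto)
  moreover have "g differentiable (at x)" if "x \<in> S" for x
    using differentiable_cong_open[OF assms(1) that Suc.prems(1)] Suc.prems(2) that by auto
  ultimately show ?case by simp
qed

lemma smooth_on_cong:
  assumes "open S" "\<And>y. y \<in> S \<Longrightarrow> f y = g y" "smooth_on S f"
  shows "smooth_on S g"
  using assms Ck_on_cong unfolding smooth_on_def by blast

lemma Ck_on_const [simp]: "Ck_on k S (\<lambda>x. c)"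
proof (induction k arbitrary: c)
  case (Suc k)
  have "partial_deriv i (\<lambda>x. c) = (\<lambda>x. 0)" for i :: 'a
    by (intro ext) (simp add: partial_deriv_def)
  thus ?case using Suc by simp
qed simp

lemma Ck_on_add: "Ck_on k S f \<Longrightarrow> Ck_on k S g \<Longrightarrow> open S \<Longrightarrow> Ck_on k S (\<lambda>x. f x + g x)"
proof (induction k arbitrary: f g)
  case 0 thus ?case by (auto intro: continuous_on_add)
next
  case (Suc k)
  have eq: "partial_deriv i f x + partial_deriv i g x = partial_deriv i (\<lambda>x. f x + g x) x"
    if "x \<in> S" for x i
    using partial_deriv_eqI[OF has_derivative_add[OF has_derivative_dderiv has_derivative_dderiv], of f x g i]
      Suc.prems that by (simp add: dderiv_axis)
  have "Ck_on k S (partial_deriv i (\<lambda>x. f x + g x))" for i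
    by (rule Ck_on_cong[OF \<open>open S\<close> eq]) (use Suc in auto)
  thus ?case using Suc.prems by simp
qed

lemma Ck_on_mult: "Ck_on k S f \<Longrightarrow> Ck_on k S g \<Longrightarrow> open S \<Longrightarrow> Ck_on k S (\<lambda>x. f x * g x)"
proof (induction k arbitrary: f g)
  case 0 thus ?case by (auto intro: continuous_on_mult)
next
  case (Suc k)
  have eq: "f x * partial_deriv i g x + partial_deriv i f x * g x = partial_deriv i (\<lambda>x. f x * g x) x"
    if "x \<in> S" for x i
    using partial_deriv_eqI[OF has_derivative_mult[OF has_derivative_dderiv has_derivative_dderiv], of f x g i]
      Suc.prems that by (simp add: dderiv_axis)
  have "Ck_on k S (partial_deriv i (\<lambda>x. f x * g x))" for i
    by (rule Ck_on_cong[OF \<open>open S\<close> eq])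
       (use Suc in \<open>auto intro!: Ck_on_add Suc.IH dest: Ck_on_SucD simp del: Ck_on.simps(2)\<close>, 
        (use Suc in auto)[2])
  thus ?case using Suc.prems by simp
qed

lemma partial_deriv_inner: "partial_deriv i (\<lambda>x. a \<bullet> x) = (\<lambda>x. a $ i)"
  by (intro ext, subst partial_deriv_eqI[of _ "\<lambda>x. a \<bullet> x"])
     (auto intro!: derivative_eq_intros simp: inner_axis)

lemma Ck_on_inner: "Ck_on k S (\<lambda>x. a \<bullet> x)"
  by (cases k) (auto intro!: continuous_intros derivative_intros simp: partial_deriv_inner)

lemma Ck_on_sum: "(\<And>i. i \<in> I \<Longrightarrow> Ck_on k S (f i)) \<Longrightarrow> open S \<Longrightarrow> Ck_on k S (\<lambda>x. \<Sum>i\<in>I. f i x)"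
  by (induction I rule: infinite_finite_induct) (auto intro: Ck_on_add)

lemma Ck_on_prod: "(\<And>i. i \<in> I \<Longrightarrow> Ck_on k S (f i)) \<Longrightarrow> open S \<Longrightarrow> Ck_on k S (\<lambda>x. \<Prod>i\<in>I. f i x)"
  by (induction I rule: infinite_finite_induct) (auto intro: Ck_on_mult)

lemma partial_deriv_compose_real:
  fixes f :: "real^'n::finite \<Rightarrow> real"
  assumes "(g has_real_derivative g') (at (f x))" "f differentiable (at x)"
  shows "partial_deriv i (\<lambda>x. g (f x)) x = g' * partial_deriv i f x"
    and "(\<lambda>x. g (f x)) differentiable (at x)"
proof -
  have *: "((\<lambda>x. g (f x)) has_derivative (\<lambda>h. g' * dderiv h f x)) (at x)"
    by (rule has_derivative_compose[OF has_derivative_dderiv[OF assms(2)]])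
       (use assms(1) in \<open>simp add: has_field_derivative_def\<close>)
  show "partial_deriv i (\<lambda>x. g (f x)) x = g' * partial_deriv i f x"
    using partial_deriv_eqI[OF *, of i] by (simp add: dderiv_axis)
  show "(\<lambda>x. g (f x)) differentiable (at x)" using * by (rule differentiableI)
qed

text \<open>The functions \<open>g j\<close> are the successive derivatives of \<open>g 0\<close>. The chain rule leads
  from \<open>g j\<close> to \<open>g (Suc j)\<close>, so the induction runs over all \<open>j\<close> at once.\<close>

lemma Ck_on_compose_real:
  fixes g :: "nat \<Rightarrow> real \<Rightarrow> real" and f :: "real^'n::finite \<Rightarrow> real"
  assumes D: "\<And>j x. x \<in> T \<Longrightarrow> (g j has_real_derivative g (Suc j) x) (at x)"
    and "Ck_on k S f" "open S" "\<And>x. x \<in> S \<Longrightarrow> f x \<in> T"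
  shows "Ck_on k S (\<lambda>x. g j (f x))"
  using assms(2)
proof (induction k arbitrary: j)
  case 0
  have "continuous_on T (g j)" for j
    using D by (meson DERIV_isCont continuous_at_imp_continuous_on)
  thus ?case using 0 assms(4) by (auto intro: continuous_on_compose2)
next
  case (Suc k)
  have eq: "g (Suc j) (f x) * partial_deriv i f x = partial_deriv i (\<lambda>x. g j (f x)) x"
     if "x \<in> S" for x i
    using partial_deriv_compose_real(1)[of "g j" _ f x i, OF D] Suc.prems that assms(4) by simp
  have "Ck_on k S (partial_deriv i (\<lambda>x. g j (f x)))" for i
    by (rule Ck_on_cong[OF \<open>open S\<close> eq])
       (use Suc Ck_on_SucD[OF Suc.prems] assms(3) in \<open>auto intro!: Ck_on_mult\<close>)
  moreover have "(\<lambda>x. g j (f x)) differentiable (at x)" if "x \<in> S" for x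
    by (rule partial_deriv_compose_real(2)[OF D]) (use Suc.prems that assms(4) in auto)
  ultimately show ?case by simp
qed

lemma has_derivative_compose_vec:
  fixes f :: "real^'p::finite \<Rightarrow> real" and g :: "'p \<Rightarrow> real^'n::finite \<Rightarrow> real"
  assumes "f differentiable (at (\<chi> j. g j x))" "\<And>j. g j differentiable (at x)"
  shows "((\<lambda>x. f (\<chi> j. g j x)) has_derivative
     (\<lambda>h. dderiv (\<chi> j. dderiv h (g j) x) f (\<chi> j. g j x))) (at x)"
proof -
  have "((\<lambda>x. \<chi> j. g j x) has_derivative (\<lambda>h. \<chi> j. dderiv h (g j) x)) (at x)"
    by (subst has_derivative_componentwise_within)
       (auto simp: Basis_vec_def inner_axis intro!: has_derivative_dderiv[OF assms(2)])
  thus ?thesis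
    by (rule has_derivative_compose[where g=f and g'="\<lambda>h. dderiv h f (\<chi> j. g j x)"])
       (rule has_derivative_dderiv[OF assms(1)])
qed

lemma Ck_on_compose:
  fixes f :: "real^'p::finite \<Rightarrow> real" and g :: "'p \<Rightarrow> real^'n::finite \<Rightarrow> real"
  assumes "Ck_on k T f" "\<And>j. Ck_on k S (g j)" "open S" "\<And>x. x \<in> S \<Longrightarrow> (\<chi> j. g j x) \<in> T"
  shows "Ck_on k S (\<lambda>x. f (\<chi> j. g j x))"
  using assms(1,2)
proof (induction k arbitrary: f)
  case 0
  have "continuous_on S (\<lambda>x. \<chi> j. g j x)" using 0 by (auto intro: continuous_on_vec_lambda)
  thus ?case using 0 assms(4) by (auto intro: continuous_on_compose2)
next
  case (Suc k)
  have fd: "f differentiable (at (\<chi> j. g j x))" and gd: "g j differentiable (at x)" if "x \<in> S" for x j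
    using Suc.prems assms(4) that by auto
  have eq: "(\<Sum>j\<in>UNIV. partial_deriv i (g j) x * partial_deriv j f (\<chi> j. g j x)) =
      partial_deriv i (\<lambda>x. f (\<chi> j. g j x)) x" if "x \<in> S" for x i
    using partial_deriv_eqI[OF has_derivative_compose_vec[of f g x, OF fd gd], of i] that
    by (simp add: dderiv_def[where f=f] dderiv_axis)
  have "Ck_on k S (partial_deriv i (\<lambda>x. f (\<chi> j. g j x)))" for i
    by (rule Ck_on_cong[OF \<open>open S\<close> eq])
       (use Suc Ck_on_SucD[OF Suc.prems(2)] assms(3) in \<open>auto intro!: Ck_on_mult Ck_on_sum\<close>)
  moreover have "(\<lambda>x. f (\<chi> j. g j x)) differentiable (at x)" if "x \<in> S" for x
    by (rule differentiableI[OF has_derivative_compose_vec[of f g x, OF fd gd]]) (use that in auto)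
  ultimately show ?case by simp
qed

lemma Ck_on_inverse:
  fixes f :: "real^'n::finite \<Rightarrow> real"
  assumes "Ck_on k S f" "open S" "\<And>x. x \<in> S \<Longrightarrow> f x \<noteq> 0"
  shows "Ck_on k S (\<lambda>x. inverse (f x))"
  using assms(1)
proof (induction k)
  case 0 thus ?case using assms(3) by (auto intro: continuous_on_inverse)
next
  case (Suc k)
  have D: "(inverse has_real_derivative - (inverse (f x) * inverse (f x))) (at (f x))" if "x \<in> S" for x
    using DERIV_inverse[of "f x"] assms(3)[OF that] by (simp add: power2_eq_square)
  have eq: "(- 1) * ((inverse (f x) * inverse (f x)) * partial_deriv i f x) = partial_deriv i (\<lambda>x. inverse (f x)) x"
     if "x \<in> S" for x i
    using partial_deriv_compose_real(1)[of _ _ f x i, OF D] Suc.prems that by simp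
  have "Ck_on k S (\<lambda>x. (- 1) * ((inverse (f x) * inverse (f x)) * partial_deriv i f x))" for i
    using Suc Ck_on_SucD[OF Suc.prems] assms(2) by (intro Ck_on_mult Ck_on_const) auto
  hence "Ck_on k S (partial_deriv i (\<lambda>x. inverse (f x)))" for i
    by (rule Ck_on_cong[OF \<open>open S\<close> eq, rotated])
  moreover have "(\<lambda>x. inverse (f x)) differentiable (at x)" if "x \<in> S" for x
    by (rule partial_deriv_compose_real(2)[OF D]) (use Suc.prems that in auto)
  ultimately show ?case by simp
qed

lemma Ck_on_ln:
  fixes f :: "real^'n::finite \<Rightarrow> real"
  assumes "Ck_on k S f" "open S" "\<And>x. x \<in> S \<Longrightarrow> f x > 0"
  shows "Ck_on k S (\<lambda>x. ln (f x))"
proof (cases k)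
  case 0 thus ?thesis using assms by (force intro!: continuous_on_ln)
next
  case (Suc l)
  have D: "(ln has_real_derivative inverse (f x)) (at (f x))" if "x \<in> S" for x
    using DERIV_ln[of "f x"] assms(3)[OF that] by simp
  have eq: "inverse (f x) * partial_deriv i f x = partial_deriv i (\<lambda>x. ln (f x)) x"
     if "x \<in> S" for x i
    using partial_deriv_compose_real(1)[of _ _ f x i, OF D] assms(1) Suc that by simp
  have "Ck_on l S (\<lambda>x. inverse (f x) * partial_deriv i f x)" for i
    using assms Suc Ck_on_SucD[of l S f] by (intro Ck_on_mult Ck_on_inverse) force+
  hence "Ck_on l S (partial_deriv i (\<lambda>x. ln (f x)))" for i
    by (rule Ck_on_cong[OF \<open>open S\<close> eq, rotated])
  moreover have "(\<lambda>x. ln (f x)) differentiable (at x)" if "x \<in> S" for x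
    by (rule partial_deriv_compose_real(2)[OF D]) (use assms Suc that in auto)
  ultimately show ?thesis using Suc by simp
qed

lemma smooth_on_const [simp]: "smooth_on S (\<lambda>x. c)"
  by (simp add: smooth_on_def)
lemma smooth_on_add: "smooth_on S f \<Longrightarrow> smooth_on S g \<Longrightarrow> open S \<Longrightarrow> smooth_on S (\<lambda>x. f x + g x)"
  by (simp add: smooth_on_def Ck_on_add)
lemma smooth_on_mult: "smooth_on S f \<Longrightarrow> smooth_on S g \<Longrightarrow> open S \<Longrightarrow> smooth_on S (\<lambda>x. f x * g x)"
  by (simp add: smooth_on_def Ck_on_mult)
lemma smooth_on_minus: "smooth_on S f \<Longrightarrow> open S \<Longrightarrow> smooth_on S (\<lambda>x. - f x)"
  using smooth_on_mult[of S "\<lambda>x. -1" f] by simp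
lemma smooth_on_diff: "smooth_on S f \<Longrightarrow> smooth_on S g \<Longrightarrow> open S \<Longrightarrow> smooth_on S (\<lambda>x. f x - g x)"
  using smooth_on_add[of S f "\<lambda>x. - g x"] by (simp add: smooth_on_minus)
lemma smooth_on_inner: "smooth_on S (\<lambda>x. a \<bullet> x)"
  by (simp add: smooth_on_def Ck_on_inner)
lemma smooth_on_component: "smooth_on S (\<lambda>x. x $ i)"
  using smooth_on_inner[of S "axis i 1"] by (simp add: inner_axis')
lemma smooth_on_sum: "(\<And>i. i \<in> I \<Longrightarrow> smooth_on S (f i)) \<Longrightarrow> open S \<Longrightarrow> smooth_on S (\<lambda>x. \<Sum>i\<in>I. f i x)"
  by (simp add: smooth_on_def Ck_on_sum)
lemma smooth_on_prod: "(\<And>i. i \<in> I \<Longrightarrow> smooth_on S (f i)) \<Longrightarrow> open S \<Longrightarrow> smooth_on S (\<lambda>x. \<Prod>i\<in>I. f i x)"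
  by (simp add: smooth_on_def Ck_on_prod)
lemma smooth_on_power: "smooth_on S f \<Longrightarrow> open S \<Longrightarrow> smooth_on S (\<lambda>x. f x ^ n)"
  by (induction n) (auto intro: smooth_on_mult)
lemma smooth_on_inverse: "smooth_on S f \<Longrightarrow> open S \<Longrightarrow> (\<And>x. x \<in> S \<Longrightarrow> f x \<noteq> 0) \<Longrightarrow> smooth_on S (\<lambda>x. inverse (f x))"
  by (simp add: smooth_on_def Ck_on_inverse)
lemma smooth_on_divide: "smooth_on S f \<Longrightarrow> smooth_on S g \<Longrightarrow> open S \<Longrightarrow> (\<And>x. x \<in> S \<Longrightarrow> g x \<noteq> 0) \<Longrightarrow> smooth_on S (\<lambda>x. f x / g x)"
  using smooth_on_mult[OF _ smooth_on_inverse, of S f g] by (simp add: divide_inverse)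
lemma smooth_on_ln: "smooth_on S f \<Longrightarrow> open S \<Longrightarrow> (\<And>x. x \<in> S \<Longrightarrow> f x > 0) \<Longrightarrow> smooth_on S (\<lambda>x. ln (f x))"
  by (simp add: smooth_on_def Ck_on_ln)
lemma smooth_on_exp: "smooth_on S f \<Longrightarrow> open S \<Longrightarrow> smooth_on S (\<lambda>x. exp (f x))"
  unfolding smooth_on_def
  using Ck_on_compose_real[where g="\<lambda>_. exp" and T=UNIV] DERIV_exp by blast
lemma smooth_on_sqrt:
  assumes "smooth_on S f" "open S" "\<And>x. x \<in> S \<Longrightarrow> f x > 0"
  shows "smooth_on S (\<lambda>x. sqrt (f x))"
proof (rule smooth_on_cong[OF assms(2)])
  show "smooth_on S (\<lambda>x. exp (1/2 * ln (f x)))"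
    by (intro smooth_on_exp smooth_on_mult smooth_on_const smooth_on_ln assms)
  show "exp (1/2 * ln (f x)) = sqrt (f x)" if "x \<in> S" for x
  proof -
    have "1/2 * ln (f x) = ln (sqrt (f x))" using ln_sqrt[of "f x"] assms(3)[OF that] by simp
    thus ?thesis using assms(3)[OF that] by (metis exp_ln real_sqrt_gt_zero)
  qed
qed
lemma smooth_on_compose:
  fixes f :: "real^'p::finite \<Rightarrow> real" and g :: "'p \<Rightarrow> real^'n::finite \<Rightarrow> real"
  assumes "smooth_on T f" "\<And>j. smooth_on S (g j)" "open S" "\<And>x. x \<in> S \<Longrightarrow> (\<chi> j. g j x) \<in> T"
  shows "smooth_on S (\<lambda>x. f (\<chi> j. g j x))"
  using assms by (auto simp: smooth_on_def intro!: Ck_on_compose)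
lemma smooth_on_dderiv: "smooth_on S f \<Longrightarrow> open S \<Longrightarrow> smooth_on S (dderiv u f)"
  unfolding dderiv_def[abs_def] by (intro smooth_on_sum smooth_on_mult smooth_on_const smooth_on_partial)

text \<open>The mean value theorem, applied first along \<open>u\<close> and then along \<open>v\<close>, turns the second
  difference of \<open>f\<close> into an iterated derivative at a nearby point. The second difference is symmetric
  in \<open>u\<close> and \<open>v\<close>, and this is why the order of differentiation does not matter.\<close>

lemma second_difference:
  fixes f :: "real^'n::finite \<Rightarrow> real"
  assumes f: "smooth_on S f" and S: "open S" and t: "0 < t"
    and sub: "\<And>r s. 0 \<le> r \<Longrightarrow> r \<le> t \<Longrightarrow> 0 \<le> s \<Longrightarrow> s \<le> t \<Longrightarrow> x + r *\<^sub>R u + s *\<^sub>R v \<in> S"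
  shows "\<exists>r s. 0 \<le> r \<and> r \<le> t \<and> 0 \<le> s \<and> s \<le> t \<and>
    f (x + t *\<^sub>R u + t *\<^sub>R v) - f (x + t *\<^sub>R u) - f (x + t *\<^sub>R v) + f x =
      t\<^sup>2 * dderiv v (dderiv u f) (x + r *\<^sub>R u + s *\<^sub>R v)"
proof -
  define g where "g r = f (x + t *\<^sub>R v + r *\<^sub>R u) - f (x + r *\<^sub>R u)" for r
  have g': "(g has_real_derivative dderiv u f (x + t *\<^sub>R v + r *\<^sub>R u) - dderiv u f (x + r *\<^sub>R u)) (at r)"
    if "0 \<le> r" "r \<le> t" for r
    unfolding g_def
    by (intro derivative_intros dderiv_along_line smooth_onD_diff[OF f])
       (use sub[OF that, of t] sub[OF that, of 0] t in \<open>auto simp: add_ac\<close>)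
  obtain r where r: "0 < r" "r < t" "g t - g 0 = (t - 0) * (dderiv u f (x + t *\<^sub>R v + r *\<^sub>R u) - dderiv u f (x + r *\<^sub>R u))"
    using MVT2[OF t g'] by auto
  have h': "((\<lambda>s. dderiv u f (x + r *\<^sub>R u + s *\<^sub>R v)) has_real_derivative dderiv v (dderiv u f) (x + r *\<^sub>R u + s *\<^sub>R v)) (at s)"
    if "0 \<le> s" "s \<le> t" for s
    by (intro dderiv_along_line smooth_onD_diff[OF smooth_on_dderiv[OF f S]])
       (use sub[of r s] r t that in \<open>auto simp: add_ac\<close>)
  obtain s where s: "0 < s" "s < t" "dderiv u f (x + r *\<^sub>R u + t *\<^sub>R v) - dderiv u f (x + r *\<^sub>R u + 0 *\<^sub>R v)
      = (t - 0) * dderiv v (dderiv u f) (x + r *\<^sub>R u + s *\<^sub>R v)"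
    using MVT2[OF t h'] by auto
  have "g t - g 0 = t\<^sup>2 * dderiv v (dderiv u f) (x + r *\<^sub>R u + s *\<^sub>R v)"
    using r s by (simp add: power2_eq_square add_ac)
  thus ?thesis using r s unfolding g_def
    by (intro exI[of _ r] exI[of _ s]) (auto simp: add_ac algebra_simps)
qed

lemma dderiv_commute:
  fixes f :: "real^'n::finite \<Rightarrow> real"
  assumes f: "smooth_on S f" and S: "open S" and x: "x \<in> S"
  shows "dderiv u (dderiv v f) x = dderiv v (dderiv u f) x"
proof -
  have "\<bar>dderiv u (dderiv v f) x - dderiv v (dderiv u f) x\<bar> \<le> e" if e: "e > 0" for e
  proof -
    have tl: "eventually (\<lambda>y. \<bar>dderiv w (dderiv w' f) y - dderiv w (dderiv w' f) x\<bar> < e/2) (nhds x)" for w w'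
    proof -
      have "continuous_on S (dderiv w (dderiv w' f))"
        by (intro smooth_onD_cont smooth_on_dderiv f S)
      hence "isCont (dderiv w (dderiv w' f)) x" using S x by (simp add: continuous_on_eq_continuous_at)
      hence "(dderiv w (dderiv w' f) \<longlongrightarrow> dderiv w (dderiv w' f) x) (nhds x)"
        by (simp add: isCont_def tendsto_nhds_iff)
      from tendstoD[OF this, of "e/2"] e show ?thesis by (simp add: dist_real_def)
    qed
    have "eventually (\<lambda>y. y \<in> S \<and> \<bar>dderiv u (dderiv v f) y - dderiv u (dderiv v f) x\<bar> < e/2
       \<and> \<bar>dderiv v (dderiv u f) y - dderiv v (dderiv u f) x\<bar> < e/2) (nhds x)"
      using eventually_nhds_in_open[OF S x] tl[of u v] tl[of v u] by eventually_elim auto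
    then obtain d where d: "d > 0" "\<And>y. dist y x < d \<Longrightarrow> y \<in> S \<and> \<bar>dderiv u (dderiv v f) y - dderiv u (dderiv v f) x\<bar> < e/2
       \<and> \<bar>dderiv v (dderiv u f) y - dderiv v (dderiv u f) x\<bar> < e/2"
      unfolding eventually_nhds_metric by blast
    define t where "t = d / (norm u + norm v + 1)"
    have t: "t > 0" and tn: "t * (norm u + norm v) < d"
      using d(1) by (auto simp: t_def field_simps add_pos_nonneg add_nonneg_pos)
    have near: "dist (x + r *\<^sub>R u + s *\<^sub>R v) x < d" if "0 \<le> r" "r \<le> t" "0 \<le> s" "s \<le> t" for r s
    proof -
      have "dist (x + r *\<^sub>R u + s *\<^sub>R v) x \<le> r * norm u + s * norm v"
        using norm_triangle_ineq[of "r *\<^sub>R u" "s *\<^sub>R v"] that by (simp add: dist_norm)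
      also have "\<dots> \<le> t * norm u + t * norm v"
        by (intro add_mono mult_right_mono that) auto
      finally show ?thesis using tn by (simp add: algebra_simps)
    qed
    obtain r s where 1: "0 \<le> r" "r \<le> t" "0 \<le> s" "s \<le> t"
      "f (x + t *\<^sub>R u + t *\<^sub>R v) - f (x + t *\<^sub>R u) - f (x + t *\<^sub>R v) + f x =
        t\<^sup>2 * dderiv v (dderiv u f) (x + r *\<^sub>R u + s *\<^sub>R v)"
      using second_difference[OF f S t, of x u v] near d(2) by blast
    obtain r' s' where 2: "0 \<le> r'" "r' \<le> t" "0 \<le> s'" "s' \<le> t"
      "f (x + t *\<^sub>R v + t *\<^sub>R u) - f (x + t *\<^sub>R v) - f (x + t *\<^sub>R u) + f x =
        t\<^sup>2 * dderiv u (dderiv v f) (x + r' *\<^sub>R v + s' *\<^sub>R u)"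
      using second_difference[OF f S t, of x v u] near d(2) by (smt (verit, ccfv_threshold) add.commute add.left_commute)
    have swap: "a + b *\<^sub>R v + c *\<^sub>R u = a + c *\<^sub>R u + b *\<^sub>R v" for a b c
      by (simp add: add_ac)
    have "t\<^sup>2 * dderiv v (dderiv u f) (x + r *\<^sub>R u + s *\<^sub>R v) = t\<^sup>2 * dderiv u (dderiv v f) (x + s' *\<^sub>R u + r' *\<^sub>R v)"
      using 1(5) 2(5) unfolding swap by linarith
    hence "dderiv v (dderiv u f) (x + r *\<^sub>R u + s *\<^sub>R v) = dderiv u (dderiv v f) (x + s' *\<^sub>R u + r' *\<^sub>R v)"
      using t by simp
    thus ?thesis using d(2)[OF near[OF 1(1-4)]] d(2)[OF near[OF 2(3,4,1,2)]] by linarith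
  qed
  hence "\<bar>dderiv u (dderiv v f) x - dderiv v (dderiv u f) x\<bar> \<le> 0"
    using dense_ge by blast
  thus ?thesis by simp
qed

lemma dderiv_add:
  fixes f g :: "real^'n::finite \<Rightarrow> real"
  assumes "f differentiable (at x)" "g differentiable (at x)"
  shows "dderiv u (\<lambda>x. f x + g x) x = dderiv u f x + dderiv u g x"
  by (rule dderiv_eqI[OF has_derivative_add[OF assms[THEN has_derivative_dderiv]]])

lemma dderiv_diff:
  fixes f g :: "real^'n::finite \<Rightarrow> real"
  assumes "f differentiable (at x)" "g differentiable (at x)"
  shows "dderiv u (\<lambda>x. f x - g x) x = dderiv u f x - dderiv u g x"
  by (rule dderiv_eqI[OF has_derivative_diff[OF assms[THEN has_derivative_dderiv]]])

lemma dderiv_mult: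
  fixes f g :: "real^'n::finite \<Rightarrow> real"
  assumes "f differentiable (at x)" "g differentiable (at x)"
  shows "dderiv u (\<lambda>x. f x * g x) x = f x * dderiv u g x + dderiv u f x * g x"
  by (rule dderiv_eqI[OF has_derivative_mult[OF assms[THEN has_derivative_dderiv]]])

lemma dderiv_const [simp]: "dderiv u (\<lambda>x. c) x = 0"
  by (rule dderiv_eqI[OF has_derivative_const])

lemma dderiv_cmult:
  fixes f :: "real^'n::finite \<Rightarrow> real"
  assumes "f differentiable (at x)"
  shows "dderiv u (\<lambda>x. c * f x) x = c * dderiv u f x"
  using dderiv_mult[of "\<lambda>x. c" x f u] assms by simp

lemma dderiv_compose_real:
  fixes f :: "real^'n::finite \<Rightarrow> real"
  assumes "(g has_real_derivative g') (at (f x))" "f differentiable (at x)"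
  shows "dderiv u (\<lambda>x. g (f x)) x = g' * dderiv u f x"
  by (simp add: dderiv_def partial_deriv_compose_real(1)[OF assms] sum_distrib_left mult_ac)

text \<open>Homogeneity is assumed only away from \<open>0\<close>, so that the lemma applies again to the
  derivatives of a homogeneous function, whose values at \<open>0\<close> are arbitrary.\<close>

lemma homogeneous_dderiv:
  fixes f :: "real^'n::finite \<Rightarrow> real"
  assumes f: "smooth_on (-{0}) f" and hom: "\<And>c y. c > 0 \<Longrightarrow> y \<noteq> 0 \<Longrightarrow> f (c *\<^sub>R y) = c ^ Suc k * f y"
    and c: "c > 0" and y: "y \<noteq> 0"
  shows "dderiv u f (c *\<^sub>R y) = c ^ k * dderiv u f y"
proof -
  have 1: "((\<lambda>t. f (c *\<^sub>R y + t *\<^sub>R (c *\<^sub>R u))) has_real_derivative c * dderiv u f (c *\<^sub>R y)) (at 0)"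
    using dderiv_along_line[of f "c *\<^sub>R y" 0 "c *\<^sub>R u"] smooth_onD_diff[OF f] c y
    by (simp add: dderiv_scale_left)
  have 2: "((\<lambda>t. c ^ Suc k * f (y + t *\<^sub>R u)) has_real_derivative c ^ Suc k * dderiv u f y) (at 0)"
    using dderiv_along_line[of f "y" 0 "u"] smooth_onD_diff[OF f] y
    by (intro DERIV_cmult) simp
  have "((\<lambda>t. y + t *\<^sub>R u) \<longlongrightarrow> y + 0 *\<^sub>R u) (nhds (0::real))"
    by (intro tendsto_intros filterlim_ident)
  hence "eventually (\<lambda>t::real. y + t *\<^sub>R u \<in> -{0}) (nhds 0)"
    by (rule topological_tendstoD) (use y in auto)
  hence "eventually (\<lambda>t. f (c *\<^sub>R y + t *\<^sub>R (c *\<^sub>R u)) = c ^ Suc k * f (y + t *\<^sub>R u)) (nhds 0)"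
    by eventually_elim (use hom[OF c, of "y + _ *\<^sub>R u"] in \<open>simp add: algebra_simps\<close>)
  from DERIV_cong_ev[OF refl this refl] 1 2
  have "c * dderiv u f (c *\<^sub>R y) = c ^ Suc k * dderiv u f y"
    using DERIV_unique by blast
  thus ?thesis using c by simp
qed

lemma euler_homogeneous:
  fixes f :: "real^'n::finite \<Rightarrow> real"
  assumes f: "smooth_on (-{0}) f" and hom: "\<And>c y. c > 0 \<Longrightarrow> y \<noteq> 0 \<Longrightarrow> f (c *\<^sub>R y) = c ^ k * f y"
    and y: "y \<noteq> 0"
  shows "dderiv y f y = real k * f y"
proof -
  have 1: "((\<lambda>t. f (y + t *\<^sub>R y)) has_real_derivative dderiv y f y) (at 0)"
    using dderiv_along_line[of f y 0 y] smooth_onD_diff[OF f] y by simp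
  have 2: "((\<lambda>t. (1 + t) ^ k * f y) has_real_derivative real k * f y) (at 0)"
    by (auto intro!: derivative_eq_intros)
  have "eventually (\<lambda>t::real. t \<in> {-1<..}) (nhds 0)" by (rule eventually_nhds_in_open) auto
  hence "eventually (\<lambda>t::real. f (y + t *\<^sub>R y) = (1 + t) ^ k * f y) (nhds 0)"
    by eventually_elim (use hom[of "1 + _" y] y in \<open>simp add: algebra_simps\<close>)
  from DERIV_cong_ev[OF refl this refl] 1 2 show ?thesis using DERIV_unique by blast
qed

section \<open>Homogeneity, positivity and bounds for Minkowski norms\<close>

lemma minkowski_smooth: "minkowski_norm F \<Longrightarrow> smooth_on (-{0}) F"
  and minkowski_nonneg: "minkowski_norm F \<Longrightarrow> 0 \<le> F y"
  and minkowski_scale: "minkowski_norm F \<Longrightarrow> 0 < c \<Longrightarrow> F (c *\<^sub>R y) = c * F y"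
  by (simp_all add: minkowski_norm_def)

lemma minkowski_zero: "minkowski_norm F \<Longrightarrow> F 0 = 0"
  using minkowski_scale[of F 2 0] by simp

lemma minkowski_sq_smooth: "minkowski_norm F \<Longrightarrow> smooth_on (-{0}) (\<lambda>z. (F z)\<^sup>2)"
  by (intro smooth_on_power minkowski_smooth) auto

text \<open>The iterated one-dimensional derivative is a second directional derivative, so strong
  convexity becomes a statement about the Hessian of the energy \<open>F\<^sup>2\<close>.\<close>

lemma fundamental_form_eq:
  fixes F :: "real^'n::finite \<Rightarrow> real"
  assumes F: "smooth_on (-{0}) F" and y: "y \<noteq> 0"
  shows "fundamental_form F y u v = 1/2 * dderiv u (dderiv v (\<lambda>z. (F z)\<^sup>2)) y"
proof -
  have E: "smooth_on (-{0}) (\<lambda>z. (F z)\<^sup>2)" by (intro smooth_on_power F) auto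
  have "((\<lambda>t. y + t *\<^sub>R u) \<longlongrightarrow> y + 0 *\<^sub>R u) (nhds (0::real))"
    by (intro tendsto_intros filterlim_ident)
  hence "eventually (\<lambda>s::real. y + s *\<^sub>R u \<in> -{0}) (nhds 0)"
    by (rule topological_tendstoD) (use y in auto)
  hence "eventually (\<lambda>s::real. deriv (\<lambda>t. (F (y + s *\<^sub>R u + t *\<^sub>R v))\<^sup>2) 0 = dderiv v (\<lambda>z. (F z)\<^sup>2) (y + s *\<^sub>R u)) (nhds 0)"
  proof eventually_elim
    case (elim s)
    show ?case
      by (rule DERIV_imp_deriv)
         (use dderiv_along_line[of "\<lambda>z. (F z)\<^sup>2" "y + s *\<^sub>R u" 0 v] smooth_onD_diff[OF E] elim in simp)
  qed
  hence "deriv (\<lambda>s. deriv (\<lambda>t. (F (y + s *\<^sub>R u + t *\<^sub>R v))\<^sup>2) 0) 0 = deriv (\<lambda>s. dderiv v (\<lambda>z. (F z)\<^sup>2) (y + s *\<^sub>R u)) 0"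
    by (rule deriv_cong_ev) simp
  also have "\<dots> = dderiv u (dderiv v (\<lambda>z. (F z)\<^sup>2)) y"
    by (rule DERIV_imp_deriv)
       (use dderiv_along_line[of "dderiv v (\<lambda>z. (F z)\<^sup>2)" "y" 0 u] smooth_onD_diff[OF smooth_on_dderiv[OF E]] y in \<open>simp add: open_Compl\<close>)
  finally show ?thesis by (simp add: fundamental_form_def)
qed

lemma minkowski_pos_def:
  assumes "minkowski_norm F" "y \<noteq> 0" "u \<noteq> 0"
  shows "0 < dderiv u (dderiv u (\<lambda>z. (F z)\<^sup>2)) y"
proof -
  have "0 < fundamental_form F y u u" using assms by (simp add: minkowski_norm_def)
  thus ?thesis using fundamental_form_eq[OF minkowski_smooth[OF assms(1)] assms(2), of u u] by simp
qed

text \<open>Strong convexity forces positivity: by Euler's relation the Hessian of \<open>F\<^sup>2\<close> at \<open>y\<close> takes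
  the value \<open>2 (F y)\<^sup>2\<close> at \<open>(y, y)\<close>.\<close>

lemma minkowski_pos:
  assumes F: "minkowski_norm F" and y: "y \<noteq> 0"
  shows "0 < F y"
proof -
  let ?E = "\<lambda>z. (F z)\<^sup>2"
  have E: "smooth_on (-{0}) ?E" by (rule minkowski_sq_smooth[OF F])
  have hom: "?E (c *\<^sub>R z) = c ^ Suc 1 * ?E z" if "c > 0" for c z
    using minkowski_scale[OF F that] by (simp add: power2_eq_square)
  have "dderiv y (dderiv y ?E) y = real 1 * dderiv y ?E y"
    by (rule euler_homogeneous[OF smooth_on_dderiv[OF E]])
       (use homogeneous_dderiv[OF E hom, of _ _ y] y in auto)
  moreover have "dderiv y ?E y = real (Suc 1) * ?E y"
    by (rule euler_homogeneous[OF E _ y]) (use hom in auto)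
  ultimately have "0 < ?E y" using minkowski_pos_def[OF F y y] by simp
  thus ?thesis using minkowski_nonneg[OF F, of y] by (simp add: zero_less_power2)
qed

lemma minkowski_bounds:
  fixes F :: "real^'n::finite \<Rightarrow> real"
  assumes F: "minkowski_norm F"
  obtains m M where "0 < m" "0 < M" "\<And>y. m * norm y \<le> F y" "\<And>y. F y \<le> M * norm y"
proof -
  let ?S = "sphere (0::real^'n) 1"
  have ne: "?S \<noteq> {}" by simp
  have cont: "continuous_on ?S F"
    by (rule continuous_on_subset[OF smooth_onD_cont[OF minkowski_smooth[OF F]]]) auto
  obtain a where a: "a \<in> ?S" "\<And>y. y \<in> ?S \<Longrightarrow> F a \<le> F y"
    using continuous_attains_inf[OF compact_sphere ne cont] by blast
  obtain b where b: "b \<in> ?S" "\<And>y. y \<in> ?S \<Longrightarrow> F y \<le> F b"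
    using continuous_attains_sup[OF compact_sphere ne cont] by blast
  have "F a * norm y \<le> F y \<and> F y \<le> F b * norm y" for y
  proof (cases "y = 0")
    case True thus ?thesis by (simp add: minkowski_zero[OF F])
  next
    case False
    hence "F y = norm y * F (y /\<^sub>R norm y)" using minkowski_scale[OF F, of "norm y" "y /\<^sub>R norm y"] by simp
    moreover have "y /\<^sub>R norm y \<in> ?S" using False by simp
    ultimately show ?thesis using a(2) b(2) False by (simp add: mult.commute mult_left_mono)
  qed
  moreover have "F a > 0" "F b > 0"
    using a(1) b(1) by (auto intro!: minkowski_pos[OF F])
  ultimately show ?thesis using that by blast
qed

lemma minkowski_continuous:
  fixes F :: "real^'n::finite \<Rightarrow> real"
  assumes F: "minkowski_norm F"
  shows "continuous_on UNIV F"
proof -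
  obtain m M where M: "0 < m" "0 < M" "\<And>y. m * norm y \<le> F y" "\<And>y. F y \<le> M * norm y"
    using minkowski_bounds[OF F] by blast
  have "isCont F y" for y
  proof (cases "y = 0")
    case False
    thus ?thesis using smooth_onD_cont[OF minkowski_smooth[OF F]]
      by (simp add: continuous_on_eq_continuous_at open_Compl)
  next
    case True
    have "((\<lambda>y::real^'n. M * norm y) \<longlongrightarrow> 0) (at 0)" by (auto intro!: tendsto_eq_intros tendsto_norm_zero)
    hence "(F \<longlongrightarrow> 0) (at 0)"
      by (intro tendsto_sandwich[of "\<lambda>_. 0" F "at 0" "\<lambda>y. M * norm y"])
         (use M minkowski_nonneg[OF F] in auto)
    thus ?thesis using True by (simp add: isCont_def minkowski_zero[OF F])
  qed
  thus ?thesis by (simp add: continuous_at_imp_continuous_on)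
qed

lemma dual_norm_bound:
  fixes F :: "real^'n::finite \<Rightarrow> real"
  assumes F: "minkowski_norm F" and y: "y \<noteq> 0"
  shows "\<bar>blinfun_apply \<beta> y\<bar> / F y \<le> dual_norm F \<beta>"
  unfolding dual_norm_def
proof (rule cSUP_upper)
  show "y \<in> - {0}" using y by simp
  obtain m M where M: "0 < m" "0 < M" "\<And>y. m * norm y \<le> F y" "\<And>y. F y \<le> M * norm y"
    using minkowski_bounds[OF F] by blast
  have "\<bar>blinfun_apply \<beta> z\<bar> / F z \<le> norm \<beta> / m" if "z \<noteq> 0" for z
  proof -
    have "\<bar>blinfun_apply \<beta> z\<bar> * m \<le> (norm \<beta> * norm z) * m"
      using norm_blinfun[of \<beta> z] M(1) by (intro mult_right_mono) auto
    also have "\<dots> = norm \<beta> * (m * norm z)" by simp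
    also have "\<dots> \<le> norm \<beta> * F z" using M(3)[of z] by (intro mult_left_mono) auto
    finally show ?thesis using M(1) minkowski_pos[OF F that] by (simp add: field_simps)
  qed
  thus "bdd_above ((\<lambda>y. \<bar>blinfun_apply \<beta> y\<bar> / F y) ` (- {0}))"
    by (intro bdd_aboveI2) auto
qed

section \<open>The mean Cartan torsion as a logarithmic gradient\<close>

text \<open>In the Leibniz formula, a permutation other than the identity moves at least two
  indices. The derivative of its product therefore keeps an off-diagonal factor, which vanishes at
  the identity matrix, and only the diagonal product contributes.\<close>

lemma det_derivative_at_identity:
  fixes N :: "real \<Rightarrow> real^'n::finite^'n"
  assumes N: "\<And>i j. ((\<lambda>t. N t $ i $ j) has_real_derivative N' $ i $ j) (at t)" and id: "N t = mat 1"
  shows "((\<lambda>t. det (N t)) has_real_derivative trace N') (at t)"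
proof -
  let ?P = "{p. p permutes (UNIV::'n set)}"
  let ?D = "\<lambda>p. \<Sum>i\<in>UNIV. N' $ i $ p i * (\<Prod>j\<in>UNIV - {i}. N t $ j $ p j)"
  have D: "((\<lambda>t. \<Sum>p\<in>?P. of_int (sign p) * (\<Prod>i\<in>UNIV. N t $ i $ p i)) has_real_derivative
     (\<Sum>p\<in>?P. of_int (sign p) * ?D p)) (at t)"
    by (intro DERIV_sum DERIV_cmult has_field_derivative_prod N)
  have *: "of_int (sign p) * ?D p = (if p = id then trace N' else 0)" if "p \<in> ?P" for p
  proof (cases "p = id")
    case True
    thus ?thesis by (simp add: id trace_def mat_def)
  next
    case False
    have "(\<Prod>j\<in>UNIV - {i}. N t $ j $ p j) = 0" for i
    proof -
      obtain k where k: "p k \<noteq> k" using False by (auto simp: fun_eq_iff)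
      have "p (p k) \<noteq> p k" using k that by (metis mem_Collect_eq permutes_inverses(2))
      then obtain j where "j \<noteq> i" "p j \<noteq> j" using k by metis
      thus ?thesis by (intro prod_zero) (auto simp: id mat_def intro!: bexI[of _ j])
    qed
    hence "?D p = 0" by (simp del: prod_eq_1_iff prod_zero_iff)
    thus ?thesis using False by simp
  qed
  have "(\<Sum>p\<in>?P. of_int (sign p) * ?D p) = (\<Sum>p\<in>?P. if p = id then trace N' else 0)"
    by (rule sum.cong[OF refl *])
  also have "(\<Sum>p\<in>?P. if p = id then trace N' else 0) = trace N'"
    by (subst sum.delta) (auto simp: permutes_id finite_permutations)
  finally show ?thesis using D by (simp add: det_def)
qed

text \<open>Multiplying by the fixed matrix \<open>matrix_inv (M t)\<close> reduces the derivative of the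
  determinant to the derivative at the identity.\<close>

lemma jacobi_formula:
  fixes M :: "real \<Rightarrow> real^'n::finite^'n"
  assumes M: "\<And>i j. ((\<lambda>t. M t $ i $ j) has_real_derivative M' $ i $ j) (at t)" and inv: "invertible (M t)"
  shows "((\<lambda>t. det (M t)) has_real_derivative det (M t) * trace (matrix_inv (M t) ** M')) (at t)"
proof -
  let ?A = "matrix_inv (M t)"
  have A: "M t ** ?A = mat 1" "?A ** M t = mat 1"
    using inv someI_ex[of "\<lambda>A'. M t ** A' = mat 1 \<and> A' ** M t = mat 1"] unfolding invertible_def matrix_inv_def by auto
  have "((\<lambda>s. det (?A ** M s)) has_real_derivative trace (?A ** M')) (at t)"
  proof (rule det_derivative_at_identity[where N="\<lambda>s. ?A ** M s", OF _ A(2)])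
    show "((\<lambda>s. (?A ** M s) $ i $ j) has_real_derivative (?A ** M') $ i $ j) (at t)" for i j
      by (auto simp: matrix_matrix_mult_def intro!: DERIV_sum DERIV_cmult M)
  qed
  hence "((\<lambda>s. det (M t) * det (?A ** M s)) has_real_derivative det (M t) * trace (?A ** M')) (at t)"
    by (rule DERIV_cmult)
  moreover have "det (M t) * det (?A ** M s) = det (M s)" for s
    by (metis A(1) det_mul matrix_mul_assoc matrix_mul_lid)
  ultimately show ?thesis by simp
qed

lemma linear_dderiv: "linear (\<lambda>u. dderiv u f x)"
  by (intro linearI) (simp_all add: dderiv_add_left dderiv_scale_left)

lemma hessian_symmetric: "smooth_on (-{0}) f \<Longrightarrow> x \<noteq> 0 \<Longrightarrow> dderiv u (dderiv v f) x = dderiv v (dderiv u f) x"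
  by (rule dderiv_commute) (auto simp: open_Compl)

lemma hessian_bilinear:
  assumes "smooth_on (-{0}) f" "x \<noteq> 0"
  shows "bilinear (\<lambda>u v. dderiv u (dderiv v f) x)"
  unfolding bilinear_def
  by (subst (1) hessian_symmetric[OF assms]) (intro conjI allI linear_dderiv)

lemma third_derivative_symmetric:
  assumes f: "smooth_on (-{0}) f" and x: "x \<noteq> 0"
  shows "dderiv u (dderiv v (dderiv w f)) x = dderiv v (dderiv u (dderiv w f)) x"
    and "dderiv u (dderiv v (dderiv w f)) x = dderiv u (dderiv w (dderiv v f)) x"
proof -
  have o: "open (-{0::real^'n::finite})" by (simp add: open_Compl)
  show "dderiv u (dderiv v (dderiv w f)) x = dderiv v (dderiv u (dderiv w f)) x"
    using f x o by (intro hessian_symmetric smooth_on_dderiv) auto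
  show "dderiv u (dderiv v (dderiv w f)) x = dderiv u (dderiv w (dderiv v f)) x"
    by (rule dderiv_cong[where S="-{0}", OF o]) (use x hessian_symmetric[OF f] in auto)
qed

lemma linear_eq_on_axes:
  assumes "linear f" "linear g" "\<And>i. f (axis i 1) = g (axis i (1::real))"
  shows "f u = (g u :: real)"
proof -
  have "f u = f (\<Sum>i\<in>UNIV. u $ i *\<^sub>R axis i 1)"
    using basis_expansion[of u] by (simp add: scalar_mult_eq_scaleR)
  also have "\<dots> = g (\<Sum>i\<in>UNIV. u $ i *\<^sub>R axis i 1)"
    by (simp add: linear_sum[OF assms(1)] linear_sum[OF assms(2)] linear_cmul[OF assms(1)] linear_cmul[OF assms(2)] assms(3))
  finally show ?thesis using basis_expansion[of u] by (simp add: scalar_mult_eq_scaleR)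
qed

lemma metric_tensor_eq:
  "metric_tensor F y $ i $ j = 1/2 * dderiv (axis j 1) (dderiv (axis i 1) (\<lambda>z. (F z)\<^sup>2)) y"
  by (simp add: metric_tensor_def dderiv_axis)

lemma cartan_torsion_eq:
  "cartan_torsion F y i j k = 1/4 * dderiv (axis k 1) (dderiv (axis j 1) (dderiv (axis i 1) (\<lambda>z. (F z)\<^sup>2))) y"
  by (simp add: cartan_torsion_def dderiv_axis)

lemma metric_tensor_invertible:
  fixes F :: "real^'n::finite \<Rightarrow> real"
  assumes F: "minkowski_norm F" and y: "y \<noteq> 0"
  shows "invertible (metric_tensor F y)"
proof -
  let ?E = "\<lambda>z. (F z)\<^sup>2"
  note E = minkowski_sq_smooth[OF F]
  have "u = 0" if "metric_tensor F y *v u = 0" for u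
  proof (rule ccontr)
    assume u: "u \<noteq> 0"
    have "(metric_tensor F y *v u) $ i = 1/2 * dderiv u (dderiv (axis i 1) ?E) y" for i
      by (simp add: matrix_vector_mult_def metric_tensor_eq dderiv_def[of u] sum_distrib_left mult_ac dderiv_axis)
    hence "dderiv u (dderiv (axis i 1) ?E) y = 0" for i using that by simp
    hence "dderiv (axis i 1) (dderiv u ?E) y = 0" for i using hessian_symmetric[OF E y] by metis
    hence "dderiv u (dderiv u ?E) y = 0"
      by (simp add: dderiv_def[of u "dderiv u ?E"] dderiv_axis)
    thus False using minkowski_pos_def[OF F y u] by simp
  qed
  hence "\<exists>B. B ** metric_tensor F y = mat 1"
    by (simp add: matrix_left_invertible_ker)
  thus ?thesis using matrix_left_right_inverse unfolding invertible_def by blast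
qed

lemma det_metric_tensor_smooth:
  fixes F :: "real^'n::finite \<Rightarrow> real"
  assumes F: "minkowski_norm F"
  shows "smooth_on (-{0}) (\<lambda>y. det (metric_tensor F y))"
proof -
  have o: "open (-{0::real^'n})" by (simp add: open_Compl)
  have "smooth_on (-{0}) (\<lambda>y. metric_tensor F y $ i $ j)" for i j
    unfolding metric_tensor_eq
    by (intro smooth_on_mult[OF smooth_on_const] smooth_on_dderiv[OF smooth_on_dderiv] minkowski_sq_smooth[OF F] o)
  thus ?thesis
    unfolding det_def using o
    by (intro smooth_on_sum smooth_on_mult[OF smooth_on_const] smooth_on_prod) auto
qed

text \<open>The Cartan torsion is half the derivative of the metric tensor, so its trace is
  half the logarithmic derivative of \<open>det g\<close>. The mean Cartan torsion is thus a gradient with an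
  explicit potential.\<close>

lemma partial_deriv_det_metric_tensor:
  fixes F :: "real^'n::finite \<Rightarrow> real"
  assumes F: "minkowski_norm F" and y: "y \<noteq> 0"
  shows "partial_deriv k (\<lambda>y. det (metric_tensor F y)) y =
    2 * det (metric_tensor F y) * mean_cartan_torsion F y k"
proof -
  let ?E = "\<lambda>z. (F z)\<^sup>2"
  note E = minkowski_sq_smooth[OF F]
  have o: "open (-{0::real^'n})" by (simp add: open_Compl)
  have sym: "cartan_torsion F y i j k = cartan_torsion F y j i k" for i j
    unfolding cartan_torsion_eq by (rule arg_cong[OF third_derivative_symmetric(2)[OF E y]])
  define M' :: "real^'n^'n" where "M' = (\<chi> j i. 2 * cartan_torsion F y i j k)"
  have "((\<lambda>t. metric_tensor F (y + t *\<^sub>R axis k 1) $ i $ j) has_real_derivative M' $ i $ j) (at 0)" for i j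
  proof -
    have "((\<lambda>t. 1/2 * dderiv (axis j 1) (dderiv (axis i 1) ?E) (y + t *\<^sub>R axis k 1)) has_real_derivative
       1/2 * dderiv (axis k 1) (dderiv (axis j 1) (dderiv (axis i 1) ?E)) y) (at 0)"
      using dderiv_along_line[of "dderiv (axis j 1) (dderiv (axis i 1) ?E)" y 0 "axis k 1"]
        smooth_onD_diff[OF smooth_on_dderiv[OF smooth_on_dderiv[OF E o] o]] y
      by (intro DERIV_cmult) simp
    thus ?thesis unfolding M'_def vec_lambda_beta sym[of j i] by (simp add: metric_tensor_eq cartan_torsion_eq)
  qed
  from jacobi_formula[where M="\<lambda>t. metric_tensor F (y + t *\<^sub>R axis k 1)" and t=0, OF this]
  have "((\<lambda>t. det (metric_tensor F (y + t *\<^sub>R axis k 1))) has_real_derivative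
     det (metric_tensor F y) * trace (matrix_inv (metric_tensor F y) ** M')) (at 0)"
    using metric_tensor_invertible[OF F y] by simp
  hence "partial_deriv k (\<lambda>y. det (metric_tensor F y)) y = det (metric_tensor F y) * trace (matrix_inv (metric_tensor F y) ** M')"
    unfolding partial_deriv_def by (rule DERIV_imp_deriv)
  also have "trace (matrix_inv (metric_tensor F y) ** M') = 2 * mean_cartan_torsion F y k"
    by (simp add: trace_def matrix_matrix_mult_def mean_cartan_torsion_def M'_def sum_distrib_left
        mult.left_commute)
  finally show ?thesis by simp
qed

section \<open>C-reducible norms are Randers norms\<close>

text \<open>The assumption \<open>rel\<close> says that, for each \<open>u\<close>, the linear forms \<open>H u\<close> and \<open>P u\<close> are
  proportional. The factor found at \<open>a\<close> is carried to the value at \<open>(w, w)\<close> by the pair \<open>w, a\<close> if \<open>w\<close> and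
  \<open>a\<close> are not conjugate, and by the pair \<open>w + a, a\<close> otherwise; polarisation does the rest.\<close>

lemma proportional_forms:
  fixes H P :: "'a::real_vector \<Rightarrow> 'a \<Rightarrow> real"
  assumes H: "bilinear H" "\<And>u v. H u v = H v u" and P: "bilinear P" "\<And>u v. P u v = P v u"
    and rel: "\<And>u w. H u w * P u u = H u u * P u w" and nz: "H a a \<noteq> 0"
  shows "P u v = P a a / H a a * H u v"
proof -
  define m where "m = P a a / H a a"
  note exp = bilinear_ladd[OF H(1)] bilinear_radd[OF H(1)] bilinear_ladd[OF P(1)] bilinear_radd[OF P(1)]
  have aw: "P a w = m * H a w" for w
    using rel[of a w] nz by (simp add: m_def field_simps)
  have diag: "P w w = m * H w w" for w
  proof (cases "H a w = 0")
    case False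
    have "H w a * P w w = H w w * P w a" by (rule rel)
    hence "H a w * P w w = H a w * (m * H w w)" using aw[of w] H(2)[of w a] P(2)[of w a] by (simp add: mult_ac)
    thus ?thesis using False mult_left_cancel[of "H a w" "P w w" "m * H w w"] by blast
  next
    case True
    hence P0: "P a w = 0" using aw by simp
    have "H (w + a) a * P (w + a) (w + a) = H (w + a) (w + a) * P (w + a) a" by (rule rel)
    hence "H a a * (P w w + P a a) = (H w w + H a a) * P a a"
      using True P0 H(2)[of w a] P(2)[of w a] by (simp add: exp)
    thus ?thesis using nz by (simp add: m_def field_simps)
  qed
  have "P (u + v) (u + v) = m * H (u + v) (u + v)" by (rule diag)
  hence "2 * P u v = m * (2 * H u v)"
    using diag[of u] diag[of v] H(2)[of v u] P(2)[of v u] by (simp add: exp algebra_simps)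
  hence "P u v = m * H u v" by linarith
  thus ?thesis by (simp add: m_def)
qed

lemma zero_gradient_constant:
  fixes f :: "real^'n::finite \<Rightarrow> real"
  assumes n: "2 \<le> CARD('n)" and f: "smooth_on (-{0}) f"
    and 0: "\<And>u x. x \<noteq> 0 \<Longrightarrow> dderiv u f x = 0"
  obtains c where "\<And>x. x \<noteq> 0 \<Longrightarrow> f x = c"
proof -
  have "f constant_on (-{0})"
  proof (rule has_derivative_zero_connected_constant_on[where K="{}"])
    show "connected (-{0::real^'n})" using n by (intro connected_punctured_universe) simp
    show "continuous_on (-{0}) f" by (rule smooth_onD_cont[OF f])
    show "\<forall>x\<in>-{0} - {}. (f has_derivative (\<lambda>h. 0)) (at x within -{0})"
    proof
      fix x :: "real^'n" assume "x \<in> -{0} - {}"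
      hence x: "x \<noteq> 0" by simp
      have "(f has_derivative (\<lambda>h. dderiv h f x)) (at x)"
        using x by (intro has_derivative_dderiv smooth_onD_diff[OF f]) auto
      thus "(f has_derivative (\<lambda>h. 0)) (at x within -{0})"
        by (simp add: 0[OF x] has_derivative_at_withinI)
    qed
  qed (auto simp: open_Compl)
  thus ?thesis using that by (auto simp: constant_on_def)
qed

text \<open>The gradient is constant, and Euler's relation recovers a function of degree one from its
  gradient.\<close>

lemma zero_hessian_linear:
  fixes f :: "real^'n::finite \<Rightarrow> real"
  assumes n: "2 \<le> CARD('n)" and f: "smooth_on (-{0}) f"
    and hom: "\<And>c y. c > 0 \<Longrightarrow> y \<noteq> 0 \<Longrightarrow> f (c *\<^sub>R y) = c * f y"
    and 0: "\<And>u v x. x \<noteq> 0 \<Longrightarrow> dderiv u (dderiv v f) x = 0"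
  obtains a where "\<And>x. x \<noteq> 0 \<Longrightarrow> f x = a \<bullet> x"
proof -
  have "\<exists>c. \<forall>x. x \<noteq> 0 \<longrightarrow> dderiv (axis i 1) f x = c" for i
    using zero_gradient_constant[OF n smooth_on_dderiv[OF f], of "axis i 1"] 0 by (metis open_Compl closed_singleton)
  then obtain c where c: "\<And>i x. x \<noteq> 0 \<Longrightarrow> dderiv (axis i 1) f x = c i" by metis
  have "f x = (\<chi> i. c i) \<bullet> x" if x: "x \<noteq> 0" for x
  proof -
    have "f x = dderiv x f x" using euler_homogeneous[OF f _ x, of 1] hom by simp
    also have "\<dots> = (\<chi> i. c i) \<bullet> x"
      using c[OF x] by (simp add: dderiv_def inner_vec_def dderiv_axis mult.commute)
    finally show ?thesis .
  qed
  thus ?thesis using that by blast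
qed

lemma hessian_square:
  fixes f :: "real^'n::finite \<Rightarrow> real"
  assumes f: "smooth_on (-{0}) f" and x: "x \<noteq> 0"
  shows "dderiv v (dderiv u (\<lambda>z. (f z)\<^sup>2)) x = 2 * (dderiv v f x * dderiv u f x + f x * dderiv v (dderiv u f) x)"
proof -
  have o: "open (-{0::real^'n})" by (simp add: open_Compl)
  have d: "f differentiable (at z)" "dderiv u f differentiable (at z)" if "z \<noteq> 0" for z
    using that smooth_onD_diff[OF f] smooth_onD_diff[OF smooth_on_dderiv[OF f o]] by auto
  have "dderiv v (dderiv u (\<lambda>z. (f z)\<^sup>2)) x = dderiv v (\<lambda>z. 2 * (f z * dderiv u f z)) x"
    by (rule dderiv_cong[OF o]) (use x in \<open>auto simp: power2_eq_square dderiv_mult d\<close>)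
  also have "\<dots> = 2 * dderiv v (\<lambda>z. f z * dderiv u f z) x"
    using d[OF x] by (intro dderiv_cmult differentiable_mult)
  also have "dderiv v (\<lambda>z. f z * dderiv u f z) x = dderiv v f x * dderiv u f x + f x * dderiv v (dderiv u f) x"
    using d[OF x] by (simp add: dderiv_mult)
  finally show ?thesis .
qed

lemma third_derivative_square:
  fixes f :: "real^'n::finite \<Rightarrow> real"
  assumes f: "smooth_on (-{0}) f" and x: "x \<noteq> 0"
  shows "dderiv w (dderiv v (dderiv u (\<lambda>z. (f z)\<^sup>2))) x =
    2 * (dderiv w (dderiv v f) x * dderiv u f x + dderiv v f x * dderiv w (dderiv u f) x
       + dderiv w f x * dderiv v (dderiv u f) x + f x * dderiv w (dderiv v (dderiv u f)) x)"
proof -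
  have o: "open (-{0::real^'n})" by (simp add: open_Compl)
  have d: "f differentiable (at x)" "dderiv u f differentiable (at x)" "dderiv v f differentiable (at x)"
     "dderiv v (dderiv u f) differentiable (at x)"
    using x smooth_onD_diff[OF f] smooth_onD_diff[OF smooth_on_dderiv[OF f o]]
     smooth_onD_diff[OF smooth_on_dderiv[OF smooth_on_dderiv[OF f o] o]] by auto
  have "dderiv w (dderiv v (dderiv u (\<lambda>z. (f z)\<^sup>2))) x =
      dderiv w (\<lambda>z. 2 * (dderiv v f z * dderiv u f z + f z * dderiv v (dderiv u f) z)) x"
    by (rule dderiv_cong[OF o]) (use x in \<open>auto simp: hessian_square[OF f]\<close>)
  also have "\<dots> = 2 * dderiv w (\<lambda>z. dderiv v f z * dderiv u f z + f z * dderiv v (dderiv u f) z) x"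
    by (intro dderiv_cmult differentiable_mult differentiable_add d)
  also have "dderiv w (\<lambda>z. dderiv v f z * dderiv u f z + f z * dderiv v (dderiv u f) z) x =
      (dderiv v f x * dderiv w (dderiv u f) x + dderiv w (dderiv v f) x * dderiv u f x) +
      (f x * dderiv w (dderiv v (dderiv u f)) x + dderiv w f x * dderiv v (dderiv u f) x)"
    by (subst dderiv_add) (auto intro!: differentiable_mult d simp: dderiv_mult[OF d(3,2)] dderiv_mult[OF d(1,4)])
  finally show ?thesis by simp
qed

lemma hessian_norm_null:
  fixes F :: "real^'n::finite \<Rightarrow> real"
  assumes F: "minkowski_norm F" and y: "y \<noteq> 0"
  shows "dderiv y F y = F y" and "dderiv u (dderiv y F) y = 0"
proof -
  note f = minkowski_smooth[OF F]
  have o: "open (-{0::real^'n})" by (simp add: open_Compl)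
  show "dderiv y F y = F y"
    using euler_homogeneous[OF f _ y, of 1] minkowski_scale[OF F] by simp
  have "dderiv y (dderiv u F) y = real 0 * dderiv u F y"
    using homogeneous_dderiv[OF f, of 0] minkowski_scale[OF F]
    by (intro euler_homogeneous[OF smooth_on_dderiv[OF f o] _ y]) auto
  thus "dderiv u (dderiv y F) y = 0" using hessian_symmetric[OF f y] by simp
qed

text \<open>Subtracting a multiple of \<open>y\<close> from \<open>u\<close> does not change the value of the Hessian of \<open>F\<close>, whose
  kernel contains \<open>y\<close>. It can be chosen so that \<open>u\<close> becomes tangent to the level set of \<open>F\<close>, and on tangent
  vectors the Hessian of \<open>F\<^sup>2\<close> is \<open>2 F\<close> times that of \<open>F\<close>.\<close>

lemma hessian_norm_pos:
  fixes F :: "real^'n::finite \<Rightarrow> real"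
  assumes F: "minkowski_norm F" and y: "y \<noteq> 0" and u: "\<And>c. u \<noteq> c *\<^sub>R y"
  shows "0 < dderiv u (dderiv u F) y"
proof -
  note f = minkowski_smooth[OF F]
  define c where "c = dderiv u F y / F y"
  define v where "v = u - c *\<^sub>R y"
  have Fy: "F y > 0" by (rule minkowski_pos[OF F y])
  have v0: "dderiv v F y = 0"
    using Fy by (simp add: v_def dderiv_diff_left dderiv_scale_left hessian_norm_null[OF F y] c_def)
  have "v \<noteq> 0" using u by (simp add: v_def)
  hence "0 < dderiv v (dderiv v (\<lambda>z. (F z)\<^sup>2)) y" by (rule minkowski_pos_def[OF F y])
  hence "0 < F y * dderiv v (dderiv v F) y" by (simp add: hessian_square[OF f y] v0)
  moreover have "dderiv v (dderiv v F) y = dderiv u (dderiv u F) y"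
  proof -
    have vd: "dderiv v h y = dderiv u h y - c * dderiv y h y" for h
      by (simp add: v_def dderiv_diff_left dderiv_scale_left)
    have "dderiv v (dderiv v F) y = dderiv u (dderiv v F) y"
      using hessian_symmetric[OF f y, of y v] hessian_norm_null(2)[OF F y] by (simp add: vd)
    also have "\<dots> = dderiv v (dderiv u F) y" by (rule hessian_symmetric[OF f y])
    also have "\<dots> = dderiv u (dderiv u F) y"
      using hessian_symmetric[OF f y, of y u] hessian_norm_null(2)[OF F y] by (simp add: vd)
    finally show ?thesis .
  qed
  ultimately show ?thesis using Fy by (simp add: zero_less_mult_iff)
qed

text \<open>This is \<open>F / \<bar>det g\<bar> powr (1/(n+1))\<close>. Taking the logarithm of the squared determinant makes
  smoothness evident without information on the sign of the determinant.\<close>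

definition cubic_density :: "(real^'n::finite \<Rightarrow> real) \<Rightarrow> real^'n \<Rightarrow> real" where
  "cubic_density F y = exp (ln (F y) - ln ((det (metric_tensor F y))\<^sup>2) / (2 * (real CARD('n) + 1)))"

lemma cubic_density_pos: "0 < cubic_density F y"
  by (simp add: cubic_density_def)

lemma det_metric_tensor_nz: "minkowski_norm F \<Longrightarrow> y \<noteq> 0 \<Longrightarrow> det (metric_tensor F y) \<noteq> 0"
  using metric_tensor_invertible invertible_det_nz by blast

lemma cubic_density_smooth:
  fixes F :: "real^'n::finite \<Rightarrow> real"
  assumes F: "minkowski_norm F"
  shows "smooth_on (-{0}) (cubic_density F)"
proof -
  have o: "open (-{0::real^'n})" by (simp add: open_Compl)
  have "smooth_on (-{0}) (\<lambda>y. ln (F y))"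
    by (intro smooth_on_ln minkowski_smooth[OF F] o) (use minkowski_pos[OF F] in auto)
  moreover have "smooth_on (-{0}) (\<lambda>y. ln ((det (metric_tensor F y))\<^sup>2))"
    by (intro smooth_on_ln smooth_on_power det_metric_tensor_smooth[OF F] o)
       (use det_metric_tensor_nz[OF F] in auto)
  ultimately have "smooth_on (-{0}) (\<lambda>y. exp (ln (F y) - ln ((det (metric_tensor F y))\<^sup>2) * inverse (2 * (real CARD('n) + 1))))"
    using o by (intro smooth_on_exp smooth_on_diff smooth_on_mult[OF _ smooth_on_const])
  thus ?thesis by (simp add: cubic_density_def[abs_def] divide_inverse)
qed

lemma cubic_density_scale:
  fixes F :: "real^'n::finite \<Rightarrow> real"
  assumes F: "minkowski_norm F" and c: "c > 0" and y: "y \<noteq> 0"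
  shows "cubic_density F (c *\<^sub>R y) = c * cubic_density F y"
proof -
  let ?E = "\<lambda>z. (F z)\<^sup>2"
  note E = minkowski_sq_smooth[OF F]
  have o: "open (-{0::real^'n})" by (simp add: open_Compl)
  have E1: "dderiv v ?E (d *\<^sub>R z) = d ^ Suc 0 * dderiv v ?E z" if "d > 0" "z \<noteq> 0" for d v z
    using homogeneous_dderiv[OF E, of 1 d z v] minkowski_scale[OF F] that by (simp add: power2_eq_square mult_ac)
  have "metric_tensor F (c *\<^sub>R y) $ i $ j = metric_tensor F y $ i $ j" for i j
    using homogeneous_dderiv[OF smooth_on_dderiv[OF E o] E1 c y] by (simp add: metric_tensor_eq)
  hence "metric_tensor F (c *\<^sub>R y) = metric_tensor F y" by (simp add: vec_eq_iff)
  moreover have "ln (F (c *\<^sub>R y)) = ln c + ln (F y)"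
    using c minkowski_pos[OF F y] by (simp add: minkowski_scale[OF F] ln_mult)
  ultimately show ?thesis using c by (simp add: cubic_density_def exp_add exp_diff)
qed


lemma dderiv_cubic_density:
  fixes F :: "real^'n::finite \<Rightarrow> real"
  assumes F: "minkowski_norm F" and y: "y \<noteq> 0"
  shows "partial_deriv k (cubic_density F) y = cubic_density F y *
    (partial_deriv k F y / F y - 2 * mean_cartan_torsion F y k / (real CARD('n) + 1))"
proof -
  let ?g = "\<lambda>y. det (metric_tensor F y)"
  let ?N = "2 * (real CARD('n) + 1)"
  have Fy: "F y > 0" and gy: "?g y \<noteq> 0" using minkowski_pos[OF F y] det_metric_tensor_nz[OF F y] by auto
  have dF: "F differentiable (at y)" and dg: "?g differentiable (at y)"
    using smooth_onD_diff[OF minkowski_smooth[OF F]] smooth_onD_diff[OF det_metric_tensor_smooth[OF F]] y by auto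
  have 1: "((\<lambda>t. F (y + t *\<^sub>R axis k 1)) has_real_derivative partial_deriv k F y) (at 0)"
    using dderiv_along_line[of F y 0 "axis k 1"] dF by (simp add: dderiv_axis)
  have 2: "((\<lambda>t. ?g (y + t *\<^sub>R axis k 1)) has_real_derivative 2 * ?g y * mean_cartan_torsion F y k) (at 0)"
    using dderiv_along_line[of ?g y 0 "axis k 1"] dg by (simp add: dderiv_axis partial_deriv_det_metric_tensor[OF F y])
  have 3: "((\<lambda>t. ln ((?g (y + t *\<^sub>R axis k 1))\<^sup>2)) has_real_derivative 4 * mean_cartan_torsion F y k) (at 0)"
  proof -
    have "((\<lambda>t. (?g (y + t *\<^sub>R axis k 1))\<^sup>2) has_real_derivative 4 * (?g y)\<^sup>2 * mean_cartan_torsion F y k) (at 0)"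
      using DERIV_power[OF 2, of 2] by (simp add: power2_eq_square mult_ac)
    moreover have "inverse ((?g y)\<^sup>2) * (4 * (?g y)\<^sup>2 * mean_cartan_torsion F y k) = 4 * mean_cartan_torsion F y k"
      using gy by (simp add: field_simps)
    moreover have "((\<lambda>t. ln ((?g (y + t *\<^sub>R axis k 1))\<^sup>2)) has_real_derivative
        inverse ((?g y)\<^sup>2) * (4 * (?g y)\<^sup>2 * mean_cartan_torsion F y k)) (at 0)"
      using calculation(1) DERIV_chain2[OF DERIV_ln, of "\<lambda>t. (?g (y + t *\<^sub>R axis k 1))\<^sup>2" 0
        "4 * (?g y)\<^sup>2 * mean_cartan_torsion F y k" UNIV] gy by simp
    ultimately show ?thesis by (simp only:)
  qed
  have 4: "((\<lambda>t. ln (F (y + t *\<^sub>R axis k 1))) has_real_derivative partial_deriv k F y / F y) (at 0)"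
    using DERIV_chain2[OF DERIV_ln 1] Fy by (simp add: field_simps)
  have "((\<lambda>t. cubic_density F (y + t *\<^sub>R axis k 1)) has_real_derivative
      exp (ln (F y) - ln ((?g y)\<^sup>2) / ?N) * (partial_deriv k F y / F y - 4 * mean_cartan_torsion F y k / ?N)) (at 0)"
    unfolding cubic_density_def
    using DERIV_chain2[OF DERIV_exp DERIV_diff[OF 4 DERIV_cdivide[OF 3, of ?N]]] by simp
  hence "partial_deriv k (cubic_density F) y = exp (ln (F y) - ln ((?g y)\<^sup>2) / ?N) * (partial_deriv k F y / F y - 4 * mean_cartan_torsion F y k / ?N)"
    unfolding partial_deriv_def by (rule DERIV_imp_deriv)
  moreover have "4 * c / ?N = 2 * c / (real CARD('n) + 1)" for c
    by (simp add: field_simps)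
  ultimately show ?thesis by (simp only: cubic_density_def)
qed

text \<open>Expressed through \<open>F\<close> instead of \<open>F\<^sup>2\<close>, the Cartan torsion acquires the cyclic
  products of \<open>F_ij\<close> and \<open>F_k\<close>. They have the same shape as the right-hand side of C-reducibility, and
  together the two covectors form the logarithmic gradient of the density. On coordinate axes this is
  the definition; both sides are symmetric trilinear forms.\<close>

lemma C_reducible_third_derivative:
  fixes F :: "real^'n::finite \<Rightarrow> real"
  assumes C: "C_reducible F" and y: "y \<noteq> 0"
  shows "cubic_density F y * dderiv w (dderiv v (dderiv u F)) y =
    - (dderiv v (dderiv u F) y * dderiv w (cubic_density F) y
     + dderiv w (dderiv v F) y * dderiv u (cubic_density F) y
     + dderiv w (dderiv u F) y * dderiv v (cubic_density F) y)"
proof -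
  have F: "minkowski_norm F" using C by (simp add: C_reducible_def)
  note f = minkowski_smooth[OF F]
  have Fy: "F y > 0" by (rule minkowski_pos[OF F y])
  let ?r = "cubic_density F"
  define N where "N = real CARD('n) + 1"
  have N: "N > 0" by (simp add: N_def)
  let ?C = "mean_cartan_torsion F y"
  let ?T = "\<lambda>u v w. ?r y * dderiv w (dderiv v (dderiv u F)) y"
  let ?R = "\<lambda>u v w. - (dderiv v (dderiv u F) y * dderiv w ?r y
     + dderiv w (dderiv v F) y * dderiv u ?r y + dderiv w (dderiv u F) y * dderiv v ?r y)"
  have axes: "?T (axis i 1) (axis j 1) (axis k 1) = ?R (axis i 1) (axis j 1) (axis k 1)" for i j k
  proof -
    let ?d = "\<lambda>i. dderiv (axis i 1 :: real^'n)"
    have "cartan_torsion F y i j k = 1 / N *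
       (F y * ?d j (?d i F) y * ?C k + F y * ?d k (?d j F) y * ?C i + F y * ?d i (?d k F) y * ?C j)"
      using C y by (simp add: C_reducible_def angular_metric_def N_def dderiv_axis)
    moreover have half: "X = 2 / N * Y" if "1 / 4 * (2 * X) = 1 / N * Y" for X Y :: real
      using that by simp
    ultimately have X: "?d k (?d j F) y * ?d i F y + ?d j F y * ?d k (?d i F) y
       + ?d k F y * ?d j (?d i F) y + F y * ?d k (?d j (?d i F)) y = 2 / N *
       (F y * ?d j (?d i F) y * ?C k + F y * ?d k (?d j F) y * ?C i + F y * ?d k (?d i F) y * ?C j)"
      unfolding cartan_torsion_eq third_derivative_square[OF f y] hessian_symmetric[OF f y, of "axis i 1" "axis k 1"]
      by blast
    have aux: "T = 2 / N * (p * c + q * d + r * e) - (a1 + a2 + a3) / F y"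
      if "a1 + a2 + a3 + F y * T = 2 / N * (F y * p * c + F y * q * d + F y * r * e)"
      for T p q r c d e a1 a2 a3
    proof -
      have "F y * T = F y * (2 / N * (p * c + q * d + r * e)) - (a1 + a2 + a3)"
        using that by (simp add: algebra_simps)
      thus ?thesis using Fy by (simp add: field_simps)
    qed
    note * = aux[OF X]
    have r: "?d l ?r y = ?r y * (?d l F y / F y - 2 * ?C l / N)" for l
      unfolding dderiv_axis N_def by (rule dderiv_cubic_density[OF F y])
    show ?thesis unfolding * r using Fy by (simp add: algebra_simps add_divide_distrib)
  qed
  have lin: "linear (\<lambda>w. ?T u v w)" "linear (\<lambda>w. ?R u v w)" for u v
    by (intro linearI; simp add: dderiv_add_left dderiv_scale_left algebra_simps)+
  have sw: "?T u v w = ?T w u v" "?R u v w = ?R w u v" for u v w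
    using third_derivative_symmetric[OF f y] hessian_symmetric[OF f y] by (metis, simp add: algebra_simps)
  have 1: "?T (axis i 1) (axis j 1) w = ?R (axis i 1) (axis j 1) w" for i j w
    by (rule linear_eq_on_axes[OF lin axes])
  have 2: "?T (axis i 1) v w = ?R (axis i 1) v w" for i v w
  proof -
    have "?T w (axis i 1) v = ?R w (axis i 1) v"
      by (rule linear_eq_on_axes[OF lin]) (use 1 sw in metis)
    thus ?thesis using sw by metis
  qed
  have "?T v w u = ?R v w u"
    by (rule linear_eq_on_axes[OF lin]) (use 2 sw in metis)
  thus ?thesis using sw by metis
qed

lemma exists_axis_off_line:
  fixes y :: "real^'n::finite"
  assumes "2 \<le> CARD('n)"
  obtains i where "\<And>c. axis i 1 \<noteq> c *\<^sub>R y"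
proof (rule ccontr)
  assume "\<not> thesis"
  hence *: "\<exists>c. axis i 1 = c *\<^sub>R y" for i using that by blast
  have "card (UNIV :: 'n set) \<noteq> 0" "\<not> card (UNIV :: 'n set) \<le> 1" using assms by auto
  then obtain i j :: 'n where ij: "i \<noteq> j"
    by (metis card_le_Suc0_iff_eq finite One_nat_def UNIV_I)
  obtain c d where c: "axis i 1 = c *\<^sub>R y" and d: "axis j 1 = d *\<^sub>R y" using *[of i] *[of j] by blast
  have "c * y $ i = 1" using arg_cong[OF c, of "\<lambda>v. v $ i"] by simp
  moreover have "d * y $ i = 0" "d * y $ j = 1"
    using arg_cong[OF d, of "\<lambda>v. v $ i"] arg_cong[OF d, of "\<lambda>v. v $ j"] ij by (auto simp: axis_def)
  ultimately show False by auto
qed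

text \<open>The identity for the third derivatives of \<open>F\<close> is differentiated in two ways that lead to
  the same fourth derivative. All terms with third derivatives cancel in the difference, and an
  algebraic relation between the two Hessians remains.\<close>

lemma density_hessian_relation:
  fixes F :: "real^'n::finite \<Rightarrow> real"
  assumes C: "C_reducible F" and y: "y \<noteq> 0"
  defines "r \<equiv> cubic_density F"
  shows "dderiv u (dderiv w F) y * dderiv u (dderiv u r) y = dderiv u (dderiv u F) y * dderiv u (dderiv w r) y"
proof -
  have F: "minkowski_norm F" using C by (simp add: C_reducible_def)
  have o: "open (-{0::real^'n})" by (simp add: open_Compl)
  note f = minkowski_smooth[OF F] and s = cubic_density_smooth[OF F, folded r_def]
  have d: "h differentiable (at y)" "dderiv a h differentiable (at y)" "dderiv b (dderiv a h) differentiable (at y)"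
     "dderiv c (dderiv b (dderiv a h)) differentiable (at y)"
     if "smooth_on (-{0}) h" for h a b c
    using y that o smooth_onD_diff smooth_on_dderiv by (metis ComplI singletonD)+
  note df = d[OF f] and ds = d[OF s]
  \<comment> \<open>the third-derivative identity for the arguments \<open>u, u, a\<close>, differentiated along \<open>b\<close>\<close>
  have diff: "r y * dderiv b (dderiv a (dderiv u (dderiv u F))) y + dderiv b r y * dderiv a (dderiv u (dderiv u F)) y
     = - (dderiv u (dderiv u F) y * dderiv b (dderiv a r) y + dderiv b (dderiv u (dderiv u F)) y * dderiv a r y
        + 2 * (dderiv a (dderiv u F) y * dderiv b (dderiv u r) y + dderiv b (dderiv a (dderiv u F)) y * dderiv u r y))"
    for a b
  proof -
    have "dderiv b (\<lambda>z. r z * dderiv a (dderiv u (dderiv u F)) z) y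
       = dderiv b (\<lambda>z. (- 1) * (dderiv u (dderiv u F) z * dderiv a r z + 2 * (dderiv a (dderiv u F) z * dderiv u r z))) y"
      by (rule dderiv_cong[OF o])
         (use y in \<open>auto simp: r_def C_reducible_third_derivative[OF C]\<close>)
    also have "\<dots> = (- 1) * (dderiv b (\<lambda>z. dderiv u (dderiv u F) z * dderiv a r z) y
       + 2 * dderiv b (\<lambda>z. dderiv a (dderiv u F) z * dderiv u r z) y)"
    proof -
      let ?p = "\<lambda>z. dderiv u (dderiv u F) z * dderiv a r z" and ?q = "\<lambda>z. dderiv a (dderiv u F) z * dderiv u r z"
      have p: "?p differentiable (at y)" and q: "?q differentiable (at y)"
        by (intro differentiable_mult df ds)+
      have q2: "(\<lambda>z. 2 * ?q z) differentiable (at y)" using differentiable_mult[OF differentiable_const q] .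
      show ?thesis
        using dderiv_cmult[OF differentiable_add[OF p q2], of b "- 1"] dderiv_add[OF p q2] dderiv_cmult[OF q, of b 2]
        by simp
    qed
    finally show ?thesis
      by (simp add: dderiv_mult df ds)
  qed
  have sw: "dderiv u (dderiv w (dderiv u (dderiv u F))) y = dderiv w (dderiv u (dderiv u (dderiv u F))) y"
    by (intro hessian_symmetric smooth_on_dderiv f o y)
  have sr: "dderiv u (dderiv w r) y = dderiv w (dderiv u r) y"
    by (rule hessian_symmetric[OF s y])
  have sF: "dderiv u (dderiv w F) y = dderiv w (dderiv u F) y"
    by (rule hessian_symmetric[OF f y])
  have tF: "dderiv u (dderiv w (dderiv u F)) y = dderiv w (dderiv u (dderiv u F)) y"
    by (rule third_derivative_symmetric(1)[OF f y])
  show ?thesis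
    using diff[of u w] diff[of w u] unfolding sw sr sF tF by (simp add: algebra_simps)
qed

text \<open>The factor is the quotient of the traces of the two Hessians, which shows that
  it depends smoothly on the point.\<close>

lemma cubic_density_hessian_proportional:
  fixes F :: "real^'n::finite \<Rightarrow> real"
  assumes C: "C_reducible F"
  obtains \<mu> where "smooth_on (-{0}) \<mu>"
    "\<And>y u v. y \<noteq> 0 \<Longrightarrow> dderiv u (dderiv v (cubic_density F)) y = \<mu> y * dderiv u (dderiv v F) y"
proof -
  have F: "minkowski_norm F" and n: "3 \<le> CARD('n)" using C by (auto simp: C_reducible_def)
  have o: "open (-{0::real^'n})" by (simp add: open_Compl)
  let ?r = "cubic_density F"
  note f = minkowski_smooth[OF F] and s = cubic_density_smooth[OF F]
  let ?H = "\<lambda>h y. \<Sum>i\<in>UNIV. dderiv (axis i 1) (dderiv (axis i 1) h) y"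
  have nonneg: "0 \<le> dderiv u (dderiv u F) y" if y: "y \<noteq> 0" for u y
  proof (cases "\<exists>c. u = c *\<^sub>R y")
    case True
    then obtain c where c: "u = c *\<^sub>R y" by blast
    have "dderiv u (dderiv u F) y = c * dderiv u (dderiv y F) y"
      using hessian_symmetric[OF f y, of y u] by (simp add: c dderiv_scale_left)
    thus ?thesis using hessian_norm_null(2)[OF F y] by simp
  next
    case False thus ?thesis using hessian_norm_pos[OF F y, of u] by force
  qed
  have tr: "0 < ?H F y" if y: "y \<noteq> 0" for y
  proof -
    obtain i where i: "\<And>c. axis i 1 \<noteq> c *\<^sub>R y" using exists_axis_off_line[of y] n by auto
    show ?thesis
      by (rule sum_pos2[of UNIV i]) (use hessian_norm_pos[OF F y i] nonneg[OF y] in auto)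
  qed
  define \<mu> where "\<mu> y = ?H ?r y / ?H F y" for y
  have "smooth_on (-{0}) \<mu>"
    unfolding \<mu>_def[abs_def]
    by (intro smooth_on_divide smooth_on_sum smooth_on_dderiv f s o) (use tr in force)
  moreover have "dderiv u (dderiv v ?r) y = \<mu> y * dderiv u (dderiv v F) y" if y: "y \<noteq> 0" for y u v
  proof -
    obtain i where i: "\<And>c. axis i 1 \<noteq> c *\<^sub>R y" using exists_axis_off_line[of y] n by auto
    let ?a = "axis i 1 :: real^'n"
    define m where "m = dderiv ?a (dderiv ?a ?r) y / dderiv ?a (dderiv ?a F) y"
    have m: "dderiv u (dderiv v ?r) y = m * dderiv u (dderiv v F) y" for u v
      unfolding m_def
      by (rule proportional_forms[OF hessian_bilinear[OF f y] hessian_symmetric[OF f y] hessian_bilinear[OF s y] hessian_symmetric[OF s y]])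
         (use hessian_norm_pos[OF F y i] density_hessian_relation[OF C y] in auto)
    have "?H ?r y = m * ?H F y" by (simp add: m sum_distrib_left)
    hence "\<mu> y = m" using tr[OF y] by (simp add: \<mu>_def)
    thus ?thesis using m by simp
  qed
  ultimately show ?thesis using that by blast
qed

text \<open>The symmetry of the third derivatives of the density gives
  \<open>\<mu>_w F_uu = \<mu>_u F_uw\<close>. The derivative of \<open>\<mu>\<close> along \<open>w\<close> vanishes as soon as some \<open>u\<close> that is not a
  multiple of \<open>y\<close> satisfies \<open>F_uw = 0\<close>, and the punctured space is connected.\<close>

lemma cubic_density_hessian_multiple:
  fixes F :: "real^'n::finite \<Rightarrow> real"
  assumes C: "C_reducible F"
  obtains c where
    "\<And>y u v. y \<noteq> 0 \<Longrightarrow> dderiv u (dderiv v (cubic_density F)) y = c * dderiv u (dderiv v F) y"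
proof -
  have F: "minkowski_norm F" and n: "3 \<le> CARD('n)" using C by (auto simp: C_reducible_def)
  have o: "open (-{0::real^'n})" by (simp add: open_Compl)
  let ?r = "cubic_density F"
  note f = minkowski_smooth[OF F] and s = cubic_density_smooth[OF F]
  obtain \<mu> where mu: "smooth_on (-{0}) \<mu>"
    "\<And>y u v. y \<noteq> 0 \<Longrightarrow> dderiv u (dderiv v ?r) y = \<mu> y * dderiv u (dderiv v F) y"
    using cubic_density_hessian_proportional[OF C] by blast
  have "dderiv w \<mu> y = 0" if y: "y \<noteq> 0" for w y
  proof -
    have d: "\<mu> differentiable (at y)" "dderiv a (dderiv b F) differentiable (at y)" for a b
      using y o smooth_onD_diff[OF mu(1)] smooth_onD_diff[OF smooth_on_dderiv[OF smooth_on_dderiv[OF f o] o]] by auto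
    have third: "dderiv a (dderiv b (dderiv e ?r)) y = \<mu> y * dderiv a (dderiv b (dderiv e F)) y + dderiv a \<mu> y * dderiv b (dderiv e F) y"
      for a b e
      unfolding dderiv_mult[OF d, symmetric] by (rule dderiv_cong[OF o]) (use y mu(2) in auto)
    \<comment> \<open>a direction off the ray through \<open>y\<close> that is conjugate to \<open>w\<close>; it exists because \<open>n \<ge> 3\<close>\<close>
    define a :: "real^'n" where "a = (\<chi> i. dderiv (axis i 1) (dderiv w F) y)"
    have "dim {y, a} < DIM(real^'n)"
      using dim_le_card'[of "{y, a}"] card_insert_le_m1[of 2 "{a}" y] n by auto
    then obtain u where u: "u \<noteq> 0" "\<And>v. v \<in> span {y, a} \<Longrightarrow> orthogonal u v"
      by (rule orthogonal_to_subspace_exists) blast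
    have uy: "u \<bullet> y = 0" and ua: "u \<bullet> a = 0" using u(2)[of y] u(2)[of a] by (auto simp: orthogonal_def span_base)
    have "u \<noteq> c *\<^sub>R y" for c using uy u(1) by (metis inner_eq_zero_iff inner_scaleR_right mult_zero_right)
    hence pos: "0 < dderiv u (dderiv u F) y" by (rule hessian_norm_pos[OF F y])
    have "dderiv u (dderiv w F) y = 0" using ua by (simp add: a_def inner_vec_def dderiv_def[of u] dderiv_axis)
    hence "dderiv w (dderiv u F) y = 0" using hessian_symmetric[OF f y] by metis
    moreover have "dderiv u (dderiv w (dderiv u ?r)) y = dderiv w (dderiv u (dderiv u ?r)) y"
      "dderiv u (dderiv w (dderiv u F)) y = dderiv w (dderiv u (dderiv u F)) y"
      by (intro third_derivative_symmetric(1) f s y)+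
    ultimately have "dderiv w \<mu> y * dderiv u (dderiv u F) y = 0" by (simp add: third)
    thus ?thesis using pos by simp
  qed
  from zero_gradient_constant[OF _ mu(1) this] n obtain c where "\<And>y. y \<noteq> 0 \<Longrightarrow> \<mu> y = c"
    by (metis le_trans numeral_le_iff semiring_norm(72) semiring_norm(68) one_le_numeral Suc_1 Suc_leD eval_nat_numeral(3))
  thus ?thesis using that mu(2) by metis
qed


text \<open>If the Hessian of \<open>r\<close> is \<open>c\<close> times that of \<open>F\<close>, then \<open>c\<close> times the identity \<open>third\<close>
  says that the third derivatives of \<open>r\<^sup>2\<close> vanish. So \<open>r\<close> is the square root of a quadratic form and
  differs from \<open>c F\<close> by a linear form.\<close>

lemma randers_norm_of_hessian_multiple:
  fixes F r :: "real^'n::finite \<Rightarrow> real"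
  assumes F: "minkowski_norm F" and r: "smooth_on (-{0}) r"
    and hom: "\<And>c y. c > 0 \<Longrightarrow> y \<noteq> 0 \<Longrightarrow> r (c *\<^sub>R y) = c * r y" and pos: "\<And>y. r y > 0"
    and hess: "\<And>y u v. y \<noteq> 0 \<Longrightarrow> dderiv u (dderiv v r) y = c * dderiv u (dderiv v F) y"
    and third: "\<And>y u v w. y \<noteq> 0 \<Longrightarrow> r y * dderiv w (dderiv v (dderiv u F)) y =
      - (dderiv v (dderiv u F) y * dderiv w r y + dderiv w (dderiv v F) y * dderiv u r y
       + dderiv w (dderiv u F) y * dderiv v r y)"
  obtains a B where "bilinear B" "\<And>x y. B x y = B y x" "\<And>x. x \<noteq> 0 \<Longrightarrow> (0::real) < B x x"
    "\<And>y. F y = sqrt (B y y) + a \<bullet> y"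
proof -
  have n: "2 \<le> CARD('n)" using F by (simp add: minkowski_norm_def)
  have o: "open (-{0::real^'n})" by (simp add: open_Compl)
  note f = minkowski_smooth[OF F]
  obtain e :: "real^'n" where e: "e \<noteq> 0" using vector_choose_size[of 1] by (metis norm_zero zero_neq_one zero_le_one)
  \<comment> \<open>\<open>r - c F\<close> is linear\<close>
  define h where "h y = r y - c * F y" for y
  have h: "smooth_on (-{0}) h" unfolding h_def
    by (intro smooth_on_diff r smooth_on_mult[OF smooth_on_const f] o)
  have "dderiv u (dderiv v h) y = 0" if y: "y \<noteq> 0" for u v y
  proof -
    have d: "r differentiable (at z)" "F differentiable (at z)" "dderiv v r differentiable (at z)" "dderiv v F differentiable (at z)"
       if "z \<noteq> 0" for z
      using that smooth_onD_diff[OF r] smooth_onD_diff[OF f] smooth_onD_diff[OF smooth_on_dderiv[OF r o]]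
        smooth_onD_diff[OF smooth_on_dderiv[OF f o]] by auto
    have "dderiv u (dderiv v h) y = dderiv u (\<lambda>z. dderiv v r z - c * dderiv v F z) y"
    proof (rule dderiv_cong[OF o])
      fix z :: "real^'n" assume "z \<in> -{0}"
      hence z: "z \<noteq> 0" by simp
      have "(\<lambda>z. c * F z) differentiable (at z)" using d(2)[OF z] by (intro differentiable_mult differentiable_const)
      thus "dderiv v h z = dderiv v r z - c * dderiv v F z"
        unfolding h_def using d[OF z] by (simp add: dderiv_diff dderiv_cmult)
    qed (use y in simp)
    also have "\<dots> = dderiv u (dderiv v r) y - c * dderiv u (dderiv v F) y"
    proof -
      have "(\<lambda>z. c * dderiv v F z) differentiable (at y)" using d(4)[OF y] by (intro differentiable_mult differentiable_const)
      thus ?thesis using d[OF y] by (simp add: dderiv_diff dderiv_cmult)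
    qed
    finally show ?thesis using hess[OF y] by simp
  qed
  moreover have "h (d *\<^sub>R y) = d * h y" if "d > 0" "y \<noteq> 0" for d y
    using that by (simp add: h_def hom minkowski_scale[OF F] algebra_simps)
  ultimately obtain a where a: "\<And>y. y \<noteq> 0 \<Longrightarrow> h y = a \<bullet> y"
    using zero_hessian_linear[OF n h] by blast
  have ra: "r y = c * F y + a \<bullet> y" if "y \<noteq> 0" for y using a[OF that] by (simp add: h_def)
  \<comment> \<open>hence \<open>r(y) + r(-y) = c (F(y) + F(-y))\<close>, which forces \<open>c > 0\<close>\<close>
  have "0 < c * (F e + F (- e))" using ra[OF e] ra[of "- e"] e pos[of e] pos[of "- e"] by (simp add: algebra_simps)
  hence c: "c > 0" using minkowski_nonneg[OF F, of e] minkowski_nonneg[OF F, of "- e"]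
    by (metis add_nonneg_nonneg zero_less_mult_pos2 mult_nonpos_nonneg not_le)
  \<comment> \<open>\<open>r\<^sup>2\<close> is a quadratic form, because its third derivatives vanish\<close>
  let ?q = "\<lambda>z. (r z)\<^sup>2"
  have q: "smooth_on (-{0}) ?q" by (intro smooth_on_power r o)
  have "dderiv w (dderiv v (dderiv u ?q)) y = 0" if y: "y \<noteq> 0" for u v w y
  proof -
    have "dderiv w (dderiv v (dderiv u r)) y = c * dderiv w (dderiv v (dderiv u F)) y"
      unfolding dderiv_cmult[OF smooth_onD_diff[OF smooth_on_dderiv[OF smooth_on_dderiv[OF f o] o]], of y, simplified, OF y, symmetric]
      by (rule dderiv_cong[OF o]) (use y hess in auto)
    moreover have "c * (r y * dderiv w (dderiv v (dderiv u F)) y) = c * - (dderiv v (dderiv u F) y * dderiv w r y + dderiv w (dderiv v F) y * dderiv u r y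
       + dderiv w (dderiv u F) y * dderiv v r y)" by (simp only: third[OF y])
    ultimately show ?thesis
      unfolding third_derivative_square[OF r y] hess[OF y] by (simp add: algebra_simps)
  qed
  hence const: "dderiv v (dderiv u ?q) y = dderiv v (dderiv u ?q) e" if "y \<noteq> 0" for u v y
    using zero_gradient_constant[OF n smooth_on_dderiv[OF smooth_on_dderiv[OF q o] o], of v u] that e by metis
  define B where "B u v = 1 / (2 * c\<^sup>2) * dderiv u (dderiv v ?q) e" for u v
  have "bilinear (\<lambda>u v. dderiv u (dderiv v ?q) e)" by (rule hessian_bilinear[OF q e])
  hence bil: "bilinear B"
    by (auto simp: bilinear_def B_def linear_iff add_divide_distrib)
  have sym: "B u v = B v u" for u v using hessian_symmetric[OF q e] by (simp add: B_def)
  have rB: "(r y)\<^sup>2 = c\<^sup>2 * B y y" if y: "y \<noteq> 0" for y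
  proof -
    have hom2: "?q (d *\<^sub>R z) = d ^ Suc 1 * ?q z" if "d > 0" "z \<noteq> 0" for d z
      using hom[OF that] by (simp add: power2_eq_square)
    have "dderiv y (dderiv y ?q) y = real 1 * dderiv y ?q y"
      by (rule euler_homogeneous[OF smooth_on_dderiv[OF q o]])
         (use homogeneous_dderiv[OF q hom2, of _ _ y] y in auto)
    moreover have "dderiv y ?q y = real (Suc 1) * ?q y"
      by (rule euler_homogeneous[OF q hom2 y])
    ultimately show ?thesis using const[OF y, of y y] c by (simp add: B_def)
  qed
  have Bpos: "0 < B x x" if "x \<noteq> 0" for x
    using rB[OF that] pos[of x] c by (metis zero_less_mult_pos zero_less_power)
  have "F y = sqrt (B y y) + (- a /\<^sub>R c) \<bullet> y" for y
  proof (cases "y = 0")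
    case True
    thus ?thesis by (simp add: minkowski_zero[OF F] bilinear_lzero[OF bil])
  next
    case False
    have "r y = sqrt ((r y)\<^sup>2)" using pos[of y] by simp
    also have "\<dots> = c * sqrt (B y y)" using c by (simp add: rB[OF False] real_sqrt_mult)
    finally show ?thesis using ra[OF False] c by (simp add: field_simps)
  qed
  thus ?thesis using that[OF bil sym Bpos] by blast
qed

text \<open>The theorem of Matsumoto and Hojo. Their second family, the Kropina metrics, would correspond
  to \<open>c = 0\<close> in the preceding lemma; on the whole punctured space it does not occur. The dual norm of
  the linear part is less than \<open>1\<close> because the norm is positive at \<open>y\<close> and at \<open>- y\<close>, and because the
  supremum is attained.\<close>

theorem C_reducible_imp_randers:
  fixes F :: "real^'n::finite \<Rightarrow> real"
  assumes C: "C_reducible F"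
  shows "randers_norm F"
proof -
  have F: "minkowski_norm F" using C by (auto simp: C_reducible_def)
  obtain c where hess: "\<And>y u v. y \<noteq> 0 \<Longrightarrow> dderiv u (dderiv v (cubic_density F)) y = c * dderiv u (dderiv v F) y"
    using cubic_density_hessian_multiple[OF C] by blast
  obtain a B where B: "bilinear B" "\<And>x y. B x y = B y x" "\<And>x. x \<noteq> 0 \<Longrightarrow> (0::real) < B x x"
    "\<And>y. F y = sqrt (B y y) + a \<bullet> y"
    using randers_norm_of_hessian_multiple[OF F cubic_density_smooth[OF F] cubic_density_scale[OF F] cubic_density_pos hess
      C_reducible_third_derivative[OF C]] by metis
  define \<alpha> where "\<alpha> y = sqrt (B y y)" for y
  define \<beta> where "\<beta> = Blinfun (\<lambda>y. a \<bullet> y)"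
  have \<beta>: "blinfun_apply \<beta> y = a \<bullet> y" for y
    by (simp add: \<beta>_def bounded_linear_Blinfun_apply bounded_linear_inner_right)
  have \<alpha>_pos: "0 < \<alpha> y" if "y \<noteq> 0" for y using B(3)[OF that] by (simp add: \<alpha>_def)
  have B_scale: "B (k *\<^sub>R y) (k *\<^sub>R y) = k\<^sup>2 * B y y" for k y
    by (simp add: bilinear_lmul[OF B(1)] bilinear_rmul[OF B(1)] power2_eq_square)
  have \<alpha>_scale: "\<alpha> (k *\<^sub>R y) = \<bar>k\<bar> * \<alpha> y" for k y
    by (simp add: \<alpha>_def B_scale real_sqrt_mult)
  have lt: "\<bar>a \<bullet> y\<bar> / \<alpha> y < 1" if y: "y \<noteq> 0" for y
    using minkowski_pos[OF F, of y] minkowski_pos[OF F, of "- y"] y \<alpha>_scale[of "-1" y] \<alpha>_pos[OF y]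
    by (simp add: B(4) flip: \<alpha>_def) 
  let ?S = "sphere (0::real^'n) 1"
  let ?q = "\<lambda>y. \<bar>a \<bullet> y\<bar> / \<alpha> y"
  have "continuous_on ?S (\<lambda>y. F y - a \<bullet> y)"
    by (intro continuous_intros continuous_on_subset[OF minkowski_continuous[OF F]]) auto
  hence "continuous_on ?S \<alpha>" by (simp add: B(4) flip: \<alpha>_def)
  moreover have "\<forall>y\<in>?S. \<alpha> y \<noteq> 0"
  proof
    fix y assume "y \<in> ?S"
    hence "y \<noteq> 0" by auto
    thus "\<alpha> y \<noteq> 0" using \<alpha>_pos[of y] by simp
  qed
  ultimately have "continuous_on ?S ?q"
    by (intro continuous_on_divide continuous_on_rabs continuous_on_inner continuous_on_const continuous_on_id)
  then obtain z where z: "z \<in> ?S" "\<And>y. y \<in> ?S \<Longrightarrow> ?q y \<le> ?q z"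
    using continuous_attains_sup[OF compact_sphere, of 0 1 ?q] by auto
  have "dual_norm \<alpha> \<beta> \<le> ?q z"
    unfolding dual_norm_def \<beta>
  proof (rule cSUP_least)
    show "- {0::real^'n} \<noteq> {}" using z(1) by force
    fix y :: "real^'n" assume "y \<in> - {0}"
    hence y: "y \<noteq> 0" by simp
    have "?q y = ?q (y /\<^sub>R norm y)" using y by (simp add: \<alpha>_scale abs_mult)
    also have "\<dots> \<le> ?q z" by (rule z(2)) (use y in simp)
    finally show "?q y \<le> ?q z" .
  qed
  also have "?q z < 1" using z(1) by (intro lt) auto
  finally have "dual_norm \<alpha> \<beta> < 1" .
  moreover have "euclidean_norm \<alpha>"
    unfolding euclidean_norm_def using B by (auto simp: \<alpha>_def)
  ultimately show ?thesis
    unfolding randers_norm_def using B(4) by (auto simp: \<beta> \<alpha>_def intro!: exI[of _ \<alpha>] exI[of _ \<beta>])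
qed

section \<open>Smooth gauges and radial squeezing\<close>

lemma Ck_on_Un: "Ck_on k S f \<Longrightarrow> Ck_on k T f \<Longrightarrow> open S \<Longrightarrow> open T \<Longrightarrow> Ck_on k (S \<union> T) f"
  by (induction k arbitrary: f) (auto intro: continuous_on_open_Un)

lemma smooth_on_Un: "smooth_on S f \<Longrightarrow> smooth_on T f \<Longrightarrow> open S \<Longrightarrow> open T \<Longrightarrow> smooth_on (S \<union> T) f"
  by (simp add: smooth_on_def Ck_on_Un)

text \<open>For \<open>q = 1\<close> this is the classical function \<open>exp (- 1/x)\<close>; with the polynomial factor the family is
  closed under differentiation.\<close>

definition flat :: "real poly \<Rightarrow> real \<Rightarrow> real" where
  "flat q x = (if x > 0 then poly q (1 / x) * exp (- (1 / x)) else 0)"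

lemma poly_times_exp_minus_tendsto_0: "((\<lambda>t::real. t ^ k * poly q t * exp (- t)) \<longlongrightarrow> 0) at_top"
proof (induction q arbitrary: k)
  case (pCons a q)
  have "((\<lambda>t. a * (t ^ k / exp t) + t ^ Suc k * poly q t * exp (- t)) \<longlongrightarrow> a * 0 + 0) at_top"
    by (intro tendsto_intros tendsto_power_div_exp_0 pCons.IH)
  thus ?case by (simp add: exp_minus field_simps)
qed simp

lemma flat_has_derivative:
  "(flat q has_real_derivative flat ([:0, 0, 1:] * (q - pderiv q)) x) (at x)"
proof -
  consider "x < 0" | "x > 0" | "x = 0" by linarith
  thus ?thesis
  proof cases
    case 1
    have "(flat q has_real_derivative 0) (at x)"
      by (rule has_field_derivative_transform_within_open[OF DERIV_const, where S="{..<0}"]) (use 1 in \<open>auto simp: flat_def\<close>)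
    thus ?thesis using 1 by (simp add: flat_def)
  next
    case 2
    have "((\<lambda>x. poly q (1 / x) * exp (- (1 / x))) has_real_derivative
       poly (pderiv q) (1 / x) * (- (1 / x\<^sup>2)) * exp (- (1 / x)) + exp (- (1 / x)) * (1 / x\<^sup>2) * poly q (1 / x)) (at x)"
    proof -
      have i: "((\<lambda>x. 1 / x) has_real_derivative - (1 / x\<^sup>2)) (at x)"
        using DERIV_inverse[of x] 2 by (simp add: inverse_eq_divide power2_eq_square)
      have p: "((\<lambda>x. poly q (1 / x)) has_real_derivative poly (pderiv q) (1 / x) * (- (1 / x\<^sup>2))) (at x)"
        by (rule DERIV_chain2[OF poly_DERIV i])
      have e: "((\<lambda>x. exp (- (1 / x))) has_real_derivative exp (- (1 / x)) * (1 / x\<^sup>2)) (at x)"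
        using DERIV_chain2[OF DERIV_exp DERIV_minus[OF i]] by simp
      show ?thesis using DERIV_mult[OF p e] by (simp add: add.commute)
    qed
    hence "(flat q has_real_derivative
       poly (pderiv q) (1 / x) * (- (1 / x\<^sup>2)) * exp (- (1 / x)) + exp (- (1 / x)) * (1 / x\<^sup>2) * poly q (1 / x)) (at x)"
      by (rule has_field_derivative_transform_within_open[where S="{0<..}"]) (use 2 in \<open>auto simp: flat_def\<close>)
    thus ?thesis using 2 by (simp add: flat_def algebra_simps power2_eq_square)
  next
    case 3
    have "((\<lambda>h. flat q h / h) \<longlongrightarrow> 0) (at 0)"
      unfolding filterlim_at_split
    proof
      have "((\<lambda>h::real. (inverse h) ^ 1 * poly q (inverse h) * exp (- inverse h)) \<longlongrightarrow> 0) (at_right 0)"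
        by (rule filterlim_compose[OF poly_times_exp_minus_tendsto_0 filterlim_inverse_at_top_right])
      moreover have "eventually (\<lambda>h::real. (inverse h) ^ 1 * poly q (inverse h) * exp (- inverse h) = flat q h / h) (at_right 0)"
        unfolding eventually_at_right_field
        by (rule exI[of _ 1]) (auto simp: flat_def field_simps)
      ultimately show "((\<lambda>h. flat q h / h) \<longlongrightarrow> 0) (at_right 0)"
        by (rule Lim_transform_eventually)
      have "eventually (\<lambda>h::real. 0 = flat q h / h) (at_left 0)"
        unfolding eventually_at_left_field
        by (rule exI[of _ "-1"]) (auto simp: flat_def)
      thus "((\<lambda>h. flat q h / h) \<longlongrightarrow> 0) (at_left 0)"
        by (rule Lim_transform_eventually[OF tendsto_const])
    qed
    thus ?thesis using 3 by (simp add: DERIV_def flat_def)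
  qed
qed

lemma smooth_on_flat:
  fixes f :: "real^'n::finite \<Rightarrow> real"
  assumes "smooth_on S f" "open S"
  shows "smooth_on S (\<lambda>x. flat q (f x))"
proof -
  let ?D = "\<lambda>q :: real poly. [:0, 0, 1:] * (q - pderiv q)"
  have "Ck_on k S (\<lambda>x. flat ((?D ^^ 0) q) (f x))" for k
    using assms by (intro Ck_on_compose_real[where T=UNIV and g="\<lambda>j. flat ((?D ^^ j) q)"])
      (auto simp: smooth_on_def flat_has_derivative simp del: mult_pCons_left)
  thus ?thesis by (simp add: smooth_on_def)
qed

text \<open>A smooth substitute for \<open>max 0 (x - 1)\<close> with slope at most \<open>1\<close>.\<close>

definition ramp :: "real \<Rightarrow> real" where "ramp x = x * flat 1 x"

lemma ramp_nonpos [simp]: "x \<le> 0 \<Longrightarrow> ramp x = 0"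
  by (simp add: ramp_def flat_def)

lemma ramp_nonneg: "0 \<le> ramp x"
  by (simp add: ramp_def flat_def)

lemma ramp_ge: "x - 1 \<le> ramp x"
proof (cases "x > 0")
  case True
  have "1 - 1 / x \<le> exp (- (1 / x))" using exp_ge_add_one_self[of "- (1/x)"] by simp
  hence "x * (1 - 1 / x) \<le> x * exp (- (1 / x))" using True by (intro mult_left_mono) auto
  thus ?thesis using True by (simp add: ramp_def flat_def right_diff_distrib)
qed simp

lemma ramp_has_derivative:
  obtains w where "(ramp has_real_derivative w) (at x)" "w \<le> 1" "x * w - ramp x \<le> 1"
proof -
  define w where "w = x * flat ([:0, 0, 1:] * (1 - pderiv 1)) x + flat 1 x"
  have "(ramp has_real_derivative w) (at x)"
    unfolding ramp_def[abs_def] w_def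
    using DERIV_mult[OF DERIV_ident flat_has_derivative[of 1 x]] by (simp add: add.commute mult.commute)
  moreover have "w \<le> 1"
  proof (cases "x > 0")
    case True
    have "w = (1 + 1 / x) * exp (- (1 / x))"
      using True by (simp add: w_def flat_def field_simps)
    also have "\<dots> \<le> exp (1 / x) * exp (- (1 / x))"
      by (intro mult_right_mono) auto
    finally show ?thesis by (simp flip: exp_add)
  qed (simp add: w_def flat_def)
  moreover have "x * w - ramp x \<le> 1"
  proof (cases "x > 0")
    case True
    have "x * w - ramp x = exp (- (1 / x))"
      using True by (simp add: w_def ramp_def flat_def field_simps)
    thus ?thesis using True by simp
  qed (simp add: w_def ramp_def flat_def)
  ultimately show ?thesis using that by blast
qed

text \<open>The factor by which \<open>s\<close> is pulled back along its ray towards the set \<open>M \<le> 1\<close>, whose points stay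
  fixed. With the constant \<open>\<tau> / (1 + \<tau>)\<^sup>2\<close> the ramp is steep enough to pull the whole space into
  \<open>M \<le> (1 + \<tau>)\<^sup>2\<close>, and flat enough for the resulting radial map to be increasing along rays.\<close>

definition squeeze :: "(real^'p::finite \<Rightarrow> real) \<Rightarrow> real \<Rightarrow> real^'p \<Rightarrow> real" where
  "squeeze M \<tau> s = 1 / (1 + \<tau> / (1 + \<tau>)\<^sup>2 * ramp ((M s - 1) / \<tau>))"

locale smooth_gauge =
  fixes M :: "real^'p::finite \<Rightarrow> real" and \<tau> :: real
  assumes tau: "0 < \<tau>" and smooth: "smooth_on (-{0}) M"
    and cont: "continuous_on UNIV M" and M0: "M 0 = 0"
    and scale: "\<And>c s. 0 < c \<Longrightarrow> M (c *\<^sub>R s) = c * M s"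
begin

lemma squeeze_denominator: "1 \<le> 1 + \<tau> / (1 + \<tau>)\<^sup>2 * ramp x"
  using tau ramp_nonneg[of x] by simp

lemma squeeze_pos: "0 < squeeze M \<tau> s"
  using squeeze_denominator[of "(M s - 1) / \<tau>"] by (simp add: squeeze_def)

lemma squeeze_eq_1: "M s \<le> 1 \<Longrightarrow> squeeze M \<tau> s = 1"
  using tau by (simp add: squeeze_def divide_le_0_iff)

lemma squeeze_smooth: "smooth_on UNIV (squeeze M \<tau>)"
proof -
  have o: "open (-{0::real^'p})" by (simp add: open_Compl)
  have "smooth_on (-{0}) (\<lambda>s. (M s - 1) / \<tau>)"
    using tau by (intro smooth_on_divide smooth_on_diff smooth smooth_on_const o) auto
  hence "smooth_on (-{0}) (\<lambda>s. 1 + \<tau> / (1 + \<tau>)\<^sup>2 * ramp ((M s - 1) / \<tau>))"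
    unfolding ramp_def by (intro smooth_on_add smooth_on_mult smooth_on_flat smooth_on_const o)
  hence 1: "smooth_on (-{0}) (squeeze M \<tau>)"
    unfolding squeeze_def[abs_def] using squeeze_denominator
    by (intro smooth_on_divide smooth_on_const o) (simp_all add: dual_order.strict_implies_not_eq less_le_trans[OF zero_less_one])
  have oM: "open {s. M s < 1}" using cont by (intro open_Collect_less continuous_on_const)
  have 2: "smooth_on {s. M s < 1} (squeeze M \<tau>)"
    by (rule smooth_on_cong[OF oM _ smooth_on_const[of _ 1]]) (simp add: squeeze_eq_1)
  have "smooth_on (-{0} \<union> {s. M s < 1}) (squeeze M \<tau>)"
    using 1 2 o oM by (rule smooth_on_Un)
  moreover have "-{0} \<union> {s. M s < 1} = UNIV" using M0 by auto
  ultimately show ?thesis by simp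
qed

lemma squeeze_into: "M (squeeze M \<tau> s *\<^sub>R s) \<le> (1 + \<tau>)\<^sup>2"
proof -
  let ?x = "(M s - 1) / \<tau>" and ?d = "1 + \<tau> / (1 + \<tau>)\<^sup>2 * ramp ((M s - 1) / \<tau>)"
  have d: "?d > 0" using squeeze_denominator[of ?x] by linarith
  have "\<tau> * (?x - 1) \<le> \<tau> * ramp ?x" using tau ramp_ge by (intro mult_left_mono) auto
  moreover have "\<tau> * (?x - 1) = M s - 1 - \<tau>" using tau by (simp add: field_simps)
  ultimately have "M s - 1 - \<tau> \<le> \<tau> * ramp ?x" by linarith
  moreover have "1 + \<tau> \<le> (1 + \<tau>)\<^sup>2" using tau by (simp add: power2_eq_square)
  ultimately have "M s \<le> (1 + \<tau>)\<^sup>2 + \<tau> * ramp ?x" by linarith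
  also have "\<dots> = (1 + \<tau>)\<^sup>2 * ?d" using tau by (simp add: field_simps)
  finally have "M s \<le> (1 + \<tau>)\<^sup>2 * ?d" .
  moreover have "M (squeeze M \<tau> s *\<^sub>R s) = M s / ?d"
    using scale[OF squeeze_pos, of s s] by (simp add: squeeze_def)
  ultimately show ?thesis using d by (simp add: divide_le_eq)
qed

text \<open>The derivative of \<open>r \<mapsto> r * squeeze M \<tau> (r *\<^sub>R s)\<close> at \<open>r = 1\<close>.\<close>

lemma squeeze_radial: "0 < squeeze M \<tau> s + dderiv s (squeeze M \<tau>) s"
proof (cases "s = 0")
  case True thus ?thesis using squeeze_pos[of s] by (simp add: dderiv_def)
next
  case False
  let ?c = "\<tau> / (1 + \<tau>)\<^sup>2"
  let ?x = "(M s - 1) / \<tau>" and ?d = "1 + ?c * ramp ((M s - 1) / \<tau>)"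
  have d: "?d > 0" using squeeze_denominator[of ?x] by linarith
  obtain w where w: "(ramp has_real_derivative w) (at ?x)" "w \<le> 1" "?x * w - ramp ?x \<le> 1"
    using ramp_has_derivative by blast
  have "((\<lambda>m. 1 / (1 + ?c * ramp ((m - 1) / \<tau>))) has_real_derivative - (?c * (w / \<tau>)) / ?d\<^sup>2) (at (M s))"
  proof -
    have "((\<lambda>m. (m - 1) / \<tau>) has_real_derivative 1 / \<tau>) (at (M s))"
      using tau by (auto intro!: derivative_eq_intros)
    from DERIV_add[OF DERIV_const[of 1] DERIV_cmult[OF DERIV_chain2[OF w(1) this], of ?c]]
    have "((\<lambda>m. 1 + ?c * ramp ((m - 1) / \<tau>)) has_real_derivative ?c * (w / \<tau>)) (at (M s))"
      by (simp only: add_0_left mult_1_right times_divide_eq_right)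
    from DERIV_inverse_fun[OF this] d show ?thesis
      by (simp add: inverse_eq_divide power2_eq_square)
  qed
  from dderiv_compose_real[of _ _ M s s, OF this smooth_onD_diff[OF smooth]] False
  have D: "dderiv s (squeeze M \<tau>) s = - (?c * (w / \<tau>)) / ?d\<^sup>2 * M s"
    using euler_homogeneous[OF smooth, of 1 s] scale by (simp add: squeeze_def[abs_def])
  have Ms: "M s = 1 + \<tau> * ?x" using tau by simp
  have "squeeze M \<tau> s + dderiv s (squeeze M \<tau>) s = (?d - ?c * (w / \<tau>) * M s) / ?d\<^sup>2"
  proof -
    have "1 / e + - q / e\<^sup>2 * m = (e - q * m) / e\<^sup>2" if "e > 0" for e q m :: real
      using that by (simp add: field_simps power2_eq_square)
    from this[OF d] show ?thesis unfolding D squeeze_def .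
  qed
  also have "?d - ?c * (w / \<tau>) * M s = 1 - ?c / \<tau> * w - ?c * (?x * w - ramp ?x)"
    using tau by (subst Ms) (simp add: algebra_simps)
  also have "0 < \<dots> / ?d\<^sup>2"
  proof -
    have "?c / \<tau> * w + ?c * (?x * w - ramp ?x) \<le> ?c / \<tau> * 1 + ?c * 1"
      using tau w by (intro add_mono mult_left_mono) auto
    also have "\<dots> = (1 + \<tau>) / (1 + \<tau>)\<^sup>2" using tau by (simp add: add_divide_distrib)
    also have "\<dots> < 1" using tau by (simp add: power2_eq_square)
    finally show ?thesis using d by simp
  qed
  finally show ?thesis .
qed

end

lemma linear_eq_inner:
  fixes f :: "real^'p::finite \<Rightarrow> real"
  assumes "linear f"
  shows "f x = (\<chi> i. f (axis i 1)) \<bullet> x"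
  by (rule linear_eq_on_axes[OF assms]) (auto simp: linear_iff inner_add_right inner_axis)

lemma smooth_on_real_polynomial:
  fixes f :: "real^'p::finite \<Rightarrow> real"
  assumes "real_polynomial_function f"
  shows "smooth_on UNIV f"
  using assms
proof induction
  case (linear f)
  have "f = (\<lambda>x. (\<chi> i. f (axis i 1)) \<bullet> x)"
    using linear_eq_inner[OF bounded_linear.linear[OF linear]] by blast
  thus ?case by (metis smooth_on_inner)
qed (auto intro: smooth_on_add smooth_on_mult)

lemma smooth_on_norm: "smooth_on (-{0}) (norm :: real^'p::finite \<Rightarrow> real)"
proof (rule smooth_on_cong)
  show "smooth_on (-{0}) (\<lambda>x::real^'p. sqrt (\<Sum>i\<in>UNIV. x $ i * x $ i))"
  proof (intro smooth_on_sqrt smooth_on_sum smooth_on_mult smooth_on_component)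
    fix x :: "real^'p" assume "x \<in> -{0}"
    hence "0 < x \<bullet> x" by simp
    thus "0 < (\<Sum>i\<in>UNIV. x $ i * x $ i)" by (simp add: inner_vec_def)
  qed (auto simp: open_Compl)
  show "sqrt (\<Sum>i\<in>UNIV. x $ i * x $ i) = norm x" for x :: "real^'p"
    by (simp add: norm_eq_sqrt_inner inner_vec_def)
qed (auto simp: open_Compl)

text \<open>On the unit sphere \<open>N\<close> is approximated by a polynomial, which is then extended
  homogeneously.\<close>

lemma smooth_gauge_approximation:
  fixes N :: "real^'p::finite \<Rightarrow> real"
  assumes cont: "continuous_on UNIV N" and hom: "\<And>c z. 0 < c \<Longrightarrow> N (c *\<^sub>R z) = c * N z"
    and pos: "\<And>z. z \<noteq> 0 \<Longrightarrow> 0 < N z" and eta: "0 < \<eta>" and tau: "0 < \<tau>"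
  obtains M where "smooth_gauge M \<tau>" "\<And>z. M z \<le> N z" "\<And>z. N z \<le> (1 + \<eta>) * M z"
proof -
  let ?S = "sphere (0::real^'p) 1"
  have o: "open (-{0::real^'p})" by (simp add: open_Compl)
  have cS: "continuous_on ?S N" by (rule continuous_on_subset[OF cont]) simp
  obtain a where a: "a \<in> ?S" "\<And>z. z \<in> ?S \<Longrightarrow> N a \<le> N z"
    using continuous_attains_inf[OF compact_sphere _ cS] by auto
  \<comment> \<open>The polynomial approximates \<open>N / (1 + \<eta>/2)\<close>; the error \<open>e\<close> leaves room on both sides.\<close>
  define e where "e = N a * (\<eta> / (2 + \<eta>)) / (1 + \<eta>)"
  have Na: "N a > 0" using a(1) by (intro pos) auto
  hence e: "e > 0" using eta by (simp add: e_def)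
  have "continuous_on ?S (\<lambda>z. N z * (2 / (2 + \<eta>)))" by (intro continuous_intros cS)
  from Stone_Weierstrass_real_polynomial_function[OF compact_sphere this e]
  obtain P where P: "real_polynomial_function P" "\<And>z. z \<in> ?S \<Longrightarrow> \<bar>N z * (2 / (2 + \<eta>)) - P z\<bar> < e" by blast
  have near: "P z \<le> N z" "N z \<le> (1 + \<eta>) * P z" if z: "z \<in> ?S" for z
  proof -
    have e1: "(1 + \<eta>) * e \<le> N z * (\<eta> / (2 + \<eta>))"
      using mult_right_mono[OF a(2)[OF z], of "\<eta> / (2 + \<eta>)"] eta by (simp add: e_def)
    have "e \<le> (1 + \<eta>) * e" using e eta by (simp add: algebra_simps)
    hence e2: "e \<le> N z * (\<eta> / (2 + \<eta>))" using e1 by linarith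
    have split: "N z * (2 / (2 + \<eta>)) + N z * (\<eta> / (2 + \<eta>)) = N z"
      using eta by (simp flip: distrib_left add_divide_distrib)
    show "P z \<le> N z" using P(2)[OF z] e2 split by linarith
    have "(1 + \<eta>) * (N z * (2 / (2 + \<eta>)) - e) \<le> (1 + \<eta>) * P z"
      using P(2)[OF z] eta by (intro mult_left_mono) auto
    moreover have "(1 + \<eta>) * (N z * (2 / (2 + \<eta>))) = N z + N z * (\<eta> / (2 + \<eta>))"
      using eta by (simp add: field_simps)
    ultimately show "N z \<le> (1 + \<eta>) * P z" using e1 by (simp add: right_diff_distrib)
  qed
  define M where "M z = norm z * P (\<chi> i. z $ i / norm z)" for z
  have dir: "(\<chi> i. z $ i / norm z) = z /\<^sub>R norm z" for z :: "real^'p"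
    by (simp add: vec_eq_iff divide_inverse mult.commute)
  have N0: "N 0 = 0" using hom[of 2 0] by simp
  have bounds: "M z \<le> N z" "N z \<le> (1 + \<eta>) * M z" for z
  proof -
    have "M z \<le> N z \<and> N z \<le> (1 + \<eta>) * M z"
    proof (cases "z = 0")
      case False
      hence s: "z /\<^sub>R norm z \<in> ?S" by simp
      have Nz: "N z = norm z * N (z /\<^sub>R norm z)"
        using hom[of "norm z" "z /\<^sub>R norm z"] False by simp
      have "norm z * P (z /\<^sub>R norm z) \<le> norm z * N (z /\<^sub>R norm z)"
        "norm z * N (z /\<^sub>R norm z) \<le> norm z * ((1 + \<eta>) * P (z /\<^sub>R norm z))"
        by (intro mult_left_mono near[OF s] norm_ge_zero)+
      thus ?thesis unfolding M_def dir Nz by (simp add: mult_ac)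
    qed (simp add: M_def N0)
    thus "M z \<le> N z" "N z \<le> (1 + \<eta>) * M z" by auto
  qed
  have smooth: "smooth_on (-{0}) M"
    unfolding M_def
    by (intro smooth_on_mult smooth_on_norm o smooth_on_compose[OF smooth_on_real_polynomial[OF P(1)]]
          smooth_on_divide smooth_on_component) auto
  have "isCont M z" for z
  proof (cases "z = 0")
    case False
    thus ?thesis using smooth_onD_cont[OF smooth] by (simp add: continuous_on_eq_continuous_at o)
  next
    case True
    have "0 \<le> M z" for z
    proof -
      have "0 \<le> N z" using pos[of z] N0 by (cases "z = 0") auto
      hence "0 \<le> (1 + \<eta>) * M z" using bounds(2)[of z] by linarith
      thus ?thesis using eta by (simp add: zero_le_mult_iff)
    qed
    moreover have "(N \<longlongrightarrow> 0) (at 0)" using cont N0 by (metis continuous_on_def UNIV_I)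
    ultimately have "(M \<longlongrightarrow> 0) (at 0)"
      by (intro tendsto_sandwich[of "\<lambda>_. 0" M "at 0" N]) (use bounds in auto)
    thus ?thesis using True by (simp add: isCont_def M_def)
  qed
  hence "continuous_on UNIV M" by (simp add: continuous_at_imp_continuous_on)
  moreover have "M 0 = 0" "\<And>c s. 0 < c \<Longrightarrow> M (c *\<^sub>R s) = c * M s" by (simp_all add: M_def)
  ultimately have "smooth_gauge M \<tau>" using tau smooth by unfold_locales auto
  thus ?thesis using that bounds by blast
qed

text \<open>Along its ray, \<open>s \<mapsto> \<kappa> s *\<^sub>R s\<close> moves with velocity \<open>\<kappa> s + dderiv s \<kappa> s\<close>. The signs of such
  expressions express monotonicity along rays, and by this lemma they are multiplicative under
  composition of radial maps.\<close>

lemma radial_compose: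
  fixes \<kappa> k :: "real^'p::finite \<Rightarrow> real"
  assumes d\<kappa>: "\<kappa> differentiable (at s)" and dk: "k differentiable (at (\<kappa> s *\<^sub>R s))"
  shows "(\<lambda>s. k (\<kappa> s *\<^sub>R s)) differentiable (at s)"
    and "dderiv s (\<lambda>s. k (\<kappa> s *\<^sub>R s)) s = (\<kappa> s + dderiv s \<kappa> s) * dderiv s k (\<kappa> s *\<^sub>R s)"
proof -
  have "((\<lambda>s. \<kappa> s *\<^sub>R s) has_derivative (\<lambda>h. \<kappa> s *\<^sub>R h + dderiv h \<kappa> s *\<^sub>R s)) (at s)"
    by (rule has_derivative_scaleR[OF has_derivative_dderiv[OF d\<kappa>] has_derivative_ident])
  from has_derivative_compose[OF this, where g=k and g'="\<lambda>h. dderiv h k (\<kappa> s *\<^sub>R s)"]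
  have D: "((\<lambda>s. k (\<kappa> s *\<^sub>R s)) has_derivative
      (\<lambda>h. dderiv (\<kappa> s *\<^sub>R h + dderiv h \<kappa> s *\<^sub>R s) k (\<kappa> s *\<^sub>R s))) (at s)"
    using has_derivative_dderiv[OF dk] by blast
  show "(\<lambda>s. k (\<kappa> s *\<^sub>R s)) differentiable (at s)" using D by (rule differentiableI)
  show "dderiv s (\<lambda>s. k (\<kappa> s *\<^sub>R s)) s = (\<kappa> s + dderiv s \<kappa> s) * dderiv s k (\<kappa> s *\<^sub>R s)"
    using dderiv_eqI[OF D, of s] by (simp add: dderiv_scale_left flip: scaleR_left_distrib)
qed

section \<open>Inverting a radial rescaling\<close>

text \<open>The assumption \<open>radial\<close> says that the map \<open>s \<mapsto> s / f s\<close> is increasing along rays; since \<open>W\<close>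
  is star-shaped, the map is then injective on \<open>W\<close>. Invariance of domain makes its image open.\<close>

locale radial_chart =
  fixes f :: "real^'p::finite \<Rightarrow> real" and W :: "(real^'p) set"
  assumes open_W: "open W" and smooth: "smooth_on W f" and pos: "s \<in> W \<Longrightarrow> 0 < f s"
    and star: "s \<in> W \<Longrightarrow> 0 \<le> r \<Longrightarrow> r \<le> 1 \<Longrightarrow> r *\<^sub>R s \<in> W"
    and radial: "s \<in> W \<Longrightarrow> dderiv s f s < f s"
begin

definition \<psi> :: "real^'p \<Rightarrow> real^'p" where "\<psi> s = (1 / f s) *\<^sub>R s"

definition \<theta> :: "real^'p \<Rightarrow> real^'p" where "\<theta> = inv_into W \<psi>"

definition \<rho> :: "real^'p \<Rightarrow> real" where "\<rho> z = f (\<theta> z)"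

lemma radial_increasing:
  assumes s: "s \<in> W" and r: "0 \<le> r" "r < 1"
  shows "r / f (r *\<^sub>R s) < 1 / f s"
proof -
  have "\<exists>D. ((\<lambda>r. r / f (r *\<^sub>R s)) has_real_derivative D) (at t) \<and> 0 < D" if t: "0 \<le> t" "t \<le> 1" for t
  proof -
    have W: "t *\<^sub>R s \<in> W" by (rule star[OF s t])
    have "((\<lambda>t. f (0 + t *\<^sub>R s)) has_real_derivative dderiv s f (0 + t *\<^sub>R s)) (at t)"
      by (rule dderiv_along_line) (use smooth_onD_diff[OF smooth W] in simp)
    hence "((\<lambda>t. t / f (t *\<^sub>R s)) has_real_derivative
       (1 * f (t *\<^sub>R s) - t * dderiv s f (t *\<^sub>R s)) / (f (t *\<^sub>R s) * f (t *\<^sub>R s))) (at t)"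
      using pos[OF W] by (intro DERIV_divide DERIV_ident) auto
    moreover have "0 < (1 * f (t *\<^sub>R s) - t * dderiv s f (t *\<^sub>R s)) / (f (t *\<^sub>R s) * f (t *\<^sub>R s))"
      using radial[OF W] pos[OF W] by (simp add: dderiv_scale_left)
    ultimately show ?thesis by blast
  qed
  hence "r / f (r *\<^sub>R s) < 1 / f (1 *\<^sub>R s)"
    using r by (intro DERIV_pos_imp_increasing[of r 1 "\<lambda>r. r / f (r *\<^sub>R s)"]) auto
  thus ?thesis by simp
qed

lemma inj_rescale: "inj_on \<psi> W"
proof (rule inj_onI)
  \<comment> \<open>Points with the same image lie on a common ray, and along a ray the map is increasing.\<close>
  have *: False if "s \<in> W" "0 \<le> r" "r < 1" "\<psi> (r *\<^sub>R s) = \<psi> s" "s \<noteq> 0" for r s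
  proof -
    have "(r / f (r *\<^sub>R s)) *\<^sub>R s = (1 / f s) *\<^sub>R s" using that(4) by (simp add: \<psi>_def)
    hence "r / f (r *\<^sub>R s) = 1 / f s" using that(5) by (simp only: scaleR_cancel_right) simp
    thus False using radial_increasing[OF that(1-3)] by simp
  qed
  fix s t assume st: "s \<in> W" "t \<in> W" "\<psi> s = \<psi> t"
  have p: "f s > 0" "f t > 0" using st pos by auto
  define r where "r = f s / f t"
  have r: "r > 0" using p by (simp add: r_def)
  have s: "s = r *\<^sub>R t"
  proof -
    have "s = f s *\<^sub>R \<psi> s" using p by (simp add: \<psi>_def)
    also have "\<dots> = r *\<^sub>R t" by (simp add: st(3)) (simp add: \<psi>_def r_def)
    finally show ?thesis .
  qed
  show "s = t"
  proof (cases "t = 0 \<or> r = 1")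
    case True thus ?thesis using s by auto
  next
    case False
    hence t0: "t \<noteq> 0" "s \<noteq> 0" using s r by auto
    have t: "t = (1 / r) *\<^sub>R s" using s r by simp
    consider "r < 1" | "1 / r < 1" using False r by (cases "r < 1") (auto simp: field_simps)
    thus ?thesis
    proof cases
      case 1 thus ?thesis using *[OF st(2) _ 1] r st(3) s t0 by auto
    next
      case 2 thus ?thesis using *[OF st(1) _ 2] r st(3) t t0 by auto
    qed
  qed
qed

lemma f_cont: "continuous_on W f" by (rule smooth_onD_cont[OF smooth])

lemma rescale_cont: "continuous_on W \<psi>"
  unfolding \<psi>_def[abs_def] by (intro continuous_intros f_cont) (use pos in force)

lemma open_image: "open (\<psi> ` W)"
  by (rule invariance_of_domain[OF rescale_cont open_W inj_rescale])

lemma unrescale_rescale: "s \<in> W \<Longrightarrow> \<theta> (\<psi> s) = s"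
  unfolding \<theta>_def by (rule inv_into_f_f[OF inj_rescale])

lemma unrescale_in: "z \<in> \<psi> ` W \<Longrightarrow> \<theta> z \<in> W" and rescale_unrescale: "z \<in> \<psi> ` W \<Longrightarrow> \<psi> (\<theta> z) = z"
  unfolding \<theta>_def by (auto intro: inv_into_into f_inv_into_f)

lemma inverse_factor_pos: "z \<in> \<psi> ` W \<Longrightarrow> 0 < \<rho> z"
  unfolding \<rho>_def by (intro pos unrescale_in)

lemma unrescale_eq: assumes "z \<in> \<psi> ` W" shows "\<theta> z = \<rho> z *\<^sub>R z"
proof -
  have "\<rho> z *\<^sub>R \<psi> (\<theta> z) = \<theta> z" using inverse_factor_pos[OF assms] by (simp add: \<psi>_def \<rho>_def)
  thus ?thesis by (simp add: rescale_unrescale[OF assms])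
qed

text \<open>The derivative of \<open>\<psi>\<close> is a multiple of the identity plus a map of rank one, so its inverse
  \<open>Q\<close> is explicit.\<close>

lemma inverse_factor_has_derivative:
  assumes z: "z \<in> \<psi> ` W"
  defines "s \<equiv> \<theta> z"
  shows "(\<rho> has_derivative (\<lambda>h. (f s)\<^sup>2 * dderiv h f s / (f s - dderiv s f s))) (at z)"
proof -
  have s: "s \<in> W" and zs: "\<psi> s = z" using z unrescale_in rescale_unrescale by (auto simp: s_def)
  have fs: "f s > 0" by (rule pos[OF s])
  define A where "A = f s - dderiv s f s"
  have A: "A > 0" using radial[OF s] by (simp add: A_def)
  have Df: "(f has_derivative (\<lambda>h. dderiv h f s)) (at s)"
    by (rule has_derivative_dderiv[OF smooth_onD_diff[OF smooth s]])
  define P where "P h = (1 / f s) *\<^sub>R h - (dderiv h f s / (f s)\<^sup>2) *\<^sub>R s" for h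
  define Q where "Q h = f s *\<^sub>R h + (f s * dderiv h f s / A) *\<^sub>R s" for h
  have DP: "(\<psi> has_derivative P) (at s)"
  proof -
    have "((\<lambda>s. inverse (f s)) has_derivative (\<lambda>h. - (inverse (f s) * dderiv h f s * inverse (f s)))) (at s)"
      by (rule Deriv.has_derivative_inverse[OF _ Df]) (use fs in simp)
    from has_derivative_scaleR[OF this has_derivative_ident]
    have "(\<psi> has_derivative (\<lambda>h. inverse (f s) *\<^sub>R h + (- (inverse (f s) * dderiv h f s * inverse (f s))) *\<^sub>R s)) (at s)"
      by (simp add: \<psi>_def[abs_def] inverse_eq_divide)
    thus ?thesis by (simp add: P_def[abs_def] inverse_eq_divide power2_eq_square)
  qed
  have dQ: "dderiv (Q h) f s = (f s)\<^sup>2 * dderiv h f s / A" for h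
  proof -
    have "dderiv (Q h) f s = f s * dderiv h f s + (f s * dderiv h f s / A) * dderiv s f s"
      by (simp add: Q_def dderiv_add_left dderiv_scale_left)
    also have "dderiv s f s = f s - A" by (simp add: A_def)
    finally show ?thesis using A by (simp add: field_simps power2_eq_square)
  qed
  have "P \<circ> Q = id"
  proof
    fix h
    have "P (Q h) = (1 / f s) *\<^sub>R Q h - (dderiv h f s / A) *\<^sub>R s"
      using fs by (simp add: P_def dQ)
    also have "\<dots> = h" using fs by (simp add: Q_def scaleR_right_distrib)
    finally show "(P \<circ> Q) h = id h" by simp
  qed
  from has_derivative_inverse_strong[OF open_W s rescale_cont unrescale_rescale DP this]
  have "(\<theta> has_derivative Q) (at z)" by (simp add: zs)
  moreover have "(f has_derivative (\<lambda>h. dderiv h f s)) (at (\<theta> z))" using Df by (simp add: s_def)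
  ultimately have "((\<lambda>z. f (\<theta> z)) has_derivative (\<lambda>h. dderiv (Q h) f s)) (at z)"
    by (rule has_derivative_compose)
  thus ?thesis by (simp add: dQ A_def \<rho>_def[abs_def])
qed

text \<open>The partial derivatives of \<open>\<rho>\<close> are smooth expressions in \<open>\<rho>\<close>, so each order of
  differentiability implies the next.\<close>

lemma inverse_factor_smooth: "smooth_on (\<psi> ` W) \<rho>"
proof -
  have "Ck_on m (\<psi> ` W) \<rho>" for m
  proof (induction m)
    case 0
    have "continuous (at z) \<rho>" if "z \<in> \<psi> ` W" for z
      using inverse_factor_has_derivative[OF that] by (rule has_derivative_continuous)
    thus ?case by (simp add: continuous_at_imp_continuous_on)
  next
    case (Suc m)
    have "Ck_on m (\<psi> ` W) (partial_deriv i \<rho>)" for i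
    proof (rule Ck_on_cong[OF open_image])
      let ?g = "\<lambda>s. (f s)\<^sup>2 * partial_deriv i f s / (f s - (\<Sum>j\<in>UNIV. s $ j * partial_deriv j f s))"
      have "smooth_on W ?g"
        by (intro smooth_on_divide smooth_on_mult smooth_on_power smooth_on_diff smooth_on_sum smooth smooth_on_partial
              smooth_on_component open_W) (use radial in \<open>force simp: dderiv_def\<close>)
      hence "Ck_on m W ?g" by (simp add: smooth_on_def)
      moreover have "Ck_on m (\<psi> ` W) (\<lambda>z. \<rho> z * z $ j)" for j
        using smooth_on_component by (intro Ck_on_mult Suc open_image) (auto simp: smooth_on_def)
      moreover have vec: "(\<chi> j. \<rho> z * z $ j) = \<theta> z" if "z \<in> \<psi> ` W" for z
        using unrescale_eq[OF that] by (simp add: vec_eq_iff)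
      ultimately show "Ck_on m (\<psi> ` W) (\<lambda>z. ?g (\<chi> j. \<rho> z * z $ j))"
        using open_image unrescale_in by (intro Ck_on_compose[where T=W]) auto
      show "?g (\<chi> j. \<rho> z * z $ j) = partial_deriv i \<rho> z" if "z \<in> \<psi> ` W" for z
        unfolding vec[OF that] partial_deriv_eqI[OF inverse_factor_has_derivative[OF that]] dderiv_axis
        by (simp add: dderiv_def)
    qed
    thus ?case using differentiableI[OF inverse_factor_has_derivative] by auto
  qed
  thus ?thesis by (simp add: smooth_on_def)
qed

lemma inverse_factor_radial:
  assumes z: "z \<in> \<psi> ` W"
  shows "0 < \<rho> z + dderiv z \<rho> z"
proof -
  define s where "s = \<theta> z"
  have s: "s \<in> W" and zs: "\<psi> s = z" using z unrescale_in rescale_unrescale by (auto simp: s_def)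
  have fs: "f s > 0" and A: "f s - dderiv s f s > 0" using pos[OF s] radial[OF s] by auto
  have "dderiv z f s = dderiv s f s / f s" unfolding zs[symmetric] \<psi>_def by (simp add: dderiv_scale_left)
  hence "dderiv z \<rho> z = f s * dderiv s f s / (f s - dderiv s f s)"
    unfolding dderiv_eqI[OF inverse_factor_has_derivative[OF z], folded s_def] using fs by (simp add: power2_eq_square)
  hence "\<rho> z + dderiv z \<rho> z = f s + f s * dderiv s f s / (f s - dderiv s f s)" by (simp add: \<rho>_def s_def)
  also have "\<dots> = (f s)\<^sup>2 / (f s - dderiv s f s)" using A by (simp add: field_simps power2_eq_square)
  also have "\<dots> > 0" using fs A by simp
  finally show ?thesis .
qed

text \<open>The inverse of \<open>\<psi>\<close> is defined near the image of \<open>K\<close> only. Composing it with a squeeze that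
  fixes this image and maps everything into that neighbourhood extends it to the whole space. The
  composition is again a radial map that is increasing along rays. The image of \<open>K\<close> is the unit ball of a
  continuous gauge, which is what a smooth gauge for the squeeze is fitted to.\<close>

theorem radial_extension:
  assumes K: "compact K" "K \<subseteq> W" and N: "continuous_on UNIV N" "\<And>c z. 0 < c \<Longrightarrow> N (c *\<^sub>R z) = c * N z"
    "\<And>z. z \<noteq> 0 \<Longrightarrow> 0 < N z" and image: "\<psi> ` K = {z. N z \<le> 1}"
  obtains h where "smooth_on UNIV h" "\<And>s. 0 < h s" "\<And>s. 0 < h s + dderiv s h s" "\<And>s. h s *\<^sub>R s \<in> W"
    "\<And>s. s \<in> K \<Longrightarrow> h (\<psi> s) = f s"
proof -
  have cK: "compact (\<psi> ` K)"
    by (rule compact_continuous_image[OF continuous_on_subset[OF rescale_cont K(2)] K(1)])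
  have sub: "\<psi> ` K \<subseteq> \<psi> ` W" using K(2) by blast
  obtain e where e: "e > 0" "(\<Union>x\<in>\<psi> ` K. ball x e) \<subseteq> \<psi> ` W"
    using compact_subset_open_imp_ball_epsilon_subset[OF cK open_image sub] by blast
  obtain R where R: "R > 0" "\<And>z. z \<in> \<psi> ` K \<Longrightarrow> norm z \<le> R"
    using compact_imp_bounded[OF cK] by (auto simp: bounded_pos)
  define \<epsilon> where "\<epsilon> = e / (2 * R)"
  have eps: "\<epsilon> > 0" "\<epsilon> * R < e" using e(1) R(1) by (auto simp: \<epsilon>_def)
  have near: "z \<in> \<psi> ` W" if "N z \<le> 1 + \<epsilon>" for z
  proof -
    define z' where "z' = (1 / (1 + \<epsilon>)) *\<^sub>R z"
    have "N z' = N z / (1 + \<epsilon>)" using N(2)[of "1 / (1 + \<epsilon>)" z] eps(1) by (simp add: z'_def)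
    hence z': "z' \<in> \<psi> ` K" using that eps(1) by (simp add: image)
    have "z = (1 + \<epsilon>) *\<^sub>R z'" using eps(1) by (simp add: z'_def)
    hence "dist z' z = \<epsilon> * norm z'" using eps(1) by (simp add: dist_norm algebra_simps)
    also have "\<dots> \<le> \<epsilon> * R" using R(2)[OF z'] eps(1) by (intro mult_left_mono) auto
    finally have "z \<in> ball z' e" using eps(2) by simp
    thus ?thesis using e(2) z' by blast
  qed
  \<comment> \<open>The constant \<open>7\<close> comes from \<open>(1 + t)\<^sup>3 \<le> 1 + 7 t\<close> for \<open>t \<le> 1\<close>.\<close>
  define t where "t = min 1 (\<epsilon> / 7)"
  have t: "0 < t" "t \<le> 1" "7 * t \<le> \<epsilon>" using eps(1) by (auto simp: t_def)
  have cube: "(1 + t) * (1 + t)\<^sup>2 \<le> 1 + \<epsilon>"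
  proof -
    have "t * t \<le> t" "t * t * t \<le> t * t" using t mult_left_le_one_le[of t t] mult_left_le_one_le[of "t * t" t] by (auto simp: mult_ac)
    moreover have "(1 + t) * (1 + t)\<^sup>2 = 1 + 3 * t + 3 * (t * t) + t * t * t" by (simp add: power2_eq_square algebra_simps)
    ultimately show ?thesis using t(3) by linarith
  qed
  obtain M where M: "smooth_gauge M t" "\<And>z. M z \<le> N z" "\<And>z. N z \<le> (1 + t) * M z"
    using smooth_gauge_approximation[OF N t(1) t(1)] by blast
  interpret smooth_gauge M t by (rule M(1))
  define \<kappa> where "\<kappa> = squeeze M t"
  have in_W: "\<kappa> s *\<^sub>R s \<in> \<psi> ` W" for s
  proof (rule near)
    have "N (\<kappa> s *\<^sub>R s) \<le> (1 + t) * M (\<kappa> s *\<^sub>R s)" by (rule M(3))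
    also have "\<dots> \<le> (1 + t) * (1 + t)\<^sup>2" unfolding \<kappa>_def using t(1) squeeze_into[of s] by (intro mult_left_mono) auto
    finally show "N (\<kappa> s *\<^sub>R s) \<le> 1 + \<epsilon>" using cube by linarith
  qed
  have vec: "(\<chi> j. \<kappa> s * s $ j) = \<kappa> s *\<^sub>R s" for s by (simp add: vec_eq_iff)
  define h where "h s = \<kappa> s * \<rho> (\<chi> j. \<kappa> s * s $ j)" for s
  have \<kappa>s: "smooth_on UNIV \<kappa>" unfolding \<kappa>_def by (rule squeeze_smooth)
  have \<kappa>c: "smooth_on UNIV (\<lambda>s. \<kappa> s * s $ j)" for j by (intro smooth_on_mult \<kappa>s smooth_on_component) simp
  have hs: "smooth_on UNIV h"
    unfolding h_def[abs_def]
    by (intro smooth_on_mult[OF \<kappa>s smooth_on_compose[OF inverse_factor_smooth \<kappa>c]]) (simp_all add: vec in_W)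
  moreover have h_pos: "0 < h s" for s
    unfolding h_def vec using inverse_factor_pos[OF in_W] squeeze_pos[of s] by (simp add: \<kappa>_def)
  moreover have "0 < h s + dderiv s h s" for s
  proof -
    define z where "z = \<kappa> s *\<^sub>R s"
    let ?\<kappa>' = "dderiv s \<kappa> s"
    have d\<kappa>: "\<kappa> differentiable (at s)" by (rule smooth_onD_diff[OF \<kappa>s]) simp
    have d\<rho>: "\<rho> differentiable (at (\<kappa> s *\<^sub>R s))"
      by (rule differentiableI[OF inverse_factor_has_derivative[OF in_W]])
    note D = radial_compose[OF d\<kappa> d\<rho>]
    have "dderiv s h s = \<kappa> s * ((\<kappa> s + ?\<kappa>') * dderiv s \<rho> z) + ?\<kappa>' * \<rho> z"
      unfolding h_def[abs_def] vec using dderiv_mult[OF d\<kappa> D(1)] by (simp add: D(2) z_def)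
    hence "h s + dderiv s h s = (\<kappa> s + ?\<kappa>') * (\<rho> z + dderiv z \<rho> z)"
      by (simp add: h_def vec z_def dderiv_scale_left algebra_simps)
    thus ?thesis using inverse_factor_radial[OF in_W] squeeze_radial[of s] by (simp add: z_def \<kappa>_def)
  qed
  moreover have "h s *\<^sub>R s \<in> W" for s
    using unrescale_in[OF in_W[of s]] by (simp add: unrescale_eq[OF in_W] h_def vec mult.commute)
  moreover have "h (\<psi> s) = f s" if s: "s \<in> K" for s
  proof -
    have "N (\<psi> s) \<le> 1" using image s by blast
    hence "\<kappa> (\<psi> s) = 1" using M(2)[of "\<psi> s"] unfolding \<kappa>_def by (intro squeeze_eq_1) linarith
    thus ?thesis using s K(2) unrescale_rescale[of s] by (auto simp: h_def vec \<rho>_def)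
  qed
  ultimately show ?thesis using that by blast
qed

end

section \<open>Fibres of independent one-forms\<close>

definition forms :: "('p::finite \<Rightarrow> ((real^'n::finite) \<Rightarrow>\<^sub>L real)) \<Rightarrow> real^'n \<Rightarrow> real^'p" where
  "forms b y = (\<chi> i. blinfun_apply (b i) y)"

lemma linear_forms: "linear (forms b)"
  by (intro linearI) (simp_all add: forms_def vec_eq_iff blinfun.add_right blinfun.scaleR_right)

lemma forms_nth [simp]: "forms b y $ i = blinfun_apply (b i) y"
  by (simp add: forms_def)

text \<open>A vector orthogonal to the range would be a linear relation between the forms.\<close>

lemma surj_forms:
  fixes b :: "'p::finite \<Rightarrow> ((real^'n::finite) \<Rightarrow>\<^sub>L real)"
  assumes inj: "inj b" and ind: "independent (range b)"
  shows "surj (forms b)"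
proof (rule ccontr)
  assume ns: "\<not> surj (forms b)"
  have sp: "span (range (forms b)) = range (forms b)"
    using linear_subspace_image[OF linear_forms subspace_UNIV] by (simp only: span_eq_iff)
  have "span (range (forms b)) \<subset> span UNIV" unfolding sp using ns by auto
  then obtain a where a: "a \<noteq> 0" "\<And>z. z \<in> span (range (forms b)) \<Longrightarrow> orthogonal a z"
    by (rule orthogonal_to_subspace_exists_gen) blast
  have "(\<Sum>i\<in>UNIV. a $ i *\<^sub>R b i) = 0"
  proof (rule blinfun_eqI)
    fix y
    have "a \<bullet> forms b y = 0" using a(2)[of "forms b y"] by (simp add: orthogonal_def span_base)
    thus "blinfun_apply (\<Sum>i\<in>UNIV. a $ i *\<^sub>R b i) y = blinfun_apply 0 y"
      by (simp add: inner_vec_def blinfun.sum_left blinfun.scaleR_left)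
  qed
  moreover have "(\<Sum>i\<in>UNIV. a $ i *\<^sub>R b i) = (\<Sum>\<beta>\<in>range b. a $ (inv b \<beta>) *\<^sub>R \<beta>)"
    by (subst sum.reindex[OF inj]) (simp add: inv_f_f[OF inj])
  ultimately have "(\<Sum>\<beta>\<in>range b. a $ (inv b \<beta>) *\<^sub>R \<beta>) = 0" by simp
  hence "a $ (inv b (b i)) = 0" for i
    by (intro independentD[OF ind, of "range b" "\<lambda>\<beta>. a $ (inv b \<beta>)" "b i"]) simp_all
  hence "a $ i = 0" for i by (simp add: inv_f_f[OF inj])
  with a(1) show False by (simp add: vec_eq_iff)
qed

lemma forms_kernel:
  fixes b :: "'p::finite \<Rightarrow> ((real^'n::finite) \<Rightarrow>\<^sub>L real)"
  assumes "CARD('p) < CARD('n)"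
  obtains w where "w \<noteq> 0" "forms b w = 0"
proof (rule ccontr)
  assume "\<not> thesis"
  hence "inj (forms b)" using that by (auto simp: linear_injective_0[OF linear_forms])
  hence "dim (range (forms b)) = dim (UNIV :: (real^'n) set)"
    by (intro dim_image_eq linear_forms) auto
  moreover have "dim (range (forms b)) \<le> DIM(real^'p)" by (rule dim_subset_UNIV)
  ultimately show False using assms by simp
qed

text \<open>The fibre of \<open>T\<close> through \<open>y\<close> contains the line in the direction \<open>w\<close>, along which \<open>G\<close> grows to
  infinity.\<close>

lemma fibre_unit_level:
  fixes G :: "real^'n::finite \<Rightarrow> real" and T :: "real^'n \<Rightarrow> 'b::real_vector"
  assumes G: "minkowski_norm G" and T: "linear T" and w: "w \<noteq> 0" "T w = 0" and y: "G y \<le> 1"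
  obtains y' where "T y' = T y" "G y' = 1"
proof -
  obtain m where m: "0 < m" "\<And>y. m * norm y \<le> G y" using minkowski_bounds[OF G] by metis
  define r where "r = (1 / m + norm y) / norm w"
  have r: "r \<ge> 0" using m(1) by (simp add: r_def)
  have "norm (r *\<^sub>R w) = r * norm w" using r by simp
  also have "\<dots> = 1 / m + norm y" using w by (simp add: r_def)
  finally have "1 / m + norm y = norm (r *\<^sub>R w)" by simp
  also have "norm (r *\<^sub>R w) \<le> norm (y + r *\<^sub>R w) + norm y" using norm_triangle_ineq4[of "y + r *\<^sub>R w" y] by simp
  finally have "1 \<le> m * norm (y + r *\<^sub>R w)" using m(1) by (simp add: field_simps)
  hence 1: "1 \<le> G (y + r *\<^sub>R w)" using m(2) order_trans by blast
  have "continuous_on {0..r} (\<lambda>t. G (y + t *\<^sub>R w))"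
    by (intro continuous_on_compose2[OF minkowski_continuous[OF G]] continuous_intros) auto
  then obtain t where "G (y + t *\<^sub>R w) = 1"
    using IVT'[of "\<lambda>t. G (y + t *\<^sub>R w)" 0 1 r] y 1 r by auto
  thus ?thesis using that[of "y + t *\<^sub>R w"] w(2) by (simp add: linear_add[OF T] linear_cmul[OF T])
qed

text \<open>The left-hand side is the image of the level set \<open>G y = 1\<close>. Because the kernel of \<open>T\<close> is not
  trivial, each fibre that meets the unit ball also meets this level set. So the image is compact and
  star-shaped.\<close>

lemma normalized_image_eq_ball_image:
  fixes G :: "real^'n::finite \<Rightarrow> real" and T :: "real^'n \<Rightarrow> 'b::real_vector"
  assumes G: "minkowski_norm G" and T: "linear T" and w: "w \<noteq> 0" "T w = 0"
  shows "(\<lambda>y. (1 / G y) *\<^sub>R T y) ` (-{0}) = T ` {y. G y \<le> 1}"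
proof (intro equalityI subsetI)
  fix z assume "z \<in> (\<lambda>y. (1 / G y) *\<^sub>R T y) ` (-{0})"
  then obtain y where y: "y \<noteq> 0" "z = (1 / G y) *\<^sub>R T y" by auto
  have "G ((1 / G y) *\<^sub>R y) = 1"
    using minkowski_scale[OF G, of "1 / G y" y] minkowski_pos[OF G y(1)] by simp
  thus "z \<in> T ` {y. G y \<le> 1}"
    using y by (intro image_eqI[of _ _ "(1 / G y) *\<^sub>R y"]) (simp_all add: linear_cmul[OF T])
next
  fix z assume "z \<in> T ` {y. G y \<le> 1}"
  then obtain y where "G y \<le> 1" "z = T y" by auto
  then obtain y' where y': "T y' = z" "G y' = 1" using fibre_unit_level[OF G T w] by metis
  have "y' \<noteq> 0" using y'(2) minkowski_zero[OF G] by auto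
  thus "z \<in> (\<lambda>y. (1 / G y) *\<^sub>R T y) ` (-{0})" using y' by (intro image_eqI[of _ _ y']) auto
qed

lemma minkowski_ball_compact:
  fixes G :: "real^'n::finite \<Rightarrow> real"
  assumes G: "minkowski_norm G"
  shows "compact {y. G y \<le> r}"
proof -
  obtain m where m: "0 < m" "\<And>y. m * norm y \<le> G y" using minkowski_bounds[OF G] by metis
  have "norm y \<le> r / m" if "G y \<le> r" for y
    using m(2)[of y] m(1) that by (simp add: field_simps)
  hence "bounded {y. G y \<le> r}" by (auto simp: bounded_iff)
  moreover have "closed {y. G y \<le> r}"
    by (intro closed_Collect_le minkowski_continuous[OF G] continuous_on_const)
  ultimately show ?thesis by (simp add: compact_eq_bounded_closed)
qed

lemma fibre_minimizer:
  fixes G :: "real^'n::finite \<Rightarrow> real" and T :: "real^'n \<Rightarrow> 'b::euclidean_space"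
  assumes G: "minkowski_norm G" and T: "linear T"
  obtains y where "T y = T y1" "\<And>y'. T y' = T y1 \<Longrightarrow> G y \<le> G y'"
proof -
  let ?S = "{y. G y \<le> G y1} \<inter> {y. T y = T y1}"
  have "closed {y. T y = T y1}"
    by (intro closed_Collect_eq linear_continuous_on linear_conv_bounded_linear[THEN iffD1] T continuous_on_const)
  hence S: "compact ?S" by (intro compact_Int_closed minkowski_ball_compact[OF G])
  obtain y where y: "y \<in> ?S" "\<And>y'. y' \<in> ?S \<Longrightarrow> G y \<le> G y'"
    using continuous_attains_inf[OF S _ continuous_on_subset[OF minkowski_continuous[OF G]]] by blast
  have "G y \<le> G y'" if "T y' = T y1" for y'
    using y(2)[of y'] y(1) that by (cases "G y' \<le> G y1") auto
  thus ?thesis using y(1) that by blast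
qed

text \<open>\<open>N\<close> is the quotient norm, the minimum of \<open>G\<close> over a fibre of \<open>T\<close>. The triangle inequality for
  \<open>G\<close> makes it Lipschitz.\<close>

lemma quotient_gauge:
  fixes G :: "real^'n::finite \<Rightarrow> real" and T :: "real^'n \<Rightarrow> real^'p::finite"
  assumes G: "minkowski_norm G" and sub: "\<And>x y. G (x + y) \<le> G x + G y" and T: "linear T" "surj T"
  obtains N where "continuous_on UNIV N" "\<And>c z. 0 < c \<Longrightarrow> N (c *\<^sub>R z) = c * N z"
    "\<And>z. z \<noteq> 0 \<Longrightarrow> 0 < N z" "T ` {y. G y \<le> 1} = {z. N z \<le> 1}"
proof -
  have "\<exists>y. T y = z \<and> (\<forall>y'. T y' = z \<longrightarrow> G y \<le> G y')" for z
    using fibre_minimizer[OF G T(1)] T(2) by (metis surjD)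
  then obtain Y where Y: "\<And>z. T (Y z) = z" "\<And>z y'. T y' = z \<Longrightarrow> G (Y z) \<le> G y'" by metis
  define N where "N z = G (Y z)" for z
  have N: "N z \<le> G y" if "T y = z" for y z using Y(2)[OF that] by (simp add: N_def)
  obtain L where L: "linear L" "T \<circ> L = id" using linear_surjective_right_inverse[OF T] by blast
  have TL: "T (L z) = z" for z using L(2) by (metis comp_apply id_apply)
  obtain C where C: "C > 0" "\<And>z. norm (L z) \<le> C * norm z" using linear_bounded_pos[OF L(1)] by blast
  obtain M where M: "M > 0" "\<And>y. G y \<le> M * norm y" using minkowski_bounds[OF G] by metis
  have step: "N z \<le> N z' + (M * C) * norm (z - z')" for z z'
  proof -
    have "N z \<le> G (Y z' + L (z - z'))" by (rule N) (simp add: linear_add[OF T(1)] Y TL)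
    also have "\<dots> \<le> N z' + G (L (z - z'))" unfolding N_def by (rule sub)
    also have "G (L (z - z')) \<le> M * (C * norm (z - z'))"
      using order_trans[OF M(2) mult_left_mono[OF C(2)]] M(1) by simp
    finally show ?thesis by simp
  qed
  have "(M * C)-lipschitz_on UNIV N"
  proof (rule lipschitz_onI)
    show "dist (N x) (N y) \<le> M * C * dist x y" for x y
      using step[of x y] step[of y x] by (simp add: dist_norm abs_le_iff norm_minus_commute)
  qed (use M C in simp)
  hence 1: "continuous_on UNIV N" by (rule lipschitz_on_continuous_on)
  have le: "N (c *\<^sub>R z) \<le> c * N z" if "0 < c" for c z
    using N[of "c *\<^sub>R Y z" "c *\<^sub>R z"] minkowski_scale[OF G that] by (simp add: linear_cmul[OF T(1)] Y N_def)
  have 2: "N (c *\<^sub>R z) = c * N z" if "0 < c" for c z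
    using le[OF that, of z] le[of "1 / c" "c *\<^sub>R z"] that by (simp add: field_simps)
  have 3: "0 < N z" if "z \<noteq> 0" for z
    unfolding N_def by (rule minkowski_pos[OF G]) (use Y(1)[of z] that linear_0[OF T(1)] in auto)
  have 4: "T ` {y. G y \<le> 1} = {z. N z \<le> 1}"
  proof (intro equalityI subsetI)
    fix z assume "z \<in> {z. N z \<le> 1}"
    thus "z \<in> T ` {y. G y \<le> 1}" using Y(1)[of z] by (intro image_eqI[of _ _ "Y z"]) (auto simp: N_def)
  next
    fix z assume "z \<in> T ` {y. G y \<le> 1}"
    thus "z \<in> {z. N z \<le> 1}" using N order_trans by blast
  qed
  show ?thesis using that 1 2 3 4 by blast
qed

text \<open>The Euclidean part satisfies the Cauchy-Schwarz inequality.\<close>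

lemma randers_triangle:
  assumes "randers_norm F"
  shows "F (x + y) \<le> F x + F y"
proof -
  from assms obtain \<alpha> \<beta> B where F: "\<And>y. F y = \<alpha> y + blinfun_apply \<beta> y"
    and B: "bilinear B" "\<And>x y. B x y = B y x" "\<And>x. x \<noteq> 0 \<Longrightarrow> (0::real) < B x x" "\<And>y. \<alpha> y = sqrt (B y y)"
    unfolding randers_norm_def euclidean_norm_def by blast
  have nn: "0 \<le> B x x" for x using B(3)[of x] bilinear_lzero[OF B(1), of x] by (cases "x = 0") auto
  have "(B x y)\<^sup>2 \<le> B x x * B y y"
  proof (cases "x = 0")
    case False
    define t where "t = B x y / B x x"
    have "0 \<le> B (y - t *\<^sub>R x) (y - t *\<^sub>R x)" by (rule nn)
    also have "\<dots> = B y y - 2 * t * B x y + t * t * B x x"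
      by (simp add: bilinear_lsub[OF B(1)] bilinear_rsub[OF B(1)] bilinear_lmul[OF B(1)] bilinear_rmul[OF B(1)] B(2)[of y x] algebra_simps)
    also have "\<dots> = B y y - (B x y)\<^sup>2 / B x x" using B(3)[OF False] by (simp add: t_def field_simps power2_eq_square)
    finally show ?thesis using B(3)[OF False] by (simp add: field_simps)
  qed (simp add: bilinear_lzero[OF B(1)])
  hence cs: "B x y \<le> sqrt (B x x) * sqrt (B y y)"
    using real_le_rsqrt by (simp flip: real_sqrt_mult)
  have "\<alpha> (x + y) \<le> \<alpha> x + \<alpha> y"
    unfolding B(4)
  proof (rule real_le_lsqrt)
    show "B (x + y) (x + y) \<le> (sqrt (B x x) + sqrt (B y y))\<^sup>2"
      using cs nn by (simp add: power2_sum bilinear_ladd[OF B(1)] bilinear_radd[OF B(1)] B(2)[of y x])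
  qed (use nn in auto)
  thus ?thesis by (simp add: F blinfun.add_right)
qed

section \<open>Inverting a deformation\<close>

text \<open>In directions in which all the forms are constant, only \<open>F\<close> varies in \<open>F f(b/F)\<close>.\<close>

lemma dderiv_deform_kernel:
  fixes F Ft :: "real^'n::finite \<Rightarrow> real" and b :: "'p::finite \<Rightarrow> ((real^'n) \<Rightarrow>\<^sub>L real)"
  assumes F: "minkowski_norm F" and f: "f differentiable (at ((1 / F y) *\<^sub>R forms b y))"
    and Ft: "\<And>y. y \<noteq> 0 \<Longrightarrow> Ft y = F y * f ((1 / F y) *\<^sub>R forms b y)"
    and y: "y \<noteq> 0" and v: "forms b v = 0"
  defines "s \<equiv> (1 / F y) *\<^sub>R forms b y"
  shows "dderiv v Ft y = (f s - dderiv s f s) * dderiv v F y"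
proof -
  let ?g = "\<lambda>j z. inverse (F z) * blinfun_apply (b j) z"
  have o: "open (-{0::real^'n})" by (simp add: open_Compl)
  have vec: "(\<chi> j. ?g j z) = (1 / F z) *\<^sub>R forms b z" for z
    by (simp add: vec_eq_iff inverse_eq_divide)
  have Fy: "F y > 0" by (rule minkowski_pos[OF F y])
  have dF: "F differentiable (at y)" using smooth_onD_diff[OF minkowski_smooth[OF F]] y by simp
  have bd: "(blinfun_apply (b j) has_derivative blinfun_apply (b j)) (at y)" for j
    by (rule bounded_linear_imp_has_derivative[OF blinfun.bounded_linear_right])
  have dinv: "(\<lambda>z. inverse (F z)) differentiable (at y)"
    using partial_deriv_compose_real(2)[OF DERIV_inverse dF] Fy by simp
  have Dinv: "dderiv v (\<lambda>z. inverse (F z)) y = - (inverse (F y))\<^sup>2 * dderiv v F y"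
    using dderiv_compose_real[OF DERIV_inverse dF, of v] Fy by (simp add: power2_eq_square)
  have bv: "blinfun_apply (b j) v = 0" for j using arg_cong[OF v, of "\<lambda>z. z $ j"] by simp
  have dg: "?g j differentiable (at y)" for j
    using dinv differentiableI[OF bd] by (intro differentiable_mult)
  have Dg: "dderiv v (?g j) y = - (inverse (F y) * dderiv v F y) * s $ j" for j
  proof -
    have "s $ j = inverse (F y) * blinfun_apply (b j) y" by (simp add: s_def inverse_eq_divide)
    thus ?thesis
      using dderiv_mult[OF dinv differentiableI[OF bd], of v j] dderiv_eqI[OF bd, of v j]
      by (simp add: bv Dinv power2_eq_square)
  qed
  have df: "f differentiable (at (\<chi> j. ?g j y))" using f by (simp add: vec)
  have D: "((\<lambda>z. f (\<chi> j. ?g j z)) has_derivative (\<lambda>h. dderiv (\<chi> j. dderiv h (?g j) y) f (\<chi> j. ?g j y))) (at y)"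
    by (rule has_derivative_compose_vec[where f=f and g="?g", OF df dg])
  have "(\<chi> j. dderiv v (?g j) y) = (- (inverse (F y) * dderiv v F y)) *\<^sub>R s"
    by (simp add: vec_eq_iff Dg)
  hence Df: "dderiv v (\<lambda>z. f (\<chi> j. ?g j z)) y = - (inverse (F y) * dderiv v F y) * dderiv s f s"
    using dderiv_eqI[OF D, of v] dderiv_scale_left[of "- (inverse (F y) * dderiv v F y)" s f s] by (simp add: vec s_def)
  have "dderiv v Ft y = dderiv v (\<lambda>z. F z * f (\<chi> j. ?g j z)) y"
    by (rule dderiv_cong[OF o]) (use y Ft in \<open>auto simp: vec\<close>)
  also have "\<dots> = F y * (- (inverse (F y) * dderiv v F y) * dderiv s f s) + dderiv v F y * f s"
    using dderiv_mult[OF dF differentiableI[OF D], of v, unfolded Df] by (simp add: vec s_def)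
  also have "\<dots> = (f s - dderiv s f s) * dderiv v F y" using Fy by (simp add: field_simps)
  finally show ?thesis .
qed

lemma dderiv_sq:
  fixes F :: "real^'n::finite \<Rightarrow> real"
  assumes "F differentiable (at y)"
  shows "dderiv v (\<lambda>z. (F z)\<^sup>2) y = 2 * F y * dderiv v F y"
  using dderiv_mult[OF assms assms, of v] by (simp add: power2_eq_square)

text \<open>Strong convexity makes \<open>t \<mapsto> (F (y + t v))\<^sup>2\<close> strictly convex on a line that avoids the
  origin.\<close>

lemma energy_increases_from_minimizer:
  fixes F :: "real^'n::finite \<Rightarrow> real"
  assumes F: "minkowski_norm F" and v: "v \<noteq> 0" and off: "\<And>t. y + t *\<^sub>R v \<noteq> 0"
    and crit: "dderiv v F y = 0"
  shows "0 < dderiv v F (y + v)"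
proof -
  let ?E = "\<lambda>z. (F z)\<^sup>2"
  have o: "open (-{0::real^'n})" by (simp add: open_Compl)
  note f = minkowski_smooth[OF F] and E = minkowski_sq_smooth[OF F]
  have dF: "F differentiable (at (y + t *\<^sub>R v))" for t
    using smooth_onD_diff[OF f] off by simp
  have "((\<lambda>t. dderiv v ?E (y + t *\<^sub>R v)) has_real_derivative dderiv v (dderiv v ?E) (y + t *\<^sub>R v)) (at t)" for t
    by (rule dderiv_along_line) (use smooth_onD_diff[OF smooth_on_dderiv[OF E o]] off in simp)
  hence "dderiv v ?E (y + 0 *\<^sub>R v) < dderiv v ?E (y + 1 *\<^sub>R v)"
    using minkowski_pos_def[OF F off v] by (intro DERIV_pos_imp_increasing[of 0 1 "\<lambda>t. dderiv v ?E (y + t *\<^sub>R v)"]) auto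
  hence "0 < F (y + v) * dderiv v F (y + v)"
    using dderiv_sq[OF dF, of v 0] dderiv_sq[OF dF, of v 1] crit by simp
  thus ?thesis using minkowski_pos[OF F off[of 1]] by (simp add: zero_less_mult_iff)
qed

text \<open>By \<open>dderiv_deform_kernel\<close> the quantity \<open>f s - dderiv s f s\<close> is the ratio of the derivatives of
  \<open>Ft\<close> and \<open>F\<close> along a fibre of the forms. At the point of the fibre where \<open>F\<close> is smallest both derivatives
  vanish, and on the way from there to \<open>y\<close> both become positive. If \<open>y\<close> is that point itself, the second
  derivatives are compared instead. On the fibre through \<open>0\<close> the ratio is \<open>f 0\<close>.\<close>

lemma deform_radial_pos:
  fixes F Ft :: "real^'n::finite \<Rightarrow> real" and b :: "'p::finite \<Rightarrow> ((real^'n) \<Rightarrow>\<^sub>L real)"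
  assumes F: "minkowski_norm F" and Ftm: "minkowski_norm Ft"
    and V: "open V" and f: "smooth_on V f" and in_V: "\<And>y. y \<noteq> 0 \<Longrightarrow> (1 / F y) *\<^sub>R forms b y \<in> V"
    and Ft: "\<And>y. y \<noteq> 0 \<Longrightarrow> Ft y = F y * f ((1 / F y) *\<^sub>R forms b y)"
    and ker: "CARD('p) < CARD('n)" and y: "y \<noteq> 0"
  defines "\<sigma> \<equiv> \<lambda>y. (1 / F y) *\<^sub>R forms b y"
  shows "dderiv (\<sigma> y) f (\<sigma> y) < f (\<sigma> y)"
proof -
  define A where "A s = f s - dderiv s f s" for s
  have o: "open (-{0::real^'n})" by (simp add: open_Compl)
  have chain: "dderiv v Ft z = A (\<sigma> z) * dderiv v F z" if "z \<noteq> 0" "forms b v = 0" for v z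
    unfolding A_def \<sigma>_def
    by (rule dderiv_deform_kernel[OF F smooth_onD_diff[OF f in_V] Ft]) (use that in auto)
  have "0 < A (\<sigma> y)"
  proof (cases "forms b y = 0")
    case True
    hence "\<sigma> y = 0" by (simp add: \<sigma>_def)
    moreover have "f (\<sigma> y) > 0"
      using Ft[OF y] minkowski_pos[OF F y] minkowski_pos[OF Ftm y] by (simp add: \<sigma>_def zero_less_mult_iff)
    ultimately show ?thesis by (simp add: A_def dderiv_def)
  next
    case False
    obtain y0 where y0: "forms b y0 = forms b y" "\<And>y'. forms b y' = forms b y \<Longrightarrow> F y0 \<le> F y'"
      using fibre_minimizer[OF F linear_forms] by blast
    have off: "y0 + t *\<^sub>R v \<noteq> 0" if "forms b v = 0" for t v
    proof
      assume "y0 + t *\<^sub>R v = 0"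
      hence "forms b (y0 + t *\<^sub>R v) = 0" using linear_0[OF linear_forms] by simp
      thus False using that False y0(1) by (simp add: linear_add[OF linear_forms] linear_cmul[OF linear_forms])
    qed
    have y0nz: "y0 \<noteq> 0" using False y0(1) linear_0[OF linear_forms, of b] by auto
    have crit: "dderiv v F y0 = 0" if v: "forms b v = 0" for v
    proof -
      have "((\<lambda>t. F (y0 + t *\<^sub>R v)) has_real_derivative dderiv v F (y0 + 0 *\<^sub>R v)) (at 0)"
        by (rule dderiv_along_line) (use smooth_onD_diff[OF minkowski_smooth[OF F]] y0nz in simp)
      moreover have "F (y0 + 0 *\<^sub>R v) \<le> F (y0 + t *\<^sub>R v)" for t
        using y0(2)[of "y0 + t *\<^sub>R v"] by (simp add: linear_add[OF linear_forms] linear_cmul[OF linear_forms] v y0(1))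
      ultimately have "dderiv v F (y0 + 0 *\<^sub>R v) = 0"
        by (intro DERIV_local_min[of _ _ _ 1]) auto
      thus ?thesis by simp
    qed
    show ?thesis
    proof (cases "y = y0")
      case False
      let ?v = "y - y0"
      have v: "?v \<noteq> 0" "forms b ?v = 0" using False y0(1) by (auto simp: linear_diff[OF linear_forms])
      have "0 < dderiv ?v F (y0 + ?v)"
        by (rule energy_increases_from_minimizer[OF F v(1) off[OF v(2)] crit[OF v(2)]])
      moreover have "0 < dderiv ?v Ft (y0 + ?v)"
        by (rule energy_increases_from_minimizer[OF Ftm v(1) off[OF v(2)]])
           (simp add: chain[OF y0nz v(2)] crit[OF v(2)])
      ultimately show ?thesis using chain[OF y v(2)] by (simp add: zero_less_mult_iff)
    next
      case True
      obtain w where w: "w \<noteq> 0" "forms b w = 0" using forms_kernel[OF ker, of b] by blast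
      let ?E = "\<lambda>z. (F z)\<^sup>2" and ?Et = "\<lambda>z. (Ft z)\<^sup>2"
      note sF = minkowski_smooth[OF F] and sFt = minkowski_smooth[OF Ftm]
      define C where "C z = Ft z * inverse (F z) * A (\<chi> j. inverse (F z) * blinfun_apply (b j) z)" for z
      have vec: "(\<chi> j. inverse (F z) * blinfun_apply (b j) z) = \<sigma> z" for z
        by (simp add: vec_eq_iff inverse_eq_divide \<sigma>_def)
      have "smooth_on V A" unfolding A_def dderiv_def
        by (intro smooth_on_diff smooth_on_sum smooth_on_mult smooth_on_component smooth_on_partial f V)
      moreover have "smooth_on S (blinfun_apply (b j))" for S j
      proof -
        have "blinfun_apply (b j) = (\<lambda>x. (\<chi> i. blinfun_apply (b j) (axis i 1)) \<bullet> x)"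
          using linear_eq_inner[OF bounded_linear.linear[OF blinfun.bounded_linear_right], of "b j"] by blast
        thus ?thesis by (metis smooth_on_inner)
      qed
      ultimately have "smooth_on (-{0}) C"
        unfolding C_def using minkowski_pos[OF F] in_V
        by (intro smooth_on_mult[OF smooth_on_mult[OF sFt smooth_on_inverse[OF sF o] o] smooth_on_compose[where T=V] o]
             smooth_on_mult[OF smooth_on_inverse[OF sF o]])
           (auto simp: o vec \<sigma>_def less_imp_neq[symmetric] dest: less_imp_neq[OF minkowski_pos[OF F]])
      hence dC: "C differentiable (at y)" using smooth_onD_diff y by blast
      have eq: "dderiv w ?Et z = C z * dderiv w ?E z" if z: "z \<in> -{0}" for z
      proof -
        have "dderiv w ?Et z = 2 * Ft z * (A (\<sigma> z) * dderiv w F z)"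
          using dderiv_sq[OF smooth_onD_diff[OF sFt z]] chain[of z w] w z by simp
        also have "\<dots> = C z * (2 * F z * dderiv w F z)"
          using minkowski_pos[OF F, of z] z by (simp add: C_def vec)
        finally show ?thesis using dderiv_sq[OF smooth_onD_diff[OF sF z]] by simp
      qed
      have E0: "dderiv w ?E y = 0"
        using dderiv_sq[OF smooth_onD_diff[OF sF], of y w] y crit[OF w(2)] True by simp
      have "dderiv w (dderiv w ?Et) y = dderiv w (\<lambda>z. C z * dderiv w ?E z) y"
        by (rule dderiv_cong[OF o]) (use y eq in auto)
      also have "\<dots> = C y * dderiv w (dderiv w ?E) y"
        using dderiv_mult[OF dC smooth_onD_diff[OF smooth_on_dderiv[OF minkowski_sq_smooth[OF F] o]], of w w] y E0
        by simp
      finally have "0 < C y"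
        using minkowski_pos_def[OF F y w(1)] minkowski_pos_def[OF Ftm y w(1)] by (simp add: zero_less_mult_iff)
      moreover have "0 < Ft y * inverse (F y)" using minkowski_pos[OF F y] minkowski_pos[OF Ftm y] by simp
      ultimately show ?thesis using zero_less_mult_pos[of "Ft y * inverse (F y)" "A (\<sigma> y)"] by (simp only: C_def vec)
    qed
  qed
  thus ?thesis by (simp add: A_def)
qed


text \<open>The segment from \<open>0\<close> to \<open>s\<close> is compact, so a neighbourhood of it is still contained in \<open>V\<close>.\<close>

lemma star_core_open:
  fixes V :: "'a::real_normed_vector set"
  assumes V: "open V"
  shows "open {s. \<forall>r\<in>{0..1}. r *\<^sub>R s \<in> V}"
proof (rule openI)
  fix s assume "s \<in> {s. \<forall>r\<in>{0..1}. r *\<^sub>R s \<in> V}"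
  hence s: "(\<lambda>r. r *\<^sub>R s) ` {0..1} \<subseteq> V" by auto
  have "compact ((\<lambda>r. r *\<^sub>R s) ` {0..1::real})"
    by (intro compact_continuous_image continuous_intros) auto
  from compact_subset_open_imp_ball_epsilon_subset[OF this V s]
  obtain e where e: "e > 0" "(\<Union>x\<in>(\<lambda>r. r *\<^sub>R s) ` {0..1}. ball x e) \<subseteq> V" by blast
  have "r *\<^sub>R t \<in> V" if t: "t \<in> ball s e" and r: "r \<in> {0..1}" for t r
  proof -
    have "dist (r *\<^sub>R s) (r *\<^sub>R t) = r * dist s t"
      using r by (simp add: dist_norm flip: scaleR_diff_right)
    also have "\<dots> \<le> dist s t" using r by (simp add: mult_left_le_one_le)
    finally have "r *\<^sub>R t \<in> ball (r *\<^sub>R s) e" using t by simp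
    thus ?thesis using e(2) r by blast
  qed
  thus "\<exists>e>0. ball s e \<subseteq> {s. \<forall>r\<in>{0..1}. r *\<^sub>R s \<in> V}" using e(1) by blast
qed

text \<open>The function \<open>h\<close> plays the role of \<open>1 / \<phi>1\<close>, where \<open>F = Ft \<phi>1(b/Ft)\<close>. In terms of \<open>h\<close> the
  positivity of \<open>\<phi>1 - s \<cdot> grad \<phi>1\<close> becomes that of \<open>h s + dderiv s h s\<close>.\<close>

lemma deformation_inverse:
  fixes F Ft :: "real^'n::finite \<Rightarrow> real" and b :: "'p::finite \<Rightarrow> ((real^'n) \<Rightarrow>\<^sub>L real)"
  assumes F: "minkowski_norm F" and Ftm: "minkowski_norm Ft" and tri: "\<And>x y. Ft (x + y) \<le> Ft x + Ft y"
    and V: "open V" and f: "smooth_on V f" and fpos: "\<And>s. s \<in> V \<Longrightarrow> 0 < f s"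
    and in_V: "\<And>y. y \<noteq> 0 \<Longrightarrow> (1 / F y) *\<^sub>R forms b y \<in> V"
    and Ft: "\<And>y. y \<noteq> 0 \<Longrightarrow> Ft y = F y * f ((1 / F y) *\<^sub>R forms b y)"
    and ker: "CARD('p) < CARD('n)" and surj: "surj (forms b)"
  obtains h where "smooth_on UNIV h" "\<And>s. 0 < h s" "\<And>s. 0 < h s + dderiv s h s" "\<And>s. h s *\<^sub>R s \<in> V"
    "\<And>y. y \<noteq> 0 \<Longrightarrow> F y * h ((1 / Ft y) *\<^sub>R forms b y) = Ft y"
proof -
  obtain w where w: "w \<noteq> 0" "forms b w = 0" using forms_kernel[OF ker, of b] by blast
  define \<sigma> where "\<sigma> y = (1 / F y) *\<^sub>R forms b y" for y
  define K where "K = \<sigma> ` (-{0})"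
  have K: "K = forms b ` {y. F y \<le> 1}"
    unfolding K_def \<sigma>_def[abs_def] by (rule normalized_image_eq_ball_image[OF F linear_forms w])
  have Kc: "compact K"
    unfolding K by (intro compact_continuous_image minkowski_ball_compact[OF F] linear_continuous_on
        linear_conv_bounded_linear[THEN iffD1] linear_forms)
  have Kstar: "r *\<^sub>R s \<in> K" if "s \<in> K" "0 \<le> r" "r \<le> 1" for r s
  proof -
    obtain y where y: "F y \<le> 1" "s = forms b y" using \<open>s \<in> K\<close> unfolding K by blast
    have "F (r *\<^sub>R y) \<le> 1"
    proof (cases "r = 0")
      case False
      hence "F (r *\<^sub>R y) = r * F y" using minkowski_scale[OF F] that by simp
      also have "\<dots> \<le> 1" using that y(1) minkowski_nonneg[OF F, of y] by (simp add: mult_le_one)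
      finally show ?thesis .
    qed (simp add: minkowski_zero[OF F])
    thus ?thesis unfolding K y(2) by (intro image_eqI[of _ _ "r *\<^sub>R y"]) (auto simp: linear_cmul[OF linear_forms])
  qed
  define V' where "V' = {s \<in> V. dderiv s f s < f s}"
  define W where "W = {s. \<forall>r\<in>{0..1}. r *\<^sub>R s \<in> V'}"
  have "continuous_on V (\<lambda>s. f s - dderiv s f s)"
    unfolding dderiv_def
    by (intro smooth_onD_cont smooth_on_diff smooth_on_sum smooth_on_mult smooth_on_component smooth_on_partial f V)
  hence "open (V \<inter> (\<lambda>s. f s - dderiv s f s) -` {0<..})" using V by (simp add: continuous_on_open_vimage Int_commute)
  moreover have "V' = V \<inter> (\<lambda>s. f s - dderiv s f s) -` {0<..}" by (auto simp: V'_def)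
  ultimately have V': "open V'" by simp
  have WV: "W \<subseteq> V'" unfolding W_def by (auto dest: bspec[of _ _ 1])
  have "K \<subseteq> V'"
    using deform_radial_pos[OF F Ftm V f in_V Ft ker] in_V by (auto simp: K_def V'_def \<sigma>_def)
  hence KW: "K \<subseteq> W" using Kstar by (auto simp: W_def)
  interpret radial_chart f W
  proof
    show "open W" unfolding W_def by (rule star_core_open[OF V'])
    show "smooth_on W f" by (rule smooth_on_subset[OF f]) (use WV in \<open>auto simp: V'_def\<close>)
    show "0 < f s" "dderiv s f s < f s" if "s \<in> W" for s using that WV fpos by (auto simp: V'_def)
    show "r *\<^sub>R s \<in> W" if s: "s \<in> W" and r: "0 \<le> r" "r \<le> 1" for r s
    proof -
      have "(q * r) *\<^sub>R s \<in> V'" if "q \<in> {0..1}" for q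
        using s r that by (auto simp: W_def mult_le_one)
      thus ?thesis by (auto simp: W_def)
    qed
  qed
  have \<psi>\<sigma>: "\<psi> (\<sigma> y) = (1 / Ft y) *\<^sub>R forms b y" if "y \<noteq> 0" for y
    using Ft[OF that] by (simp add: \<psi>_def \<sigma>_def)
  obtain N where N: "continuous_on UNIV N" "\<And>c z. 0 < c \<Longrightarrow> N (c *\<^sub>R z) = c * N z"
    "\<And>z. z \<noteq> 0 \<Longrightarrow> 0 < N z" "forms b ` {y. Ft y \<le> 1} = {z. N z \<le> 1}"
    using quotient_gauge[OF Ftm tri linear_forms surj] by blast
  have "\<psi> ` K = (\<lambda>y. (1 / Ft y) *\<^sub>R forms b y) ` (-{0})"
    unfolding K_def image_image by (rule image_cong) (auto simp: \<psi>\<sigma>)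
  also have "\<dots> = {z. N z \<le> 1}"
    unfolding N(4)[symmetric] by (rule normalized_image_eq_ball_image[OF Ftm linear_forms w])
  finally obtain h where h: "smooth_on UNIV h" "\<And>s. 0 < h s" "\<And>s. 0 < h s + dderiv s h s" "\<And>s. h s *\<^sub>R s \<in> W"
    "\<And>s. s \<in> K \<Longrightarrow> h (\<psi> s) = f s"
    using radial_extension[OF Kc KW N(1-3)] by blast
  have "F y * h ((1 / Ft y) *\<^sub>R forms b y) = Ft y" if y: "y \<noteq> 0" for y
  proof -
    have "h ((1 / Ft y) *\<^sub>R forms b y) = f (\<sigma> y)"
      using h(5)[of "\<sigma> y"] y \<psi>\<sigma>[OF y] by (simp add: K_def)
    thus ?thesis using Ft[OF y] by (simp add: \<sigma>_def)
  qed
  moreover have "h s *\<^sub>R s \<in> V" for s using h(4) WV by (auto simp: V'_def)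
  ultimately show ?thesis using that h(1-3) by blast
qed

section \<open>The deformations of the C-reducible norm\<close>

theorem theorem3:
  fixes F Fbar Ftilde :: "real^'n::finite \<Rightarrow> real"
    and b :: "'p::finite \<Rightarrow> ((real^'n) \<Rightarrow>\<^sub>L real)"
    and \<delta> :: "real^'p"
    and \<phi> :: "real^'p \<Rightarrow> real"
  assumes "3 \<le> CARD('n)" and "CARD('p) < CARD('n)"
    and "minkowski_norm F"
    and "inj b" and "independent (range b)"
    and "deformation_function F b \<delta> \<phi>"
    and "\<forall>s\<in>cbox (- \<delta>) \<delta>. \<phi> s \<noteq> 1"
    and "Fbar = deform b \<phi> F" and "minkowski_norm Fbar"
    and "Ftilde = (\<lambda>y. sqrt \<bar>(Fbar y)\<^sup>2 - (F y)\<^sup>2\<bar>)"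
    and "minkowski_norm Ftilde" and "C_reducible Ftilde"
  shows "randers_norm Ftilde \<and>
    (\<exists>\<delta>1 \<phi>1 \<phi>2.
       deformation_function Ftilde b \<delta>1 \<phi>1 \<and>
       deformation_function Ftilde b \<delta>1 \<phi>2 \<and>
       (\<forall>s\<in>cbox (- \<delta>1) \<delta>1. (1 / \<phi>1 s) *\<^sub>R s \<in> cbox (- \<delta>) \<delta> \<and>
                               \<phi>2 s = \<phi>1 s * \<phi> ((1 / \<phi>1 s) *\<^sub>R s)) \<and>
       F = deform b \<phi>1 Ftilde \<and>
       Fbar = deform b \<phi>2 Ftilde)"
proof -
  have n: "3 \<le> CARD('n)" and p: "CARD('p) < CARD('n)" and F: "minkowski_norm F"
    and inj: "inj b" and ind: "independent (range b)" and \<phi>: "deformation_function F b \<delta> \<phi>"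
    and \<phi>1: "\<forall>s\<in>cbox (- \<delta>) \<delta>. \<phi> s \<noteq> 1" and Fbar: "Fbar = deform b \<phi> F"
    and Ftilde: "Ftilde = (\<lambda>y. sqrt \<bar>(Fbar y)\<^sup>2 - (F y)\<^sup>2\<bar>)"
    and Ftm: "minkowski_norm Ftilde" and C: "C_reducible Ftilde"
    using assms by blast+
  have randers: "randers_norm Ftilde" by (rule C_reducible_imp_randers[OF C])
  \<comment> \<open>The open box already contains the compact set of values of \<open>b/F\<close>.\<close>
  define V where "V = box (- \<delta>) \<delta>"
  have V: "open V" by (simp add: V_def open_box)
  have VB: "V \<subseteq> cbox (- \<delta>) \<delta>" by (simp add: V_def box_subset_cbox)
  obtain U where U: "cbox (- \<delta>) \<delta> \<subseteq> U" "smooth_on U \<phi>"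
    using \<phi> by (auto simp: deformation_function_def)
  have \<phi>_smooth: "smooth_on V \<phi>" using smooth_on_subset[OF U(2)] U(1) VB by blast
  have \<phi>_pos: "0 < \<phi> s" "\<phi> s \<noteq> 1" "dderiv s \<phi> s < \<phi> s" if "s \<in> V" for s
    using that VB \<phi> \<phi>1 by (auto simp: deformation_function_def dderiv_def)
  have vec: "(\<chi> i. blinfun_apply (b i) y / G) = (1 / G) *\<^sub>R forms b y" for y and G :: real
    by (simp add: vec_eq_iff)
  have in_V: "(1 / F y) *\<^sub>R forms b y \<in> V" if y: "y \<noteq> 0" for y
  proof -
    have "\<bar>blinfun_apply (b i) y / F y\<bar> < \<delta> $ i" for i
      using dual_norm_bound[OF F y, of "b i"] minkowski_pos[OF F y] \<phi>
      by (auto simp: deformation_function_def abs_divide intro: le_less_trans)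
    hence "- (\<delta> $ i) < blinfun_apply (b i) y / F y \<and> blinfun_apply (b i) y / F y < \<delta> $ i" for i
      unfolding abs_less_iff by (metis minus_less_iff)
    thus ?thesis by (simp add: V_def mem_box_cart)
  qed
  define f where "f s = sqrt \<bar>(\<phi> s)\<^sup>2 - 1\<bar>" for s
  have sq1: "(\<phi> s)\<^sup>2 - 1 \<noteq> 0" if "s \<in> V" for s
    using \<phi>_pos[OF that] by (simp add: power2_eq_1_iff)
  have fpos: "0 < f s" if "s \<in> V" for s using sq1[OF that] by (simp add: f_def)
  have f: "smooth_on V f"
  proof -
    \<comment> \<open>One square root stands for the absolute value, which is smooth since \<open>\<phi>\<^sup>2 \<noteq> 1\<close>.\<close>
    have "smooth_on V (\<lambda>s. sqrt (sqrt (((\<phi> s)\<^sup>2 - 1)\<^sup>2)))"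
      using sq1 by (intro smooth_on_sqrt smooth_on_power smooth_on_diff smooth_on_const \<phi>_smooth V) auto
    thus ?thesis by (simp add: f_def[abs_def])
  qed
  have Ft: "Ftilde y = F y * f ((1 / F y) *\<^sub>R forms b y)" for y
  proof -
    define q where "q = \<phi> ((1 / F y) *\<^sub>R forms b y)"
    have "(F y * q)\<^sup>2 - (F y)\<^sup>2 = (F y)\<^sup>2 * (q\<^sup>2 - 1)" by (simp add: power_mult_distrib algebra_simps)
    thus ?thesis using minkowski_nonneg[OF F, of y]
      by (simp add: Ftilde Fbar deform_def vec f_def abs_mult real_sqrt_mult flip: q_def)
  qed
  obtain h where h: "smooth_on UNIV h" "\<And>s. 0 < h s" "\<And>s. 0 < h s + dderiv s h s" "\<And>s. h s *\<^sub>R s \<in> V"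
    "\<And>y. y \<noteq> 0 \<Longrightarrow> F y * h ((1 / Ftilde y) *\<^sub>R forms b y) = Ftilde y"
    using deformation_inverse[OF F Ftm randers_triangle[OF randers] V f fpos in_V Ft p surj_forms[OF inj ind]] by metis
  \<comment> \<open>\<open>h\<close> is defined on the whole space, so any box beyond the dual norms will do.\<close>
  define \<delta>1 where "\<delta>1 = (\<chi> i. dual_norm Ftilde (b i) + 1)"
  define \<phi>1 where "\<phi>1 s = 1 / h s" for s
  define \<phi>2 where "\<phi>2 s = \<phi>1 s * \<phi> ((1 / \<phi>1 s) *\<^sub>R s)" for s
  have hnz: "h s \<noteq> 0" for s using h(2)[of s] by simp
  have dh: "h differentiable (at s)" for s by (rule smooth_onD_diff[OF h(1)]) simp
  have \<phi>2: "\<phi>2 s = 1 / h s * \<phi> (h s *\<^sub>R s)" for s by (simp add: \<phi>2_def \<phi>1_def)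
  have \<phi>1_smooth: "smooth_on UNIV \<phi>1"
    unfolding \<phi>1_def[abs_def] using hnz by (intro smooth_on_divide h(1) smooth_on_const) auto
  have \<phi>1_deriv: "dderiv s \<phi>1 s = - dderiv s h s / (h s)\<^sup>2" for s
    using dderiv_compose_real[OF DERIV_inverse[OF hnz] dh, of s] 
    by (simp add: \<phi>1_def[abs_def] inverse_eq_divide power2_eq_square)
  have "deformation_function Ftilde b \<delta>1 \<phi>1"
    unfolding deformation_function_def dderiv_def[symmetric]
  proof (intro conjI ballI allI)
    show "0 < \<phi>1 s" for s using h(2) by (simp add: \<phi>1_def)
    have "\<phi>1 s - dderiv s \<phi>1 s = (h s + dderiv s h s) / (h s)\<^sup>2" for s
      using hnz[of s] by (simp add: \<phi>1_deriv) (simp add: \<phi>1_def field_simps power2_eq_square)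
    thus "0 < \<phi>1 s - dderiv s \<phi>1 s" for s using h(3)[of s] h(2)[of s] by simp
  qed (use \<phi>1_smooth in \<open>auto simp: \<delta>1_def\<close>)
  moreover have "deformation_function Ftilde b \<delta>1 \<phi>2"
    unfolding deformation_function_def dderiv_def[symmetric]
  proof (intro conjI ballI allI)
    have d\<phi>: "\<phi> differentiable (at (h s *\<^sub>R s))" for s by (rule smooth_onD_diff[OF \<phi>_smooth h(4)])
    show "0 < \<phi>2 s" for s using h(2) \<phi>_pos[OF h(4)] by (simp add: \<phi>2)
    show "0 < \<phi>2 s - dderiv s \<phi>2 s" for s
    proof -
      define q where "q = h s + dderiv s h s"
      have "dderiv s \<phi>2 s = \<phi>1 s * (q * dderiv s \<phi> (h s *\<^sub>R s)) + dderiv s \<phi>1 s * \<phi> (h s *\<^sub>R s)"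
        using dderiv_mult[OF smooth_onD_diff[OF \<phi>1_smooth] radial_compose(1)[OF dh d\<phi>], of s s] radial_compose(2)[OF dh d\<phi>, of s]
        by (simp add: \<phi>2_def[abs_def] \<phi>1_def[abs_def] q_def)
      also have "\<dots> = q / (h s)\<^sup>2 * dderiv (h s *\<^sub>R s) \<phi> (h s *\<^sub>R s) - (q - h s) / (h s)\<^sup>2 * \<phi> (h s *\<^sub>R s)"
        using hnz[of s] by (simp add: \<phi>1_deriv dderiv_scale_left q_def) (simp add: \<phi>1_def power2_eq_square)
      finally have D: "dderiv s \<phi>2 s = \<dots>" .
      have "\<phi>2 s - dderiv s \<phi>2 s = q / (h s)\<^sup>2 * (\<phi> (h s *\<^sub>R s) - dderiv (h s *\<^sub>R s) \<phi> (h s *\<^sub>R s))"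
        unfolding D unfolding \<phi>2 using hnz[of s] by (simp add: field_simps power2_eq_square)
      also have "0 < \<dots>" using h(2,3)[of s] \<phi>_pos(3)[OF h(4), of s] by (simp add: q_def)
      finally show ?thesis .
    qed
    have "smooth_on UNIV (\<lambda>s. \<phi>1 s * \<phi> (\<chi> j. h s * s $ j))"
    proof (intro smooth_on_mult \<phi>1_smooth smooth_on_compose[OF \<phi>_smooth] h(1) smooth_on_component)
      fix s show "(\<chi> j. h s * s $ j) \<in> V"
        using h(4)[of s] by (simp add: scaleR_vec_def)
    qed simp_all
    hence "smooth_on UNIV \<phi>2" by (simp add: \<phi>2_def[abs_def] \<phi>1_def[abs_def] scaleR_vec_def)
    thus "\<exists>U. open U \<and> cbox (- \<delta>1) \<delta>1 \<subseteq> U \<and> smooth_on U \<phi>2" by (intro exI[of _ UNIV]) simp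
  qed (simp add: \<delta>1_def)
  moreover have "\<forall>s\<in>cbox (- \<delta>1) \<delta>1. (1 / \<phi>1 s) *\<^sub>R s \<in> cbox (- \<delta>) \<delta> \<and> \<phi>2 s = \<phi>1 s * \<phi> ((1 / \<phi>1 s) *\<^sub>R s)"
    using h(4) VB by (auto simp: \<phi>1_def \<phi>2_def)
  moreover have F1: "F y = Ftilde y * \<phi>1 ((1 / Ftilde y) *\<^sub>R forms b y)" for y
  proof (cases "y = 0")
    case False
    thus ?thesis using h(5)[OF False] hnz[of "(1 / Ftilde y) *\<^sub>R forms b y"] by (simp add: \<phi>1_def field_simps)
  qed (simp add: minkowski_zero[OF F] minkowski_zero[OF Ftm])
  hence "F = deform b \<phi>1 Ftilde" by (auto simp: deform_def vec)
  moreover have "Fbar = deform b \<phi>2 Ftilde"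
  proof
    fix y
    define s where "s = (1 / Ftilde y) *\<^sub>R forms b y"
    show "Fbar y = deform b \<phi>2 Ftilde y"
    proof (cases "y = 0")
      case False
      have eq: "(1 / \<phi>1 s) *\<^sub>R s = (1 / F y) *\<^sub>R forms b y"
        using F1[of y] by (simp add: s_def mult.commute)
      have "deform b \<phi>2 Ftilde y = Ftilde y * (\<phi>1 s * \<phi> ((1 / \<phi>1 s) *\<^sub>R s))"
        by (simp only: deform_def vec \<phi>2_def s_def)
      also have "\<dots> = (Ftilde y * \<phi>1 s) * \<phi> ((1 / F y) *\<^sub>R forms b y)"
        by (simp only: eq mult.assoc)
      also have "\<dots> = Fbar y" using F1[of y] by (simp add: Fbar deform_def vec s_def)
      finally show ?thesis by simp
    qed (simp add: Fbar deform_def minkowski_zero[OF F] minkowski_zero[OF Ftm])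
  qed
  ultimately show ?thesis using randers by blast
qed

end
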